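(* Let $C_1,C_2,\tilde{C}_1,\tilde{C}_2$ be complex analytic plane branches at $0\in\mathbb{C}^2$ with $C_1\neq C_2$ and $\tilde{C}_1\neq\tilde{C}_2$. If $Cont(C_1,C_2)\neq Cont(\tilde{C}_1,\tilde{C}_2)$, then there exists $0<\alpha<1$ such that $(C_1\cup C_2,0)$ is not $\alpha$-Hölder homeomorphic to $(\tilde{C}_1\cup\tilde{C}_2,0)$.
   Context: $\mathbb{C}^2\cong\mathbb{R}^4$ carries the Euclidean norm. A complex analytic plane branch is a germ at $0\in\mathbb{C}^2$ of an analytically irreducible complex analytic curve. Hölder equivalence: for a real $\alpha>0$, a map $f\colon U\subset\mathbb{R}^n\to\mathbb{R}^m$ is $\alpha$-Hölder if there is $c>0$ with $\|f(p)-f(q)\|\le c\|p-q\|^{\alpha}$ for all $p,q\in U$. Germs $(X,x_0)$, $(Y,y_0)$ of Euclidean subsets are $\alpha$-Hölder homeomorphic if there is a germ of homeomorphism $f\colon(X,x_0)\to(Y,y_0)$ (so $f(x_0)=y_0$) such that $f$ and $f^{-1}$ are $\alpha$-Hölder. Contact: let $\Gamma_1,\Gamma_2$ be germs at $0\in\mathbb{R}^n$ of closed subsets with $\Gamma_1\cap\Gamma_2=\{0\}$. For $r>0$ sufficiently small (and fixed small representatives of the germs) put $$f_{\Gamma_1,\Gamma_2}(r)=\inf\{\|\gamma_1-\gamma_2\| : \gamma_i\in\Gamma_i,\ \|\gamma_i\|\ge r,\ i=1,2\},$$ and define $Cont(\Gamma_1,\Gamma_2)=\lim_{r\to0^+}\dfrac{\ln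 f_{\Gamma_1,\Gamma_2}(r)}{\ln r}$. *)

theory Defs
  imports "HOL-Analysis.Analysis"
begin

text \<open>
  Germs are handled through representatives: a germ at a point is given by any set (or
  function) on the whole space, and all notions below depend only on what happens near that
  point. The plane is \<^typ>\<open>complex \<times> complex\<close>, whose norm is the Euclidean norm of
  real 4-space.
\<close>

definition same_germ :: "'a::topological_space \<Rightarrow> 'a set \<Rightarrow> 'a set \<Rightarrow> bool" where
  "same_germ x0 X Y \<longleftrightarrow> (\<forall>\<^sub>F x in nhds x0. x \<in> X \<longleftrightarrow> x \<in> Y)"


subsection \<open>Plane branches\<close>

text \<open>
  Holomorphy in two variables near the origin: the function is Frechet differentiable on a
  neighbourhood of 0 and its differential is complex linear there.
\<close>

definition holo_germ :: "(complex \<times> complex \<Rightarrow> complex) \<Rightarrow> bool" where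
  "holo_germ f \<longleftrightarrow>
     (\<forall>\<^sub>F z in nhds 0. \<exists>a b. (f has_derivative (\<lambda>(u, v). a * u + b * v)) (at z))"

definition holo_germ_unit :: "(complex \<times> complex \<Rightarrow> complex) \<Rightarrow> bool" where
  "holo_germ_unit f \<longleftrightarrow>
     holo_germ f \<and> (\<exists>g. holo_germ g \<and> (\<forall>\<^sub>F z in nhds 0. f z * g z = 1))"

text \<open>
  Irreducibility in the ring of germs of holomorphic functions at the origin; the clauses are
  those of \<^const>\<open>irreducible\<close>, with equality of functions replaced by equality of germs.
\<close>

definition holo_germ_irreducible :: "(complex \<times> complex \<Rightarrow> complex) \<Rightarrow> bool" where
  "holo_germ_irreducible f \<longleftrightarrow>
     holo_germ f \<and> \<not> (\<forall>\<^sub>F z in nhds 0. f z = 0) \<and> \<not> holo_germ_unit f \<and>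
     (\<forall>g h. holo_germ g \<longrightarrow> holo_germ h \<longrightarrow> (\<forall>\<^sub>F z in nhds 0. f z = g z * h z) \<longrightarrow>
        holo_germ_unit g \<or> holo_germ_unit h)"

text \<open>An analytically irreducible curve germ is the zero set of an irreducible germ.\<close>

definition plane_branch :: "(complex \<times> complex) set \<Rightarrow> bool" where
  "plane_branch C \<longleftrightarrow> (\<exists>f. holo_germ_irreducible f \<and> same_germ 0 C {z. f z = 0})"


subsection \<open>Hoelder homeomorphic germs\<close>

definition holder_on ::
  "real \<Rightarrow> 'a::real_normed_vector set \<Rightarrow> ('a \<Rightarrow> 'b::real_normed_vector) \<Rightarrow> bool" where
  "holder_on \<alpha> U f \<longleftrightarrow>
     \<alpha> > 0 \<and> (\<exists>c>0. \<forall>p\<in>U. \<forall>q\<in>U. norm (f p - f q) \<le> c * norm (p - q) powr \<alpha>)"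

definition holder_homeomorphic_germs ::
  "real \<Rightarrow> 'a::real_normed_vector set \<Rightarrow> 'a \<Rightarrow> 'b::real_normed_vector set \<Rightarrow> 'b \<Rightarrow> bool" where
  "holder_homeomorphic_germs \<alpha> X x0 Y y0 \<longleftrightarrow>
     (\<exists>U V f g. open U \<and> x0 \<in> U \<and> open V \<and> y0 \<in> V \<and>
        homeomorphism (X \<inter> U) (Y \<inter> V) f g \<and> f x0 = y0 \<and>
        holder_on \<alpha> (X \<inter> U) f \<and> holder_on \<alpha> (Y \<inter> V) g)"


subsection \<open>Contact\<close>

definition contact_fun ::
  "'a::real_normed_vector set \<Rightarrow> 'a set \<Rightarrow> real \<Rightarrow> real" where
  "contact_fun \<Gamma>1 \<Gamma>2 r =
     Inf {norm (x - y) | x y. x \<in> \<Gamma>1 \<and> y \<in> \<Gamma>2 \<and> norm x \<ge> r \<and> norm y \<ge> r}"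

text \<open>
  The function above has to be formed from small representatives, here the intersections with
  the closed ball of radius \<open>\<epsilon>\<close>; the contact is the limit obtained for every sufficiently
  small \<open>\<epsilon>\<close>. If there is no such real limit, the value is unspecified.
\<close>

definition contact :: "'a::real_normed_vector set \<Rightarrow> 'a set \<Rightarrow> real" where
  "contact \<Gamma>1 \<Gamma>2 =
     (THE l. \<forall>\<^sub>F \<epsilon> in at_right 0.
        ((\<lambda>r. ln (contact_fun (\<Gamma>1 \<inter> cball 0 \<epsilon>) (\<Gamma>2 \<inter> cball 0 \<epsilon>) r) / ln r)
           \<longlongrightarrow> l) (at_right 0))"

end

theory Submission
  imports Defs "HOL-Complex_Analysis.Complex_Analysis"
begin

text \<open>
  If \<open>f\<close> and its inverse are \<open>\<alpha>\<close>-Hoelder, then \<open>norm (f x)\<close> is at least of order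
  \<open>norm x powr (1 / \<alpha>)\<close>, while distances between the two branches are distorted by at most the power
  \<open>\<alpha>\<close>. Hence, once \<open>f\<close> is known to match the branches of the two unions, upper and lower limits of
  \<open>ln (contact_fun r) / ln r\<close> change at most by factors \<open>\<alpha>\<^sup>2\<close> and \<open>1 / \<alpha>\<^sup>2\<close>; letting \<open>\<alpha>\<close> tend to 1
  shows that a number is the limit for one pair if and only if it is the limit for the other. No
  existence of the limits (and no Puiseux expansion) is needed: if neither exists, both contacts
  are the same unspecified value.

  The branches are matched because a punctured branch is connected and two distinct branches
  meet only at the origin. Both follow from irreducibility. Put \<open>f\<close> in general position, so that over
  a small disc in \<open>z\<close> its zeros form a branched cover. For a part of the punctured
  cover that is both open and closed, the power sums of its roots are holomorphic in \<open>z\<close> by the argument principle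
  and bounded near 0, so by Newton's identities the monic polynomial with these roots has
  holomorphic coefficients and divides \<open>f\<close>; irreducibility forces the part to be empty or everything.
  Applied to the common zeros of two germs this gives the second claim.
\<close>

subsection \<open>Holomorphic functions with parameters\<close>

text \<open>Contour integrals with a parameter naturally yield functions that are jointly continuous
  and separately holomorphic, so the constructions stay with this notion; an Osgood-type lemma
  returns to Frechet differentiability when irreducibility is applied. Roots are counted with
  multiplicity and only z = 0 is punctured: the cover may ramify over other points, and constancy of
  the weighted counts replaces the removal of a discriminant. The delicate claim is that the common
  zeros with a second germ \<phi> form an open part of the cover. Vanishing of \<phi> at one root
  says nothing about the roots into which it splits nearby, so openness is read off from the degree
  of a polynomial with holomorphic coefficients, over a disc small enough to exclude isolated common
  zeros. In the metric half the homeomorphism and its constants may change with \<alpha>.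
  Multiplicative constants disappear on division by \<open>ln r\<close>, so each \<alpha> is treated
  separately before \<alpha> moves to 1.\<close>

lemma continuous_on_contour_integral_circlepath:
  fixes F :: "'a::topological_space \<Rightarrow> complex \<Rightarrow> complex"
  assumes cont: "continuous_on (S \<times> sphere c r) (\<lambda>(x, s). F x s)" and r: "0 \<le> r"
  shows "continuous_on S (\<lambda>x. contour_integral (circlepath c r) (F x))"
proof -
  let ?D = "\<lambda>t::real. 2 * of_real pi * \<i> * of_real r * exp (2 * of_real pi * \<i> * of_real t)"
  have 1: "contour_integral (circlepath c r) (F x) =
      integral (cbox 0 1) (\<lambda>t. F x (circlepath c r t) * ?D t)" for x
    unfolding contour_integral_integral
    by (auto intro!: integral_cong simp: vector_derivative_circlepath)
  have "continuous_on (S \<times> cbox 0 1) (\<lambda>p. (fst p, circlepath c r (snd p)))"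
    unfolding circlepath by (intro continuous_intros)
  moreover have "(\<lambda>p. (fst p, circlepath c r (snd p))) ` (S \<times> cbox 0 1) \<subseteq> S \<times> sphere c r"
    using r path_image_circlepath_nonneg[of r c] by (auto simp: path_image_def image_subset_iff)
  ultimately have "continuous_on (S \<times> cbox 0 1) (\<lambda>p. F (fst p) (circlepath c r (snd p)))"
    using continuous_on_compose2[OF cont] by (fastforce simp: case_prod_beta)
  then have "continuous_on (S \<times> cbox 0 1) (\<lambda>(x, t). F x (circlepath c r t) * ?D t)"
    unfolding case_prod_beta by (intro continuous_intros) auto
  then show ?thesis
    unfolding 1 by (rule integral_continuous_on_param)
qed

text \<open>Cauchy's formula on one circle around z0 writes the derivative, for all z inside that
  circle, as an integral with jointly continuous integrand.\<close>

lemma continuous_on_deriv_param: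
  fixes F :: "complex \<Rightarrow> 'a::t2_space \<Rightarrow> complex"
  assumes cont: "continuous_on (U \<times> T) (\<lambda>(z, t). F z t)" and U: "open U"
    and hol: "\<And>t. t \<in> T \<Longrightarrow> (\<lambda>z. F z t) holomorphic_on U"
  shows "continuous_on (U \<times> T) (\<lambda>(z, t). deriv (\<lambda>z. F z t) z)"
proof -
  have "continuous (at p within U \<times> T) (\<lambda>(z, t). deriv (\<lambda>z. F z t) z)" if pUT: "p \<in> U \<times> T" for p
  proof -
    obtain z0 t0 where p: "p = (z0, t0)" "z0 \<in> U" "t0 \<in> T" using pUT by auto
    obtain d where d: "d > 0" "cball z0 d \<subseteq> U"
      using U p open_contains_cball by blast
    have F: "continuous_on X (\<lambda>x. F (f x) (g x))" if "continuous_on X f" "continuous_on X g"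
      "\<And>x. x \<in> X \<Longrightarrow> f x \<in> U \<and> g x \<in> T" for X :: "'z::topological_space set" and f g
      using continuous_on_compose2[OF cont continuous_on_Pair[OF that(1,2)]] that(3)
      by (auto simp: image_subset_iff)
    have "continuous_on ((ball z0 d \<times> T) \<times> sphere z0 d)
        (\<lambda>(q, s). (\<lambda>q s. F s (snd q) / (s - fst q)\<^sup>2) q s)"
      unfolding case_prod_beta
      by (intro continuous_intros F) (use d in \<open>auto simp: dist_commute\<close>)
    then have "continuous_on (ball z0 d \<times> T)
        (\<lambda>q. contour_integral (circlepath z0 d) (\<lambda>s. F s (snd q) / (s - fst q)\<^sup>2))"
      by (rule continuous_on_contour_integral_circlepath) (use d in auto)
    then have "continuous_on (ball z0 d \<times> T) (\<lambda>q. 1 / (2 * of_real pi * \<i>) *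
        contour_integral (circlepath z0 d) (\<lambda>s. F s (snd q) / (s - fst q)\<^sup>2))"
      by (intro continuous_intros)
    moreover have "deriv (\<lambda>z. F z t) z = 1 / (2 * of_real pi * \<i>) *
        contour_integral (circlepath z0 d) (\<lambda>s. F s t / (s - z)\<^sup>2)"
      if "z \<in> ball z0 d" "t \<in> T" for z t
    proof (rule DERIV_imp_deriv, rule Cauchy_derivative_integral_circlepath(2))
      show "continuous_on (cball z0 d) (\<lambda>z. F z t)"
        using hol[OF that(2)] d holomorphic_on_imp_continuous_on holomorphic_on_subset by blast
      show "(\<lambda>z. F z t) holomorphic_on ball z0 d"
        using hol[OF that(2)] d ball_subset_cball holomorphic_on_subset by blast
    qed (use that in auto)
    ultimately have "continuous_on (ball z0 d \<times> T) (\<lambda>(z, t). deriv (\<lambda>z. F z t) z)"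
      by (elim continuous_on_eq) auto
    then have "continuous (at p within ball z0 d \<times> T) (\<lambda>(z, t). deriv (\<lambda>z. F z t) z)"
      using p d by (auto simp: continuous_on_eq_continuous_within)
    moreover have "at p within ball z0 d \<times> T = at p within U \<times> T"
      by (rule at_within_nhd[of _ "ball z0 d \<times> UNIV"])
         (use p d ball_subset_cball[of z0 d] in \<open>auto simp: open_Times\<close>)
    ultimately show ?thesis by simp
  qed
  then show ?thesis by (simp add: continuous_on_eq_continuous_within)
qed

text \<open>Differentiation under the integral sign. The Leibniz rule asks for a jointly continuous
  z-derivative of the integrand, which \<open>continuous_on_deriv_param\<close> supplies.\<close>

lemma holomorphic_on_contour_integral_circlepath:
  assumes cont: "continuous_on (U \<times> sphere c r) (\<lambda>(z, s). F z s)" and U: "open U" and r: "0 \<le> r"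
    and hol: "\<And>s. s \<in> sphere c r \<Longrightarrow> (\<lambda>z. F z s) holomorphic_on U"
  shows "(\<lambda>z. contour_integral (circlepath c r) (F z)) holomorphic_on U"
proof -
  let ?D = "\<lambda>t::real. 2 * of_real pi * \<i> * of_real r * exp (2 * of_real pi * \<i> * of_real t)"
  have 1: "contour_integral (circlepath c r) (F x) =
      integral (cbox 0 1) (\<lambda>t. F x (circlepath c r t) * ?D t)" for x
    unfolding contour_integral_integral
    by (auto intro!: integral_cong simp: vector_derivative_circlepath)
  have cS: "circlepath c r t \<in> sphere c r" if "t \<in> cbox 0 1" for t
    using that r path_image_circlepath_nonneg[of r c] by (auto simp: path_image_def)
  have cP: "continuous_on X (circlepath c r)" for X
    unfolding circlepath by (intro continuous_intros)
  have comp: "continuous_on (V \<times> cbox 0 1) (\<lambda>p. G (fst p) (circlepath c r (snd p)))"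
    if "continuous_on (U \<times> sphere c r) (\<lambda>(z, s). G z s)" "V \<subseteq> U"
    for G :: "complex \<Rightarrow> complex \<Rightarrow> complex" and V
  proof -
    have "continuous_on (V \<times> cbox 0 1) (\<lambda>p. (fst p, circlepath c r (snd p)))"
      unfolding circlepath by (intro continuous_intros)
    then have "continuous_on (V \<times> cbox 0 1)
        (\<lambda>p. (\<lambda>(z, s). G z s) (fst p, circlepath c r (snd p)))"
      by (rule continuous_on_compose2[OF that(1)]) (use cS that(2) in auto)
    then show ?thesis by simp
  qed
  note cd = continuous_on_deriv_param[OF cont U hol]
  show ?thesis
  proof (rule analytic_imp_holomorphic, subst analytic_on_open[OF U], unfold holomorphic_on_def,
      intro ballI)
    fix z0 assume "z0 \<in> U"
    then obtain d where d: "d > 0" "ball z0 d \<subseteq> U" using U open_contains_ball by blast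
    have "(\<lambda>z. integral (cbox 0 1) (\<lambda>t. F z (circlepath c r t) * ?D t)) holomorphic_on ball z0 d"
    proof (rule leibniz_rule_holomorphic)
      show "((\<lambda>z. F z (circlepath c r t) * ?D t) has_field_derivative
          deriv (\<lambda>z. F z (circlepath c r t)) z * ?D t) (at z within ball z0 d)"
        if "z \<in> ball z0 d" "t \<in> cbox 0 1" for z t
        by (rule DERIV_cmult_right)
          (use holomorphic_derivI[OF hol[OF cS[OF that(2)]] U] that d in \<open>auto intro: DERIV_subset\<close>)
      show "(\<lambda>t. F z (circlepath c r t) * ?D t) integrable_on cbox 0 1" if "z \<in> ball z0 d" for z
      proof (rule integrable_continuous)
        have "continuous_on (cbox 0 1) (\<lambda>t. (\<lambda>(z, s). F z s) (z, circlepath c r t))"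
          by (rule continuous_on_compose2[OF cont])
             (use that d cS cP in \<open>auto intro!: continuous_intros\<close>)
        then show "continuous_on (cbox 0 1) (\<lambda>t. F z (circlepath c r t) * ?D t)"
          by (intro continuous_intros) simp
      qed
      show "continuous_on (ball z0 d \<times> cbox 0 1)
          (\<lambda>(z, t). deriv (\<lambda>z. F z (circlepath c r t)) z * ?D t)"
        unfolding case_prod_beta
        using comp[of "\<lambda>z s. deriv (\<lambda>z. F z s) z" "ball z0 d"] cd d
        by (intro continuous_intros) (auto simp: case_prod_beta)
    qed auto
    then have "(\<lambda>z. contour_integral (circlepath c r) (F z)) holomorphic_on ball z0 d"
      unfolding 1 .
    then show "(\<lambda>z. contour_integral (circlepath c r) (F z)) field_differentiable at z0 within U"
      using d by (meson centre_in_ball field_differentiable_at_within holomorphic_on_imp_differentiable_at open_ball)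
  qed
qed

text \<open>Osgood's lemma. The w-derivative is jointly continuous by Cauchy's formula, and one
  continuous partial derivative together with the other one at the point gives differentiability.
  This places functions built from integrals in the ring in which irreducibility is stated.\<close>

lemma has_derivative_separately_holomorphic:
  fixes f :: "complex \<times> complex \<Rightarrow> complex"
  assumes cont: "continuous_on (U \<times> V) f" and U: "open U" and V: "open V"
    and h1: "\<And>w. w \<in> V \<Longrightarrow> (\<lambda>z. f (z, w)) holomorphic_on U"
    and h2: "\<And>z. z \<in> U \<Longrightarrow> (\<lambda>w. f (z, w)) holomorphic_on V"
    and p: "(z0, w0) \<in> U \<times> V"
  shows "\<exists>a b. (f has_derivative (\<lambda>(u, v). a * u + b * v)) (at (z0, w0))"
proof -
  obtain d where d: "d > 0" "ball w0 d \<subseteq> V" using V p open_contains_ball by blast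
  have sw: "continuous_on (V \<times> U) (\<lambda>(w, z). f (z, w))"
    unfolding case_prod_beta
    by (rule continuous_on_compose2[OF cont]) (auto intro!: continuous_intros)
  have "continuous_on (V \<times> U) (\<lambda>(w, z). deriv (\<lambda>w. f (z, w)) w)"
    by (rule continuous_on_deriv_param[OF sw V h2])
  then have "continuous_on (U \<times> ball w0 d) (\<lambda>p. (\<lambda>(w, z). deriv (\<lambda>w. f (z, w)) w) (snd p, fst p))"
    by (rule continuous_on_compose2) (use d in \<open>auto intro!: continuous_intros\<close>)
  then have cw: "continuous_on (U \<times> ball w0 d) (\<lambda>(z, w). deriv (\<lambda>w. f (z, w)) w)"
    by (simp add: case_prod_beta)
  have op: "open (U \<times> ball w0 d)" using U by (intro open_Times) auto
  have "((\<lambda>(x, y). (\<lambda>x y. f (x, y)) x y) has_derivative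
      (\<lambda>(tx, ty). deriv (\<lambda>z. f (z, w0)) z0 * tx + blinfun_mult_right (deriv (\<lambda>w. f (z0, w)) w0) ty))
     (at (z0, w0) within U \<times> ball w0 d)"
  proof (rule has_derivative_partialsI)
    show "((\<lambda>x. f (x, w0)) has_derivative (*) (deriv (\<lambda>z. f (z, w0)) z0)) (at z0 within U)"
      using holomorphic_derivI[OF h1 U, of w0 z0] p
      by (auto simp: has_field_derivative_def intro: has_derivative_at_withinI)
    show "((\<lambda>y. f (x, y)) has_derivative blinfun_apply (blinfun_mult_right (deriv (\<lambda>w. f (x, w)) y)))
        (at y within ball w0 d)" if "x \<in> U" "y \<in> ball w0 d" for x y
      using holomorphic_derivI[OF h2 V, of x y] that d
      by (auto simp: has_field_derivative_def intro: has_derivative_at_withinI)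
    have "continuous (at (z0, w0)) (\<lambda>(z, w). deriv (\<lambda>w. f (z, w)) w)"
      using cw op p d by (simp add: continuous_on_eq_continuous_at)
    then have "isCont (\<lambda>p. blinfun_mult_right ((\<lambda>(z, w). deriv (\<lambda>w. f (z, w)) w) p)) (z0, w0)"
      using bounded_linear.isCont[OF bounded_linear_blinfun_mult_right] by blast
    then show "continuous (at (z0, w0) within U \<times> ball w0 d)
        (\<lambda>(x, y). blinfun_mult_right (deriv (\<lambda>w. f (x, w)) y))"
      unfolding case_prod_beta by (rule continuous_at_imp_continuous_at_within)
  qed (use d in auto)
  then have "(f has_derivative
      (\<lambda>(tx, ty). deriv (\<lambda>z. f (z, w0)) z0 * tx + deriv (\<lambda>w. f (z0, w)) w0 * ty))
     (at (z0, w0) within U \<times> ball w0 d)"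
    by (simp add: case_prod_beta)
  then have "(f has_derivative
      (\<lambda>(tx, ty). deriv (\<lambda>z. f (z, w0)) z0 * tx + deriv (\<lambda>w. f (z0, w)) w0 * ty)) (at (z0, w0))"
    using op p d by (simp add: at_within_open[of "(z0,w0)" "U \<times> ball w0 d"])
  then show ?thesis by blast
qed

text \<open>The logarithmic derivative of the product generates the power sums.\<close>

lemma newton_fps:
  fixes a :: "'i \<Rightarrow> 'a::{comm_ring_1, idom}" and m :: "'i \<Rightarrow> nat"
  assumes "finite I"
  shows "fps_deriv (\<Prod>i\<in>I. (1 - fps_const (a i) * fps_X) ^ m i) =
    - ((\<Prod>i\<in>I. (1 - fps_const (a i) * fps_X) ^ m i) *
      Abs_fps (\<lambda>j. \<Sum>i\<in>I. of_nat (m i) * a i ^ Suc j))"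
  using assms
proof (induction I)
  case empty
  then show ?case by (simp add: fps_zero_def[symmetric])
next
  case (insert i I)
  let ?L = "1 - fps_const (a i) * fps_X"
  let ?G = "Abs_fps (\<lambda>j. a i ^ Suc j)"
  \<comment> \<open>\<open>?G\<close> is the geometric series a / (1 - a X), which is minus the
    logarithmic derivative of the linear factor \<open>?L\<close>.\<close>
  have LG: "?L * ?G = fps_const (a i)"
  proof (rule fps_ext)
    fix n show "(?L * ?G) $ n = fps_const (a i) $ n"
      by (cases n) (auto simp: algebra_simps fps_X_mult_nth)
  qed
  have pow: "fps_deriv (?L ^ n) = - (?L ^ n * (of_nat n * ?G))" for n
  proof (induction n)
    case (Suc n)
    have "fps_deriv (?L ^ Suc n) = - fps_const (a i) * ?L ^ n + ?L * fps_deriv (?L ^ n)"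
      by simp
    also have "\<dots> = - (?L * ?G) * ?L ^ n - ?L * (?L ^ n * (of_nat n * ?G))"
      unfolding Suc.IH LG by simp
    finally show ?case by (simp add: algebra_simps)
  qed simp
  have "Abs_fps (\<lambda>j. \<Sum>i\<in>insert i I. of_nat (m i) * a i ^ Suc j) =
      of_nat (m i) * ?G + Abs_fps (\<lambda>j. \<Sum>i\<in>I. of_nat (m i) * a i ^ Suc j)"
    using insert.hyps by (intro fps_ext) (simp add: fps_of_nat[symmetric] del: fps_of_nat)
  note e = this
  show ?case
    unfolding e prod.insert[OF insert.hyps] fps_deriv_mult insert.IH pow
    by (simp only: algebra_simps mult_minus_right minus_add_distrib)
qed

text \<open>Coefficient k of the preceding identity. The polynomial has constant coefficient 1, and
  in characteristic 0 the factor \<open>Suc k\<close> can be cancelled, so the power sums determine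
  all coefficients recursively, whatever the number of roots.\<close>

lemma newton_poly:
  fixes a :: "'i \<Rightarrow> 'a::{comm_ring_1, idom}" and m :: "'i \<Rightarrow> nat"
  assumes "finite I"
  defines "P \<equiv> \<Prod>i\<in>I. [:1, - a i:] ^ m i"
  shows "of_nat (Suc k) * coeff P (Suc k) =
    - (\<Sum>j\<le>k. coeff P j * (\<Sum>i\<in>I. of_nat (m i) * a i ^ Suc (k - j)))"
proof -
  have "fps_of_poly P = (\<Prod>i\<in>I. (1 - fps_const (a i) * fps_X) ^ m i)"
    unfolding P_def by (simp add: fps_of_poly_prod fps_of_poly_power fps_of_poly_pCons fps_const_neg[symmetric] del: fps_const_neg)
  note e = this
  have "fps_deriv (fps_of_poly P) = - (fps_of_poly P *
      Abs_fps (\<lambda>j. \<Sum>i\<in>I. of_nat (m i) * a i ^ Suc j))"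
    unfolding e by (rule newton_fps[OF assms(1)])
  from arg_cong[OF this, of "\<lambda>F. fps_nth F k"] show ?thesis
    by (simp add: fps_mult_nth atLeast0AtMost)
qed

text \<open>Returns from factors 1 - a X to the monic polynomial with roots a: for w \<noteq> 0
  evaluate P at 1 / w and clear denominators; the point w = 0 follows by continuity.\<close>

lemma poly_prod_linear_reversed:
  fixes a :: "'i \<Rightarrow> complex" and m :: "'i \<Rightarrow> nat"
  assumes "finite I"
  defines "P \<equiv> \<Prod>i\<in>I. [:1, - a i:] ^ m i"
  shows "(\<Sum>k\<le>sum m I. coeff P k * w ^ (sum m I - k)) = (\<Prod>i\<in>I. (w - a i) ^ m i)"
proof -
  let ?l = "\<lambda>w. \<Sum>k\<le>sum m I. coeff P k * w ^ (sum m I - k)"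
  let ?r = "\<lambda>w. \<Prod>i\<in>I. (w - a i) ^ m i"
  have "degree P \<le> (\<Sum>i\<in>I. degree ([:1, - a i:] ^ m i))"
    unfolding P_def by (rule degree_prod_sum_le[OF assms(1), unfolded o_def])
  also have "\<dots> \<le> sum m I"
  proof (rule sum_mono)
    show "degree ([:1, - a i:] ^ m i) \<le> m i" for i
      by (rule order_trans[OF degree_power_le]) simp
  qed
  finally have deg: "degree P \<le> sum m I" .
  have eq: "?l w = ?r w" if w: "w \<noteq> 0" for w
  proof -
    have "?l w = (\<Sum>k\<le>sum m I. w ^ sum m I * (coeff P k * (1 / w) ^ k))"
    proof (rule sum.cong)
      fix k assume "k \<in> {..sum m I}"
      then have "w ^ sum m I = w ^ (sum m I - k) * w ^ k" by (simp flip: power_add)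
      then show "coeff P k * w ^ (sum m I - k) = w ^ sum m I * (coeff P k * (1 / w) ^ k)"
        using w by (simp add: field_simps)
    qed simp
    also have "\<dots> = w ^ sum m I * poly P (1 / w)"
      unfolding poly_altdef sum_distrib_left using deg
      by (intro sum.mono_neutral_right) (auto simp: coeff_eq_0)
    also have "\<dots> = (\<Prod>i\<in>I. w ^ m i * (1 - a i / w) ^ m i)"
      unfolding P_def by (simp add: power_sum prod.distrib poly_prod)
    also have "\<dots> = ?r w"
      using w by (simp add: power_mult_distrib[symmetric] right_diff_distrib)
    finally show ?thesis .
  qed
  have "(?l \<longlongrightarrow> ?l 0) (at 0)" "(?r \<longlongrightarrow> ?r 0) (at 0)"
    by (intro tendsto_intros)+
  moreover have "\<forall>\<^sub>F w in at 0. ?l w = ?r w"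
    using eq by (simp add: eventually_at_filter)
  ultimately have "?l 0 = ?r 0"
    by (intro tendsto_unique[OF trivial_limit_at, of ?l])
       (auto elim: Lim_transform_eventually simp: eq_commute)
  with eq show ?thesis by (cases "w = 0") auto
qed

subsection \<open>Zeros of a Weierstrass-regular function\<close>

text \<open>The radius R exceeds \<rho> so that the circle of radius \<rho> lies in the domain of
  holomorphy. Non-vanishing on that circle keeps roots from entering or leaving the disc as z
  varies, and the last condition makes all roots tend to 0 with z.\<close>

locale branched_cover =
  fixes f :: "complex \<times> complex \<Rightarrow> complex" and R \<delta> \<rho> :: real
  assumes pos: "0 < \<delta>" "0 < \<rho>" "\<rho> < R"
    and cont: "continuous_on (ball 0 \<delta> \<times> ball 0 R) f"
    and hol1: "\<And>w. w \<in> ball 0 R \<Longrightarrow> (\<lambda>z. f (z, w)) holomorphic_on ball 0 \<delta>"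
    and hol2: "\<And>z. z \<in> ball 0 \<delta> \<Longrightarrow> (\<lambda>w. f (z, w)) holomorphic_on ball 0 R"
    and boundary: "\<And>z w. z \<in> ball 0 \<delta> \<Longrightarrow> norm w = \<rho> \<Longrightarrow> f (z, w) \<noteq> 0"
    and centre: "\<And>w. norm w \<le> \<rho> \<Longrightarrow> f (0, w) = 0 \<longleftrightarrow> w = 0"
begin

definition roots :: "complex \<Rightarrow> complex set" where
  "roots z = {w. norm w < \<rho> \<and> f (z, w) = 0}"

definition root_mult :: "complex \<Rightarrow> complex \<Rightarrow> nat" where
  "root_mult z w = nat (zorder (\<lambda>w. f (z, w)) w)"

lemma ball_sub: "ball 0 \<rho> \<subseteq> ball 0 R" "cball 0 \<rho> \<subseteq> ball 0 R" "sphere 0 \<rho> \<subseteq> ball 0 R"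
  using pos by auto

lemma nonzero_on_disc: "z \<in> ball 0 \<delta> \<Longrightarrow> \<exists>w\<in>ball 0 R. f (z, w) \<noteq> 0"
  using boundary[of z "of_real \<rho>"] pos by (intro bexI[of _ "of_real \<rho>"]) auto

lemma finite_roots: assumes z: "z \<in> ball 0 \<delta>" shows "finite (roots z)"
proof (cases "(\<lambda>w. f (z, w)) constant_on ball 0 R")
  case True
  then have "roots z = {}"
    using nonzero_on_disc[OF z] ball_sub by (force simp: constant_on_def roots_def)
  then show ?thesis by simp
next
  case False
  then have "finite {w \<in> cball 0 \<rho>. f (z, w) = 0}"
    using holomorphic_compact_finite_zeros[OF hol2[OF z] _ _ compact_cball ball_sub(2)] by simp
  then show ?thesis by (rule finite_subset[rotated]) (auto simp: roots_def)
qed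

lemma roots_0: "roots 0 = {0}"
  using centre pos by (auto simp: roots_def)

lemma zorder_root:
  assumes z: "z \<in> ball 0 \<delta>" and w: "w \<in> roots z"
  shows "zorder (\<lambda>w. f (z, w)) w = int (root_mult z w)" and "root_mult z w > 0"
proof -
  have "zorder (\<lambda>w. f (z, w)) w > 0"
    using zorder_exist_zero[OF hol2[OF z] _ _ _ nonzero_on_disc[OF z], of w] w pos
    by (auto simp: roots_def)
  then show "zorder (\<lambda>w. f (z, w)) w = int (root_mult z w)" and "root_mult z w > 0"
    by (auto simp: root_mult_def)
qed

section \<open>Separating the roots over a small disc\<close>

text \<open>Around each root over z0 lies a disc of radius \<epsilon>, and \<eta> limits the motion
  of z so that all roots stay inside these discs. The closed discs are disjoint, so their boundary
  circles avoid the roots over every nearby z and serve as contours independent of z.\<close>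

definition isolating :: "complex \<Rightarrow> real \<Rightarrow> real \<Rightarrow> bool" where
  "isolating z0 \<epsilon> \<eta> \<longleftrightarrow> 0 < \<epsilon> \<and> 0 < \<eta> \<and> ball z0 \<eta> \<subseteq> ball 0 \<delta> \<and>
     (\<forall>a\<in>roots z0. cball a \<epsilon> \<subseteq> ball 0 \<rho>) \<and>
     (\<forall>a\<in>roots z0. \<forall>b\<in>roots z0. a \<noteq> b \<longrightarrow> cball a \<epsilon> \<inter> cball b \<epsilon> = {}) \<and>
     (\<forall>z\<in>ball z0 \<eta>. \<forall>w\<in>cball 0 \<rho> - (\<Union>a\<in>roots z0. ball a \<epsilon>). f (z, w) \<noteq> 0)"

lemma isolating_mono: "isolating z0 \<epsilon> \<eta> \<Longrightarrow> 0 < \<eta>' \<Longrightarrow> \<eta>' \<le> \<eta> \<Longrightarrow> isolating z0 \<epsilon> \<eta>'"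
  unfolding isolating_def using subset_ball[of \<eta>' \<eta> z0] by blast

text \<open>Outside the \<epsilon>-discs the closed disc of radius \<rho> is compact and
  \<open>f (z0, w)\<close> has no zero there; the tube lemma extends this to a neighbourhood of
  z0.\<close>

lemma exists_isolating:
  assumes z0: "z0 \<in> ball 0 \<delta>" and e: "0 < e"
  obtains \<epsilon> \<eta> where "isolating z0 \<epsilon> \<eta>" "\<epsilon> < e"
proof -
  note fin = finite_roots[OF z0]
  have "\<exists>d>0. \<forall>\<epsilon>. \<epsilon> \<le> d \<longrightarrow> cball a \<epsilon> \<subseteq> ball 0 \<rho>" if "a \<in> roots z0" for a
  proof -
    have "a \<in> ball 0 \<rho>" using that by (auto simp: roots_def)
    then obtain d where "d > 0" "cball a d \<subseteq> ball 0 \<rho>"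
      using open_contains_cball open_ball by blast
    then show ?thesis by (intro exI[of _ d]) (auto dest: subset_cball)
  qed
  then obtain d1 where d1: "\<And>a. a \<in> roots z0 \<Longrightarrow> 0 < d1 a \<and> (\<forall>\<epsilon>\<le>d1 a. cball a \<epsilon> \<subseteq> ball 0 \<rho>)"
    by metis
  define Pr where "Pr = {(a, b). a \<in> roots z0 \<and> b \<in> roots z0 \<and> a \<noteq> b}"
  have "finite Pr"
    by (rule finite_subset[of _ "roots z0 \<times> roots z0"]) (auto simp: Pr_def fin)
  \<comment> \<open>Half of e makes the final bound strict and keeps the set nonempty; a third of
    each mutual distance keeps even the closed discs disjoint.\<close>
  define \<epsilon> where "\<epsilon> = Min (insert (e / 2) (d1 ` roots z0 \<union> (\<lambda>(a, b). dist a b / 3) ` Pr))"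
  have F: "finite (insert (e / 2) (d1 ` roots z0 \<union> (\<lambda>(a, b). dist a b / 3) ` Pr))"
    using fin \<open>finite Pr\<close> by auto
  have "\<epsilon> > 0"
    unfolding \<epsilon>_def using F e d1 by (subst Min_gr_iff) (auto simp: Pr_def)
  have "\<epsilon> \<le> e / 2" unfolding \<epsilon>_def by (rule Min_le[OF F]) auto
  have le1: "\<epsilon> \<le> d1 a" if "a \<in> roots z0" for a
    unfolding \<epsilon>_def by (rule Min_le[OF F]) (use that in auto)
  have le2: "\<epsilon> \<le> dist a b / 3" if "a \<in> roots z0" "b \<in> roots z0" "a \<noteq> b" for a b
    unfolding \<epsilon>_def by (rule Min_le[OF F]) (use that in \<open>force simp: Pr_def\<close>)
  have disj: "cball a \<epsilon> \<inter> cball b \<epsilon> = {}" if "a \<in> roots z0" "b \<in> roots z0" "a \<noteq> b" for a b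
  proof (rule ccontr)
    assume "cball a \<epsilon> \<inter> cball b \<epsilon> \<noteq> {}"
    then obtain x where "dist a x \<le> \<epsilon>" "dist b x \<le> \<epsilon>" by auto
    then have "dist a b \<le> 2 * \<epsilon>" using dist_triangle2[of a b x] by linarith
    then show False using le2[OF that] \<open>\<epsilon> > 0\<close> by linarith
  qed
  define K where "K = cball 0 \<rho> - (\<Union>a\<in>roots z0. ball a \<epsilon>)"
  have K: "compact K" unfolding K_def by (intro compact_diff open_UN) auto
  define Op where "Op = (ball 0 \<delta> \<times> ball 0 R) \<inter> f -` (- {0})"
  have "open Op" unfolding Op_def
    by (rule continuous_open_preimage[OF cont]) (auto intro: open_Times)
  moreover have "{z0} \<times> K \<subseteq> Op"
  proof -
    have "f (z0, w) \<noteq> 0" if "w \<in> K" for w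
    proof
      assume 0: "f (z0, w) = 0"
      then have "norm w \<noteq> \<rho>" using boundary[OF z0] by auto
      then have "w \<in> roots z0" using 0 that by (auto simp: K_def roots_def)
      then show False using that \<open>\<epsilon> > 0\<close> by (auto simp: K_def)
    qed
    then show ?thesis using z0 ball_sub by (auto simp: Op_def K_def)
  qed
  ultimately have "\<exists>U V. open U \<and> open V \<and> z0 \<in> U \<and> K \<subseteq> V \<and> U \<times> V \<subseteq> Op"
    using tube_lemma_right[of euclidean euclidean Op K z0] K
    by (simp add: euclidean_product_topology)
  then obtain U V where UV: "open U" "z0 \<in> U" "K \<subseteq> V" "U \<times> V \<subseteq> Op" by blast
  have "open (U \<inter> ball 0 \<delta>)" "z0 \<in> U \<inter> ball 0 \<delta>" using UV z0 by auto
  then obtain \<eta> where \<eta>: "\<eta> > 0" "ball z0 \<eta> \<subseteq> U \<inter> ball 0 \<delta>"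
    using open_contains_ball by blast
  have "isolating z0 \<epsilon> \<eta>"
    unfolding isolating_def
  proof (intro conjI ballI impI)
    show "f (z, w) \<noteq> 0" if "z \<in> ball z0 \<eta>" "w \<in> cball 0 \<rho> - (\<Union>a\<in>roots z0. ball a \<epsilon>)" for z w
    proof -
      have "(z, w) \<in> Op" using that \<eta> UV unfolding K_def[symmetric] by blast
      then show ?thesis by (simp add: Op_def)
    qed
    show "ball z0 \<eta> \<subseteq> ball 0 \<delta>" using \<eta> by blast
    show "cball a \<epsilon> \<subseteq> ball 0 \<rho>" if "a \<in> roots z0" for a
      using d1[OF that] le1[OF that] by blast
  qed (use \<open>\<epsilon> > 0\<close> \<eta> disj in simp_all)
  with \<open>\<epsilon> \<le> e / 2\<close> e show thesis by (intro that[of \<epsilon> \<eta>]) auto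
qed

lemma isolating_roots:
  assumes "isolating z0 \<epsilon> \<eta>" "z \<in> ball z0 \<eta>"
  shows "roots z \<subseteq> (\<Union>a\<in>roots z0. ball a \<epsilon>)"
proof
  fix w assume "w \<in> roots z"
  then have "w \<in> cball 0 \<rho>" "f (z, w) = 0" by (auto simp: roots_def)
  then show "w \<in> (\<Union>a\<in>roots z0. ball a \<epsilon>)" using assms unfolding isolating_def by blast
qed

lemma isolating_sphere:
  assumes "isolating z0 \<epsilon> \<eta>" "z \<in> ball z0 \<eta>" "a \<in> roots z0" "w \<in> sphere a \<epsilon>"
  shows "f (z, w) \<noteq> 0"
proof -
  have w: "w \<in> cball a \<epsilon>" using assms(4) by auto
  then have "w \<in> ball 0 \<rho>" using assms(1,3) unfolding isolating_def by blast
  then have "w \<in> cball 0 \<rho>" by simp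
  moreover have "w \<notin> ball b \<epsilon>" if b: "b \<in> roots z0" for b
  proof (cases "a = b")
    case False
    then have "w \<notin> cball b \<epsilon>" using w b assms(1,3) unfolding isolating_def by blast
    then show ?thesis by simp
  qed (use assms(4) in auto)
  ultimately show ?thesis using assms unfolding isolating_def by auto
qed

section \<open>Sums over the roots near one root\<close>

text \<open>Argument principle with weight h. The circle has winding number 1 about the roots inside
  and 0 about those outside, and it carries no root itself.\<close>

lemma local_trace:
  assumes iso: "isolating z0 \<epsilon> \<eta>" and z: "z \<in> ball z0 \<eta>" and a: "a \<in> roots z0"
    and h: "h holomorphic_on ball 0 \<rho>"
  shows "contour_integral (circlepath a \<epsilon>) (\<lambda>w. deriv (\<lambda>w. f (z, w)) w * h w / f (z, w)) =
    2 * pi * \<i> * (\<Sum>p\<in>roots z \<inter> ball a \<epsilon>. of_nat (root_mult z p) * h p)"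
proof -
  have \<epsilon>: "\<epsilon> > 0" and zd: "z \<in> ball 0 \<delta>" and sub: "cball a \<epsilon> \<subseteq> ball 0 \<rho>"
    using iso z a unfolding isolating_def by auto
  have pz: "{w \<in> ball 0 \<rho>. f (z, w) = 0 \<or> w \<in> {}} = roots z"
    by (auto simp: roots_def)
  have nz: "f (z, w) \<noteq> 0" if "w \<in> sphere a \<epsilon>" for w
    using isolating_sphere[OF iso z a that] .
  have "contour_integral (circlepath a \<epsilon>) (\<lambda>w. deriv (\<lambda>w. f (z, w)) w * h w / f (z, w)) =
    2 * pi * \<i> * (\<Sum>p\<in>{w \<in> ball 0 \<rho>. f (z, w) = 0 \<or> w \<in> {}}.
        winding_number (circlepath a \<epsilon>) p * h p * zorder (\<lambda>w. f (z, w)) p)"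
  proof (rule argument_principle)
    show "(\<lambda>w. f (z, w)) holomorphic_on ball 0 \<rho> - {}"
      using hol2[OF zd] ball_sub by (auto intro: holomorphic_on_subset)
    show "path_image (circlepath a \<epsilon>) \<subseteq> ball 0 \<rho> - {w \<in> ball 0 \<rho>. f (z, w) = 0 \<or> w \<in> {}}"
      using \<epsilon> nz sub sphere_cball[of a \<epsilon>] by auto
    show "\<forall>u. u \<notin> ball 0 \<rho> \<longrightarrow> winding_number (circlepath a \<epsilon>) u = 0"
      using \<epsilon> sub sphere_cball[of a \<epsilon>]
      by (auto intro!: winding_number_zero_outside[of _ "ball 0 \<rho>"])
    show "finite {w \<in> ball 0 \<rho>. f (z, w) = 0 \<or> w \<in> {}}"
      unfolding pz by (rule finite_roots[OF zd])
  qed (use h in auto)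
  also note pz
  also have "(\<Sum>p\<in>roots z. winding_number (circlepath a \<epsilon>) p * h p * zorder (\<lambda>w. f (z, w)) p) =
      (\<Sum>p\<in>roots z \<inter> ball a \<epsilon>. of_nat (root_mult z p) * h p)"
  proof (rule sum.mono_neutral_cong_right)
    show "\<forall>p\<in>roots z - roots z \<inter> ball a \<epsilon>.
        winding_number (circlepath a \<epsilon>) p * h p * zorder (\<lambda>w. f (z, w)) p = 0"
    proof
      fix p assume p: "p \<in> roots z - roots z \<inter> ball a \<epsilon>"
      then have "p \<notin> cball a \<epsilon>" using nz[of p] by (auto simp: roots_def)
      then have "winding_number (circlepath a \<epsilon>) p = 0"
        using \<epsilon> by (intro winding_number_zero_outside[of _ "cball a \<epsilon>"]) auto
      then show "winding_number (circlepath a \<epsilon>) p * h p * zorder (\<lambda>w. f (z, w)) p = 0" by simp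
    qed
    show "winding_number (circlepath a \<epsilon>) p * h p * zorder (\<lambda>w. f (z, w)) p =
        of_nat (root_mult z p) * h p" if "p \<in> roots z \<inter> ball a \<epsilon>" for p
      using that zorder_root(1)[OF zd, of p]
      by (simp add: winding_number_circlepath dist_norm norm_minus_commute)
  qed (use finite_roots[OF zd] in auto)
  finally show ?thesis .
qed

text \<open>Holomorphy in two variables in the form that parameter integrals deliver. The radius in
  w is \<rho>, since weights are only evaluated at roots and quotients by Cauchy integrals exist
  only inside that circle.\<close>

definition admissible :: "(complex \<times> complex \<Rightarrow> complex) \<Rightarrow> bool" where
  "admissible \<phi> \<longleftrightarrow> continuous_on (ball 0 \<delta> \<times> ball 0 \<rho>) \<phi> \<and>
     (\<forall>w\<in>ball 0 \<rho>. (\<lambda>z. \<phi> (z, w)) holomorphic_on ball 0 \<delta>) \<and>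
     (\<forall>z\<in>ball 0 \<delta>. (\<lambda>w. \<phi> (z, w)) holomorphic_on ball 0 \<rho>)"

lemma admissible_const: "admissible (\<lambda>_. c)"
  by (auto simp: admissible_def)

lemma admissible_snd: "admissible snd"
  by (auto simp: admissible_def continuous_on_snd)

lemma admissible_power: "admissible \<phi> \<Longrightarrow> admissible (\<lambda>p. \<phi> p ^ n)"
  by (auto simp: admissible_def intro!: continuous_intros holomorphic_intros)

text \<open>The individual roots need not depend holomorphically on z, but their weighted sum is an
  integral over a circle that does not move with z.\<close>

lemma local_trace_holomorphic:
  assumes iso: "isolating z0 \<epsilon> \<eta>" and a: "a \<in> roots z0" and \<phi>: "admissible \<phi>"
  shows "(\<lambda>z. \<Sum>p\<in>roots z \<inter> ball a \<epsilon>. of_nat (root_mult z p) * \<phi> (z, p)) holomorphic_on ball z0 \<eta>"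
proof -
  have \<epsilon>: "\<epsilon> > 0" and zd: "ball z0 \<eta> \<subseteq> ball 0 \<delta>" and sub: "cball a \<epsilon> \<subseteq> ball 0 \<rho>"
    using iso a unfolding isolating_def by auto
  have sph: "sphere a \<epsilon> \<subseteq> ball 0 \<rho>" "sphere a \<epsilon> \<subseteq> ball 0 R"
    using sub ball_sub(1) sphere_cball[of a \<epsilon>] by blast+
  have sw: "continuous_on (ball 0 R \<times> ball 0 \<delta>) (\<lambda>(w, z). f (z, w))"
    unfolding case_prod_beta
    by (rule continuous_on_compose2[OF cont]) (auto intro!: continuous_intros)
  have "continuous_on (ball 0 R \<times> ball 0 \<delta>) (\<lambda>(w, z). deriv (\<lambda>w. f (z, w)) w)"
    by (rule continuous_on_deriv_param[OF sw]) (use hol2 in auto)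
  then have "continuous_on (ball 0 \<delta> \<times> ball 0 R)
      (\<lambda>p. (\<lambda>(w, z). deriv (\<lambda>w. f (z, w)) w) (snd p, fst p))"
    by (rule continuous_on_compose2) (auto intro!: continuous_intros)
  then have cw: "continuous_on (ball 0 \<delta> \<times> ball 0 R) (\<lambda>p. deriv (\<lambda>w. f (fst p, w)) (snd p))"
    by (simp add: case_prod_beta)
  \<comment> \<open>Cauchy's formula in w expresses the w-derivative through values of f on a fixed
    circle, each of them holomorphic in z.\<close>
  have hw: "(\<lambda>z. deriv (\<lambda>w. f (z, w)) w) holomorphic_on ball 0 \<delta>" if w: "w \<in> ball 0 R" for w
  proof -
    obtain r where r: "r > 0" "cball w r \<subseteq> ball 0 R"
      using w open_contains_cball open_ball by blast
    have sr: "sphere w r \<subseteq> ball 0 R" using r sphere_cball[of w r] by blast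
    have nz: "s \<noteq> w" if "s \<in> sphere w r" for s using that r by auto
    have "continuous_on (ball 0 \<delta> \<times> sphere w r) (\<lambda>(z, s). f (z, s) / (s - w)\<^sup>2)"
      unfolding case_prod_beta prod.collapse
      by (intro continuous_intros continuous_on_subset[OF cont]) (use sr nz in auto)
    then have "(\<lambda>z. contour_integral (circlepath w r) (\<lambda>s. f (z, s) / (s - w)\<^sup>2)) holomorphic_on ball 0 \<delta>"
      by (rule holomorphic_on_contour_integral_circlepath)
         (use r sr nz hol1 in \<open>auto intro!: holomorphic_intros\<close>)
    then have "(\<lambda>z. 1 / (2 * of_real pi * \<i>) *
        contour_integral (circlepath w r) (\<lambda>s. f (z, s) / (s - w)\<^sup>2)) holomorphic_on ball 0 \<delta>"
      by (intro holomorphic_intros)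
    moreover have "deriv (\<lambda>w. f (z, w)) w = 1 / (2 * of_real pi * \<i>) *
        contour_integral (circlepath w r) (\<lambda>s. f (z, s) / (s - w)\<^sup>2)" if "z \<in> ball 0 \<delta>" for z
    proof (rule DERIV_imp_deriv, rule Cauchy_derivative_integral_circlepath(2))
      show "continuous_on (cball w r) (\<lambda>w. f (z, w))"
        using hol2[OF that] r holomorphic_on_imp_continuous_on holomorphic_on_subset by blast
      show "(\<lambda>w. f (z, w)) holomorphic_on ball w r"
        using hol2[OF that] r ball_subset_cball holomorphic_on_subset by blast
    qed (use r in auto)
    ultimately show ?thesis by (elim holomorphic_transform) auto
  qed
  let ?F = "\<lambda>z w. deriv (\<lambda>w. f (z, w)) w * \<phi> (z, w) / f (z, w)"
  have sub2: "ball z0 \<eta> \<times> sphere a \<epsilon> \<subseteq> ball 0 \<delta> \<times> ball 0 R"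
    "ball z0 \<eta> \<times> sphere a \<epsilon> \<subseteq> ball 0 \<delta> \<times> ball 0 \<rho>"
    using zd sph by auto
  have c\<phi>: "continuous_on (ball z0 \<eta> \<times> sphere a \<epsilon>) \<phi>"
    using \<phi> sub2 continuous_on_subset unfolding admissible_def by blast
  have "continuous_on (ball z0 \<eta> \<times> sphere a \<epsilon>) (\<lambda>(z, w). ?F z w)"
    unfolding case_prod_beta prod.collapse
    using continuous_on_subset[OF cw sub2(1)] continuous_on_subset[OF cont sub2(1)] c\<phi>
      isolating_sphere[OF iso _ a]
    by (intro continuous_intros) auto
  then have "(\<lambda>z. contour_integral (circlepath a \<epsilon>) (?F z)) holomorphic_on ball z0 \<eta>"
  proof (rule holomorphic_on_contour_integral_circlepath)
    fix s assume s: "s \<in> sphere a \<epsilon>"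
    then have sb: "s \<in> ball 0 \<rho>" "s \<in> ball 0 R" using sph by blast+
    show "(\<lambda>z. ?F z s) holomorphic_on ball z0 \<eta>"
    proof (intro holomorphic_intros)
      show "(\<lambda>z. deriv (\<lambda>w. f (z, w)) s) holomorphic_on ball z0 \<eta>"
        "(\<lambda>z. f (z, s)) holomorphic_on ball z0 \<eta>"
        using holomorphic_on_subset[OF _ zd] hw hol1 sb by blast+
      show "(\<lambda>z. \<phi> (z, s)) holomorphic_on ball z0 \<eta>"
        using holomorphic_on_subset[OF _ zd] \<phi> sb unfolding admissible_def by blast
    qed (rule isolating_sphere[OF iso _ a s])
  qed (use \<epsilon> in auto)
  then have "(\<lambda>z. 1 / (2 * of_real pi * \<i>) * contour_integral (circlepath a \<epsilon>) (?F z))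
      holomorphic_on ball z0 \<eta>"
    by (intro holomorphic_intros)
  moreover have "(\<Sum>p\<in>roots z \<inter> ball a \<epsilon>. of_nat (root_mult z p) * \<phi> (z, p)) =
      1 / (2 * of_real pi * \<i>) * contour_integral (circlepath a \<epsilon>) (?F z)"
    if "z \<in> ball z0 \<eta>" for z
    using local_trace[OF iso that a, of "\<lambda>w. \<phi> (z, w)"] that zd \<phi>
    by (auto simp: admissible_def)
  ultimately show ?thesis by (elim holomorphic_transform) auto
qed

section \<open>Open and closed parts of the cover\<close>

definition fiber :: "(complex \<times> complex) set \<Rightarrow> complex \<Rightarrow> complex set" where
  "fiber A z = {w \<in> roots z. (z, w) \<in> A}"

definition total :: "(complex \<times> complex) set \<Rightarrow> complex \<Rightarrow> nat" where
  "total A z = (\<Sum>w\<in>fiber A z. root_mult z w)"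

definition trace :: "(complex \<times> complex \<Rightarrow> complex) \<Rightarrow> (complex \<times> complex) set \<Rightarrow> complex \<Rightarrow> complex" where
  "trace \<phi> A z = (\<Sum>w\<in>fiber A z. of_nat (root_mult z w) * \<phi> (z, w))"

text \<open>For open D this says that the zeros over D lying in A form a relatively open and closed
  set. Points off the zero set do not count, so A can be an arbitrary set such as
  \<open>UNIV\<close> or the zero set of another function.\<close>

definition clopen_over :: "complex set \<Rightarrow> (complex \<times> complex) set \<Rightarrow> bool" where
  "clopen_over D A \<longleftrightarrow> (\<forall>z0\<in>D. \<forall>a\<in>roots z0. \<exists>e>0. \<forall>z\<in>ball z0 e. \<forall>w\<in>roots z \<inter> ball a e.
     (z, w) \<in> A \<longleftrightarrow> (z0, a) \<in> A)"

lemma clopen_over_UNIV: "clopen_over D UNIV"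
  unfolding clopen_over_def by (auto intro: exI[of _ 1])

lemma clopen_over_compl: "clopen_over D A \<Longrightarrow> clopen_over D (- A)"
  unfolding clopen_over_def by simp

lemma fiber_UNIV [simp]: "fiber UNIV z = roots z"
  by (simp add: fiber_def)

lemma finite_fiber: "z \<in> ball 0 \<delta> \<Longrightarrow> finite (fiber A z)"
  using finite_roots by (simp add: fiber_def)

lemma of_nat_total: "of_nat (total A z) = trace (\<lambda>_. 1) A z"
  by (simp add: total_def trace_def)

lemma total_eq_0_iff:
  assumes z: "z \<in> ball 0 \<delta>" shows "total A z = 0 \<longleftrightarrow> fiber A z = {}"
proof -
  have "\<forall>w\<in>fiber A z. root_mult z w \<noteq> 0"
    using zorder_root(2)[OF z] by (force simp: fiber_def)
  then show ?thesis using finite_fiber[OF z, of A] by (auto simp: total_def)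
qed

text \<open>Once \<epsilon> and \<eta> are below the finitely many radii of local constancy, the
  roots in one disc lie all in A or all outside A, according to the root at its centre. The part A
  then consists of whole discs.\<close>

lemma clopen_isolating:
  assumes D: "open D" "D \<subseteq> ball 0 \<delta>" and A: "clopen_over D A" and z0: "z0 \<in> D" and e: "0 < e"
  obtains \<epsilon> \<eta> where "isolating z0 \<epsilon> \<eta>" "\<epsilon> < e" "\<eta> \<le> e" "ball z0 \<eta> \<subseteq> D"
    "\<And>z. z \<in> ball z0 \<eta> \<Longrightarrow> fiber A z = (\<Union>a\<in>fiber A z0. roots z \<inter> ball a \<epsilon>)"
proof -
  have z0d: "z0 \<in> ball 0 \<delta>" using z0 D by blast
  obtain d where d: "\<And>a. a \<in> roots z0 \<Longrightarrow> 0 < d a \<and> (\<forall>z\<in>ball z0 (d a). \<forall>w\<in>roots z \<inter> ball a (d a).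
     (z, w) \<in> A \<longleftrightarrow> (z0, a) \<in> A)"
    using A z0 unfolding clopen_over_def by metis
  define e' where "e' = Min (insert e (d ` roots z0))"
  have F: "finite (insert e (d ` roots z0))" using finite_roots[OF z0d] by simp
  have e': "e' > 0" unfolding e'_def using F e d by (subst Min_gr_iff) auto
  have le: "e' \<le> e" "\<And>a. a \<in> roots z0 \<Longrightarrow> e' \<le> d a"
    unfolding e'_def by (auto intro!: Min_le F)
  obtain \<epsilon> \<eta> where iso: "isolating z0 \<epsilon> \<eta>" "\<epsilon> < e'"
    using exists_isolating[OF z0d e'] by blast
  obtain r where r: "r > 0" "ball z0 r \<subseteq> D" using D z0 open_contains_ball by blast
  define \<eta>' where "\<eta>' = min \<eta> (min r e')"
  have \<eta>': "0 < \<eta>'" "\<eta>' \<le> \<eta>" "\<eta>' \<le> r" "\<eta>' \<le> e'"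
    using iso r e' by (auto simp: \<eta>'_def isolating_def)
  have iso': "isolating z0 \<epsilon> \<eta>'" by (rule isolating_mono[OF iso(1)]) (use \<eta>' in auto)
  have key: "(z, w) \<in> A \<longleftrightarrow> (z0, a) \<in> A"
    if "z \<in> ball z0 \<eta>'" "w \<in> roots z" "a \<in> roots z0" "w \<in> ball a \<epsilon>" for z w a
  proof -
    have "z \<in> ball z0 (d a)" "w \<in> ball a (d a)"
      using that le(2)[OF that(3)] \<eta>'(4) iso(2) by auto
    then show ?thesis using d[OF that(3)] that(2) by blast
  qed
  show thesis
  proof (rule that[OF iso'])
    show "ball z0 \<eta>' \<subseteq> D" using r \<eta>' subset_ball by blast
    show "fiber A z = (\<Union>a\<in>fiber A z0. roots z \<inter> ball a \<epsilon>)" if z: "z \<in> ball z0 \<eta>'" for z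
    proof
      show "fiber A z \<subseteq> (\<Union>a\<in>fiber A z0. roots z \<inter> ball a \<epsilon>)"
      proof
        fix w assume w: "w \<in> fiber A z"
        then obtain a where "a \<in> roots z0" "w \<in> ball a \<epsilon>"
          using isolating_roots[OF iso' z] by (auto simp: fiber_def)
        then show "w \<in> (\<Union>a\<in>fiber A z0. roots z \<inter> ball a \<epsilon>)"
          using key[OF z] w unfolding fiber_def by blast
      qed
      show "(\<Union>a\<in>fiber A z0. roots z \<inter> ball a \<epsilon>) \<subseteq> fiber A z"
        using key[OF z] unfolding fiber_def by blast
    qed
  qed (use iso(2) le(1) \<eta>' in auto)
qed

lemma sum_isolating:
  assumes iso: "isolating z0 \<epsilon> \<eta>" and z: "z \<in> ball z0 \<eta>" and S: "S \<subseteq> roots z0"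
  shows "(\<Sum>p\<in>(\<Union>a\<in>S. roots z \<inter> ball a \<epsilon>). h p) = (\<Sum>a\<in>S. \<Sum>p\<in>roots z \<inter> ball a \<epsilon>. h p)"
proof (rule sum.UNION_disjoint)
  have zd: "z0 \<in> ball 0 \<delta>" "z \<in> ball 0 \<delta>"
    using iso z unfolding isolating_def by (blast intro: centre_in_ball[THEN iffD2])+
  show "finite S" using S finite_roots[OF zd(1)] finite_subset by blast
  show "\<forall>a\<in>S. finite (roots z \<inter> ball a \<epsilon>)" using finite_roots[OF zd(2)] by blast
  show "\<forall>a\<in>S. \<forall>b\<in>S. a \<noteq> b \<longrightarrow> roots z \<inter> ball a \<epsilon> \<inter> (roots z \<inter> ball b \<epsilon>) = {}"
  proof (intro ballI impI)
    fix a b assume "a \<in> S" "b \<in> S" "a \<noteq> b"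
    then have "cball a \<epsilon> \<inter> cball b \<epsilon> = {}" using iso S unfolding isolating_def by blast
    then show "roots z \<inter> ball a \<epsilon> \<inter> (roots z \<inter> ball b \<epsilon>) = {}"
      using ball_subset_cball[of a \<epsilon>] ball_subset_cball[of b \<epsilon>] by blast
  qed
qed

lemma trace_holomorphic:
  assumes D: "open D" "D \<subseteq> ball 0 \<delta>" and A: "clopen_over D A" and \<phi>: "admissible \<phi>"
  shows "trace \<phi> A holomorphic_on D"
proof (rule analytic_imp_holomorphic, subst analytic_on_open[OF D(1)], unfold holomorphic_on_def,
    intro ballI)
  fix z0 assume z0: "z0 \<in> D"
  obtain \<epsilon> \<eta> where iso: "isolating z0 \<epsilon> \<eta>" and fib:
    "\<And>z. z \<in> ball z0 \<eta> \<Longrightarrow> fiber A z = (\<Union>a\<in>fiber A z0. roots z \<inter> ball a \<epsilon>)"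
    using clopen_isolating[OF D A z0 zero_less_one] by metis
  have sub: "fiber A z0 \<subseteq> roots z0" by (auto simp: fiber_def)
  have "(\<lambda>z. \<Sum>a\<in>fiber A z0. \<Sum>p\<in>roots z \<inter> ball a \<epsilon>. of_nat (root_mult z p) * \<phi> (z, p))
      holomorphic_on ball z0 \<eta>"
    by (intro holomorphic_on_sum local_trace_holomorphic[OF iso _ \<phi>]) (use sub in auto)
  then have "trace \<phi> A holomorphic_on ball z0 \<eta>"
    by (rule holomorphic_transform)
       (simp only: trace_def fib sum_isolating[OF iso _ sub])
  moreover have "\<eta> > 0" using iso by (simp add: isolating_def)
  ultimately show "trace \<phi> A field_differentiable at z0 within D"
    by (meson centre_in_ball field_differentiable_at_within holomorphic_on_imp_differentiable_at open_ball)
qed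

lemma nat_valued_constant:
  fixes n :: "complex \<Rightarrow> nat"
  assumes "connected D" "continuous_on D (\<lambda>z. of_nat (n z) :: complex)" "z \<in> D" "z' \<in> D"
  shows "n z = n z'"
proof -
  have "(\<lambda>z. of_nat (n z) :: complex) constant_on D"
  proof (rule continuous_discrete_range_constant[OF assms(1,2)])
    fix x assume "x \<in> D"
    have "1 \<le> cmod (of_nat (n y) - of_nat (n x))" if "n y \<noteq> n x" for y
    proof -
      have "cmod (of_nat (n y) - of_nat (n x)) = \<bar>real_of_int (int (n y) - int (n x))\<bar>"
        by (metis norm_of_int of_int_diff of_int_of_nat_eq)
      then show ?thesis using that by linarith
    qed
    then show "\<exists>e>0. \<forall>y. y \<in> D \<and> complex_of_nat (n y) \<noteq> of_nat (n x) \<longrightarrow>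
        e \<le> cmod (of_nat (n y) - of_nat (n x))"
      by (intro exI[of _ 1]) auto
  qed
  then show ?thesis using assms(3,4) by (metis constant_on_def of_nat_eq_iff)
qed

text \<open>Conservation of number: the trace with weight 1 is continuous and takes natural numbers
  as values on a connected set.\<close>

lemma total_constant:
  assumes "open D" "D \<subseteq> ball 0 \<delta>" "clopen_over D A" "connected D" "z \<in> D" "z' \<in> D"
  shows "total A z = total A z'"
  using trace_holomorphic[OF assms(1-3) admissible_const[of 1]] assms(4-)
  by (intro nat_valued_constant[of D "total A"])
     (auto simp: of_nat_total holomorphic_on_imp_continuous_on)

text \<open>The local count is constant on the disc around z0, and at z0 itself the \<epsilon>-disc
  around a contains no other root. So a root splits into roots whose multiplicities add up to its
  own.\<close>

lemma local_total:
  assumes iso: "isolating z0 \<epsilon> \<eta>" and a: "a \<in> roots z0" and z: "z \<in> ball z0 \<eta>"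
  shows "(\<Sum>p\<in>roots z \<inter> ball a \<epsilon>. root_mult z p) = root_mult z0 a"
proof -
  have "(\<Sum>p\<in>roots z \<inter> ball a \<epsilon>. root_mult z p) = (\<Sum>p\<in>roots z0 \<inter> ball a \<epsilon>. root_mult z0 p)"
  proof (rule nat_valued_constant)
    show "continuous_on (ball z0 \<eta>) (\<lambda>z. of_nat (\<Sum>p\<in>roots z \<inter> ball a \<epsilon>. root_mult z p) :: complex)"
      using local_trace_holomorphic[OF iso a admissible_const[of 1]]
      by (simp add: holomorphic_on_imp_continuous_on)
  qed (use iso z in \<open>auto simp: isolating_def\<close>)
  also have "roots z0 \<inter> ball a \<epsilon> = {a}"
  proof -
    have "b = a" if "b \<in> roots z0" "b \<in> ball a \<epsilon>" for b
    proof (rule ccontr)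
      assume "b \<noteq> a"
      then have "cball b \<epsilon> \<inter> cball a \<epsilon> = {}" using iso a that unfolding isolating_def by blast
      moreover have "b \<in> cball b \<epsilon>" "b \<in> cball a \<epsilon>"
        using that iso unfolding isolating_def by auto
      ultimately show False by blast
    qed
    then show ?thesis using a iso by (auto simp: isolating_def)
  qed
  finally show ?thesis by simp
qed

abbreviation punctured :: "complex set" where "punctured \<equiv> ball 0 \<delta> - {0}"

lemma punctured: "open punctured" "punctured \<subseteq> ball 0 \<delta>" "connected punctured"
  "of_real (\<delta> / 2) \<in> punctured"
  using pos connected_punctured_ball[of "0::complex" \<delta>] by (auto simp: open_Diff)

lemma roots_nonempty: assumes "z \<in> ball 0 \<delta>" shows "roots z \<noteq> {}"
proof -
  have "total UNIV z = total UNIV 0"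
    by (rule total_constant[OF open_ball subset_refl clopen_over_UNIV]) (use assms pos in auto)
  then show ?thesis
    using total_eq_0_iff[OF assms, of UNIV] total_eq_0_iff[of 0 UNIV] pos roots_0 by simp
qed

lemma roots_near_0:
  assumes "0 < e" shows "\<exists>d>0. d \<le> \<delta> \<and> (\<forall>z\<in>ball 0 d. \<forall>w\<in>roots z. norm w < e)"
proof -
  have "0 \<in> ball (0::complex) \<delta>" using pos by simp
  then obtain \<epsilon> \<eta> where iso: "isolating 0 \<epsilon> \<eta>" "\<epsilon> < e"
    using exists_isolating assms by blast
  from iso(1) have "ball (0::complex) \<eta> \<subseteq> ball 0 \<delta>" and \<eta>: "\<eta> > 0" by (auto simp: isolating_def)
  then have "\<eta> \<le> \<delta>" by (simp add: ball_subset_ball_iff)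
  moreover have "norm w < e" if "z \<in> ball 0 \<eta>" "w \<in> roots z" for z w
    using isolating_roots[OF iso(1) that(1)] that(2) roots_0 iso(2) by auto
  ultimately show ?thesis using \<eta> by blast
qed

text \<open>The base point is arbitrary: by \<open>total_eq_deg\<close> it gives the common value of
  the count when A is clopen over the punctured disc.\<close>

definition deg :: "(complex \<times> complex) set \<Rightarrow> nat" where
  "deg A = total A (of_real (\<delta> / 2))"

lemma total_eq_deg: "clopen_over punctured A \<Longrightarrow> z \<in> punctured \<Longrightarrow> total A z = deg A"
  unfolding deg_def using total_constant[OF punctured(1,2) _ punctured(3)] punctured(4) by blast

text \<open>All roots converge to 0 while their number, with multiplicity, stays
  \<open>deg A\<close>. This limit is what makes the singularity of the trace at z = 0
  removable.\<close>

lemma trace_tendsto: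
  assumes A: "clopen_over punctured A" and \<phi>: "admissible \<phi>"
  shows "(trace \<phi> A \<longlongrightarrow> of_nat (deg A) * \<phi> (0, 0)) (at 0)"
proof (rule tendstoI)
  fix e :: real assume e: "e > 0"
  \<comment> \<open>Adding 1 covers \<open>deg A = 0\<close> and makes the final estimate
    strict.\<close>
  define e' where "e' = e / (deg A + 1)"
  have e': "e' > 0" using e by (simp add: e'_def)
  have "isCont \<phi> (0, 0)"
    using \<phi> pos unfolding admissible_def
    by (auto simp: continuous_on_eq_continuous_at open_Times)
  then have "(\<phi> \<longlongrightarrow> \<phi> (0, 0)) (nhds (0, 0))"
    by (simp add: isCont_def tendsto_at_iff_tendsto_nhds)
  then have "\<forall>\<^sub>F p in nhds (0, 0). dist (\<phi> p) (\<phi> (0, 0)) < e'"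
    using e' tendstoD by blast
  then obtain r where r: "r > 0" "\<And>p. dist p (0, 0) < r \<Longrightarrow> dist (\<phi> p) (\<phi> (0, 0)) < e'"
    unfolding eventually_nhds_metric by blast
  obtain d where d: "d > 0" "d \<le> \<delta>" "\<And>z w. z \<in> ball 0 d \<Longrightarrow> w \<in> roots z \<Longrightarrow> norm w < r / 2"
    using roots_near_0[of "r / 2"] r by auto
  have "dist (trace \<phi> A z) (of_nat (deg A) * \<phi> (0, 0)) < e"
    if z: "z \<noteq> 0" "dist z 0 < min d (r / 2)" for z
  proof -
    have zp: "z \<in> punctured" using z d by auto
    have "trace \<phi> A z - of_nat (deg A) * \<phi> (0, 0) =
        (\<Sum>w\<in>fiber A z. of_nat (root_mult z w) * (\<phi> (z, w) - \<phi> (0, 0)))"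
      by (simp add: trace_def total_eq_deg[OF A zp, symmetric] total_def
          right_diff_distrib sum_subtractf sum_distrib_right)
    also have "cmod \<dots> \<le> (\<Sum>w\<in>fiber A z. of_nat (root_mult z w) * e')"
    proof (rule sum_norm_le)
      fix w assume "w \<in> fiber A z"
      then have "norm w < r / 2" using d z by (auto simp: fiber_def)
      moreover have "norm (z, w) \<le> norm z + norm w" by (rule norm_Pair_le)
      ultimately have "dist (z, w) (0, 0) < r" using z by (simp add: dist_norm zero_prod_def[symmetric])
      then have "cmod (\<phi> (z, w) - \<phi> (0, 0)) \<le> e'" using r(2) by (force simp: dist_norm)
      then show "cmod (of_nat (root_mult z w) * (\<phi> (z, w) - \<phi> (0, 0))) \<le> of_nat (root_mult z w) * e'"
        by (simp add: norm_mult mult_left_mono)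
    qed
    also have "\<dots> = deg A * e'"
      by (simp add: total_eq_deg[OF A zp, symmetric] total_def sum_distrib_right)
    also have "\<dots> < e" using e by (simp add: e'_def field_simps)
    finally show ?thesis by (simp add: dist_norm)
  qed
  then show "\<forall>\<^sub>F z in at 0. dist (trace \<phi> A z) (of_nat (deg A) * \<phi> (0, 0)) < e"
    unfolding eventually_at using d r by (intro exI[of _ "min d (r / 2)"]) auto
qed

section \<open>Characteristic polynomials of parts of the cover\<close>

text \<open>The characteristic polynomial of the values of \<phi> on A, written in reversed form
  with factors 1 - \<phi> X, which normalizes its constant coefficient to 1 as Newton's recursion
  requires. At z = 0 it is set to its limit, because membership of the origin in A is unrelated to
  \<open>deg A\<close>.\<close>

definition charpoly :: "(complex \<times> complex \<Rightarrow> complex) \<Rightarrow> (complex \<times> complex) set \<Rightarrow> complex \<Rightarrow> complex poly" where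
  "charpoly \<phi> A z = (if z = 0 then [:1, - \<phi> (0, 0):] ^ deg A
     else (\<Prod>w\<in>fiber A z. [:1, - \<phi> (z, w):] ^ root_mult z w))"

text \<open>Newton's recursion expresses coefficient k through earlier coefficients and power sums,
  so strong induction on k reduces the claim to the power sums.\<close>

lemma coeff_charpoly_holomorphic:
  assumes A: "clopen_over punctured A" and \<phi>: "admissible \<phi>"
  shows "(\<lambda>z. coeff (charpoly \<phi> A z) k) holomorphic_on ball 0 \<delta>"
proof (induction k rule: less_induct)
  case (less k)
  \<comment> \<open>The n-th power sum, extended over z = 0 by the limit from
    \<open>trace_tendsto\<close>, so that Riemann's theorem on removable singularities
    applies.\<close>
  define T where "T n z = (if z = 0 then of_nat (deg A) * \<phi> (0, 0) ^ n else trace (\<lambda>p. \<phi> p ^ n) A z)" for n z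
  have T: "T n holomorphic_on ball 0 \<delta>" for n
  proof (rule no_isolated_singularity'[of "{0}"])
    show "(T n \<longlongrightarrow> T n z) (at z within ball 0 \<delta>)" if "z \<in> {0}" for z
    proof -
      have "(trace (\<lambda>p. \<phi> p ^ n) A \<longlongrightarrow> T n 0) (at 0)"
        using trace_tendsto[OF A admissible_power[OF \<phi>], of n] by (simp add: T_def)
      moreover have "\<forall>\<^sub>F z in at 0. trace (\<lambda>p. \<phi> p ^ n) A z = T n z"
        by (simp add: eventually_at_filter T_def)
      ultimately have "(T n \<longlongrightarrow> T n 0) (at 0)" by (rule Lim_transform_eventually)
      then show ?thesis using that tendsto_within_subset[of _ _ 0 UNIV] by auto
    qed
    show "T n holomorphic_on ball 0 \<delta> - {0}"
      by (rule holomorphic_transform[OF trace_holomorphic[OF punctured(1,2) A admissible_power[OF \<phi>, of n]]])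
         (auto simp: T_def)
  qed auto
  show ?case
  proof (cases k)
    case 0
    have "coeff (charpoly \<phi> A z) 0 = 1" for z
      unfolding poly_0_coeff_0[symmetric] charpoly_def by (simp add: poly_prod)
    then show ?thesis using 0 by simp
  next
    case (Suc n)
    have rec: "of_nat (Suc n) * coeff (charpoly \<phi> A z) (Suc n) =
        - (\<Sum>j\<le>n. coeff (charpoly \<phi> A z) j * T (Suc (n - j)) z)" if "z \<in> ball 0 \<delta>" for z
    proof (cases "z = 0")
      case True
      then show ?thesis
        using newton_poly[of "{()}" n "\<lambda>_. \<phi> (0, 0)" "\<lambda>_. deg A"] by (simp add: charpoly_def T_def)
    next
      case False
      then show ?thesis
        using newton_poly[OF finite_fiber[OF that], of n "\<lambda>w. \<phi> (z, w)" "root_mult z" A]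
        by (simp add: charpoly_def T_def trace_def)
    qed
    have "(\<lambda>z. - (\<Sum>j\<le>n. coeff (charpoly \<phi> A z) j * T (Suc (n - j)) z) / of_nat (Suc n))
        holomorphic_on ball 0 \<delta>"
      by (intro holomorphic_intros less.IH T) (auto simp: Suc simp del: of_nat_Suc)
    then show ?thesis
      unfolding Suc by (rule holomorphic_transform) (simp add: rec[symmetric] del: of_nat_Suc)
  qed
qed

end

section \<open>Dividing by the polynomial of a part\<close>

text \<open>Zeros are split off one at a time. Each exponent can be the order of the original h,
  since the factors already removed do not vanish at the new point.\<close>

lemma holomorphic_divide_zeros:
  assumes h: "h holomorphic_on S" and S: "open S" "connected S" "\<exists>w\<in>S. h w \<noteq> 0"
    and I: "finite I" "I \<subseteq> S"
  shows "\<exists>H. H holomorphic_on S \<and> (\<forall>w\<in>S. h w = (\<Prod>a\<in>I. (w - a) ^ nat (zorder h a)) * H w)"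
  using I
proof (induction I)
  case empty
  then show ?case using h by auto
next
  case (insert a I)
  define P where "P w = (\<Prod>a\<in>I. (w - a) ^ nat (zorder h a))" for w
  obtain H where H: "H holomorphic_on S" "\<And>w. w \<in> S \<Longrightarrow> h w = P w * H w"
    using insert by (auto simp: P_def)
  define m where "m = nat (zorder h a)"
  define g where "g = zor_poly h a"
  obtain r where r: "r > 0" "cball a r \<subseteq> S" and g: "g holomorphic_on cball a r"
    and hg: "\<And>w. w \<in> cball a r \<Longrightarrow> h w = g w * (w - a) ^ m"
    using zorder_exist_zero[OF h S(1,2) _ S(3), of a] insert.prems
    unfolding m_def g_def by (auto split: if_splits)
  have Pa: "P a \<noteq> 0" using insert.hyps by (auto simp: P_def)
  have P: "P holomorphic_on X" for X
    unfolding P_def by (intro holomorphic_intros)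
  \<comment> \<open>The value at a is the limit of the quotient, computed from the local form of h
    at a; the product P of the earlier factors is nonzero there.\<close>
  define H' where "H' w = (if w = a then g a / P a else H w / (w - a) ^ m)" for w
  have "H' holomorphic_on S"
  proof (rule no_isolated_singularity'[of "{a}"])
    show "H' holomorphic_on S - {a}"
      by (rule holomorphic_transform[of "\<lambda>w. H w / (w - a) ^ m"])
         (auto simp: H'_def intro!: holomorphic_intros holomorphic_on_subset[OF H(1)])
    have "isCont g a"
      using r g by (metis centre_in_ball continuous_on_interior holomorphic_on_imp_continuous_on interior_cball)
    moreover have "isCont P a"
      using P[of UNIV] holomorphic_on_imp_continuous_on continuous_on_eq_continuous_at open_UNIV by blast
    ultimately have "((\<lambda>w. g w / P w) \<longlongrightarrow> g a / P a) (at a)"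
      using Pa by (auto simp: isCont_def intro: tendsto_divide)
    moreover have "\<forall>\<^sub>F w in at a. g w / P w = H' w"
    proof -
      have "\<forall>\<^sub>F w in at a. w \<in> cball a r \<and> w \<noteq> a"
        using r by (auto simp: eventually_at intro!: exI[of _ r] simp: dist_commute)
      moreover have "\<forall>\<^sub>F w in at a. P w \<noteq> 0"
        using \<open>isCont P a\<close> Pa by (simp add: isCont_def tendsto_imp_eventually_ne)
      ultimately show ?thesis
      proof eventually_elim
        case (elim w)
        then have "P w * H w = g w * (w - a) ^ m" using H(2)[of w] hg[of w] r by auto
        then show ?case using elim by (simp add: H'_def field_simps)
      qed
    qed
    ultimately have "(H' \<longlongrightarrow> g a / P a) (at a)" by (rule Lim_transform_eventually)
    then show "(H' \<longlongrightarrow> H' z) (at z within S)" if "z \<in> {a}" for z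
      using that tendsto_within_subset[of _ _ a UNIV] by (auto simp: H'_def)
  qed (use S in auto)
  moreover have "h w = (\<Prod>a\<in>insert a I. (w - a) ^ nat (zorder h a)) * H' w" if w: "w \<in> S" for w
  proof (cases "w = a")
    case False
    then show ?thesis
      using H(2)[OF w] insert.hyps by (simp add: H'_def P_def m_def)
  next
    case True
    then have "h w = g a * 0 ^ m" using hg[of a] r by simp
    then show ?thesis
      using True insert.hyps Pa by (simp add: H'_def flip: m_def P_def)
  qed
  ultimately show ?case by blast
qed

context branched_cover
begin

text \<open>The Weierstrass polynomial of the part A. At z = 0 all its roots have merged at 0, hence
  the pure power.\<close>

definition factor :: "(complex \<times> complex) set \<Rightarrow> complex \<times> complex \<Rightarrow> complex" where
  "factor A = (\<lambda>(z, w). if z = 0 then w ^ deg A else (\<Prod>a\<in>fiber A z. (w - a) ^ root_mult z a))"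

text \<open>The product form displays the zeros, this coefficient form the holomorphy in z.\<close>

lemma factor_eq_charpoly:
  assumes A: "clopen_over punctured A" and z: "z \<in> ball 0 \<delta>"
  shows "factor A (z, w) = (\<Sum>k\<le>deg A. coeff (charpoly snd A z) k * w ^ (deg A - k))"
proof (cases "z = 0")
  case True
  then show ?thesis
    using poly_prod_linear_reversed[of "{()}" "\<lambda>_. 0" "\<lambda>_. deg A" w]
    by (simp add: factor_def charpoly_def)
next
  case False
  then have "deg A = sum (root_mult z) (fiber A z)"
    using total_eq_deg[OF A, of z] z by (simp add: total_def)
  then show ?thesis
    using poly_prod_linear_reversed[OF finite_fiber[OF z], of "\<lambda>w. w" "root_mult z" A w] False
    by (simp add: factor_def charpoly_def)
qed

lemma factor_continuous:
  assumes A: "clopen_over punctured A"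
  shows "continuous_on (ball 0 \<delta> \<times> UNIV) (factor A)"
proof -
  have "continuous_on (ball 0 \<delta> \<times> UNIV) (\<lambda>p. \<Sum>k\<le>deg A. coeff (charpoly snd A (fst p)) k * snd p ^ (deg A - k))"
  proof (intro continuous_intros)
    show "continuous_on (ball 0 \<delta> \<times> UNIV) (\<lambda>p. coeff (charpoly snd A (fst p)) k)" for k
      by (rule continuous_on_compose2[OF holomorphic_on_imp_continuous_on[OF
            coeff_charpoly_holomorphic[OF A admissible_snd]]])
         (auto intro: continuous_intros)
  qed
  then show ?thesis
    by (rule continuous_on_eq) (auto simp: factor_eq_charpoly[OF A])
qed

lemma factor_holomorphic1:
  assumes A: "clopen_over punctured A"
  shows "(\<lambda>z. factor A (z, w)) holomorphic_on ball 0 \<delta>"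
proof -
  have "(\<lambda>z. \<Sum>k\<le>deg A. coeff (charpoly snd A z) k * w ^ (deg A - k)) holomorphic_on ball 0 \<delta>"
    by (intro holomorphic_intros coeff_charpoly_holomorphic[OF A admissible_snd])
  then show ?thesis
    by (rule holomorphic_transform) (simp add: factor_eq_charpoly[OF A])
qed

lemma factor_holomorphic2: "(\<lambda>w. factor A (z, w)) holomorphic_on X"
  by (cases "z = 0") (auto simp: factor_def intro!: holomorphic_intros)

lemma factor_eq_0_iff:
  assumes A: "clopen_over punctured A" and z: "z \<in> punctured"
  shows "factor A (z, w) = 0 \<longleftrightarrow> w \<in> fiber A z"
  using z finite_fiber[of z A] zorder_root(2)[of z]
  by (auto simp: factor_def fiber_def)

lemma factor_nonzero:
  assumes A: "clopen_over punctured A" and z: "z \<in> ball 0 \<delta>" and w: "norm w = \<rho>"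
  shows "factor A (z, w) \<noteq> 0"
proof (cases "z = 0")
  case True
  then show ?thesis using w pos by (auto simp: factor_def)
next
  case False
  then show ?thesis
    using factor_eq_0_iff[OF A, of z w] z w by (auto simp: fiber_def roots_def)
qed

lemma admissible_factor: "clopen_over punctured A \<Longrightarrow> admissible (factor A)"
  unfolding admissible_def
  by (auto intro: continuous_on_subset[OF factor_continuous] factor_holomorphic1 factor_holomorphic2)

lemma admissible_isCont:
  assumes "admissible \<phi>" "z \<in> ball 0 \<delta>" "w \<in> ball 0 \<rho>" shows "isCont \<phi> (z, w)"
  using assms unfolding admissible_def by (auto simp: continuous_on_eq_continuous_at open_Times)

text \<open>The quotient is defined by a Cauchy integral over the circle of radius \<rho>, where the
  divisor has no zeros; this makes it holomorphic in both variables at once. That it is the quotient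
  is then checked separately for each z.\<close>

lemma factor_divides:
  assumes A: "clopen_over punctured A"
  obtains q where "admissible q"
    "\<And>z w. z \<in> ball 0 \<delta> \<Longrightarrow> w \<in> ball 0 \<rho> \<Longrightarrow> f (z, w) = factor A (z, w) * q (z, w)"
proof -
  define K where "K p s = f (fst p, s) / (factor A (fst p, s) * (s - snd p))" for p s
  define q where "q p = 1 / (2 * of_real pi * \<i>) * contour_integral (circlepath 0 \<rho>) (K p)" for p
  have sR: "sphere 0 \<rho> \<subseteq> ball 0 R" using pos by auto
  have ne: "s \<noteq> w" if "s \<in> sphere 0 \<rho>" "w \<in> ball 0 \<rho>" for s w :: complex using that by auto
  have cK: "continuous_on ((ball 0 \<delta> \<times> ball 0 \<rho>) \<times> sphere 0 \<rho>) (\<lambda>(p, s). K p s)"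
    unfolding K_def case_prod_beta
    by (intro continuous_intros continuous_on_compose2[OF cont]
        continuous_on_compose2[OF factor_continuous[OF A]])
       (use sR in \<open>auto simp: factor_nonzero[OF A]\<close>)
  have slice: "continuous_on (U \<times> sphere 0 \<rho>) (\<lambda>(u, s). K (h u) s)"
    if "continuous_on U h" "h ` U \<subseteq> ball 0 \<delta> \<times> ball 0 \<rho>" for U :: "complex set" and h
  proof -
    have "continuous_on (U \<times> sphere 0 \<rho>) (\<lambda>p. (\<lambda>(p, s). K p s) (h (fst p), snd p))"
      by (rule continuous_on_compose2[OF cK])
         (use that in \<open>auto intro!: continuous_intros continuous_on_compose2[OF that(1)]\<close>)
    then show ?thesis by (simp add: case_prod_beta)
  qed
  have "admissible q"
    unfolding admissible_def
  proof (intro conjI ballI)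
    show "continuous_on (ball 0 \<delta> \<times> ball 0 \<rho>) q"
      unfolding q_def
      by (intro continuous_intros continuous_on_contour_integral_circlepath cK) (use pos in auto)
  next
    fix w :: complex assume w: "w \<in> ball 0 \<rho>"
    show "(\<lambda>z. q (z, w)) holomorphic_on ball 0 \<delta>"
      unfolding q_def
    proof (intro holomorphic_intros holomorphic_on_contour_integral_circlepath slice)
      fix s :: complex assume s: "s \<in> sphere 0 \<rho>"
      then have sb: "s \<in> ball 0 R" using sR by blast
      have "factor A (z, s) * (s - w) \<noteq> 0" if "z \<in> ball 0 \<delta>" for z
        using factor_nonzero[OF A that, of s] s ne[OF s w] by simp
      then show "(\<lambda>z. K (z, w) s) holomorphic_on ball 0 \<delta>"
        unfolding K_def fst_conv snd_conv
        by (intro holomorphic_on_divide holomorphic_on_mult hol1[OF sb] factor_holomorphic1[OF A]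
            holomorphic_on_const)
    qed (use w pos in \<open>auto intro!: continuous_intros\<close>)
  next
    fix z :: complex assume z: "z \<in> ball 0 \<delta>"
    show "(\<lambda>w. q (z, w)) holomorphic_on ball 0 \<rho>"
      unfolding q_def
    proof (intro holomorphic_intros holomorphic_on_contour_integral_circlepath slice)
      fix s :: complex assume s: "s \<in> sphere 0 \<rho>"
      then have "factor A (z, s) * (s - w) \<noteq> 0" if "w \<in> ball 0 \<rho>" for w
        using factor_nonzero[OF A z, of s] ne[OF s that] by simp
      then show "(\<lambda>w. K (z, w) s) holomorphic_on ball 0 \<rho>"
        unfolding K_def fst_conv snd_conv by (intro holomorphic_intros)
    qed (use z pos in \<open>auto intro!: continuous_intros\<close>)
  qed
  moreover have eq: "f (z, w) = factor A (z, w) * q (z, w)" if z: "z \<in> punctured" and w: "w \<in> ball 0 \<rho>" for z w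
  proof -
    have zd: "z \<in> ball 0 \<delta>" "z \<noteq> 0" using z by auto
    have fs: "fiber A z \<subseteq> ball 0 R" using pos by (auto simp: fiber_def roots_def)
    obtain H where H: "H holomorphic_on ball 0 R"
      "\<And>w. w \<in> ball 0 R \<Longrightarrow> f (z, w) = factor A (z, w) * H w"
      using holomorphic_divide_zeros[OF hol2[OF zd(1)] open_ball connected_ball
          nonzero_on_disc[OF zd(1)] finite_fiber[OF zd(1)] fs] zd
      by (auto simp: factor_def root_mult_def)
    \<comment> \<open>For fixed z \<noteq> 0 the one-variable quotient H is holomorphic on the
      larger disc, so Cauchy's formula recovers it from its values on the circle, where it agrees
      with \<open>f / factor A\<close>.\<close>
    have "((\<lambda>s. H s / (s - w)) has_contour_integral 2 * of_real pi * \<i> * H w) (circlepath 0 \<rho>)"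
      by (rule Cauchy_integral_circlepath_simple)
         (use H w pos in \<open>auto intro: holomorphic_on_subset\<close>)
    then have "(K (z, w) has_contour_integral 2 * of_real pi * \<i> * H w) (circlepath 0 \<rho>)"
    proof (rule has_contour_integral_eq)
      fix s assume "s \<in> path_image (circlepath 0 \<rho>)"
      then have s: "s \<in> sphere 0 \<rho>" using pos by simp
      then have "f (z, s) = factor A (z, s) * H s" using H(2) sR by blast
      moreover have "factor A (z, s) \<noteq> 0" using factor_nonzero[OF A zd(1)] s by simp
      ultimately show "H s / (s - w) = K (z, w) s" by (simp add: K_def)
    qed
    then have "q (z, w) = H w" by (simp add: q_def contour_integral_unique)
    then show ?thesis using H(2)[of w] w pos by simp
  qed
  \<comment> \<open>At z = 0 the divisor is defined by a limit and not by a fiber, so the identity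
    is extended by continuity in z.\<close>
  moreover have "f (0, w) = factor A (0, w) * q (0, w)" if w: "w \<in> ball 0 \<rho>" for w
  proof -
    have z0: "0 \<in> ball (0::complex) \<delta>" "w \<in> ball 0 R" using pos w by auto
    have c: "continuous_on (ball 0 \<delta>) (\<lambda>z. f (z, w))"
      "continuous_on (ball 0 \<delta>) (\<lambda>z. factor A (z, w) * q (z, w))"
      using hol1[OF z0(2)] factor_holomorphic1[OF A, of w] \<open>admissible q\<close> w
      unfolding admissible_def
      by (auto intro!: holomorphic_on_imp_continuous_on holomorphic_intros)
    then have "((\<lambda>z. f (z, w)) \<longlongrightarrow> f (0, w)) (at 0)"
      "((\<lambda>z. factor A (z, w) * q (z, w)) \<longlongrightarrow> factor A (0, w) * q (0, w)) (at 0)"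
      using z0(1) by (simp_all add: continuous_on_eq_continuous_at isCont_def)
    moreover have "\<forall>\<^sub>F z in at 0. f (z, w) = factor A (z, w) * q (z, w)"
      unfolding eventually_at using eq[OF _ w] pos by (intro exI[of _ \<delta>]) auto
    ultimately show ?thesis
      by (intro tendsto_unique[OF trivial_limit_at, of "\<lambda>z. f (z, w)"])
         (auto elim: Lim_transform_eventually simp: eq_commute)
  qed
  ultimately show thesis by (intro that[of q]) (auto split: if_splits)
qed

text \<open>Roots outside A are zeros of f but not of \<open>factor A\<close>, hence zeros of the
  cofactor q. They exist over every z near 0 and converge to the origin, so q vanishes there by
  continuity.\<close>

lemma factorization:
  assumes A: "clopen_over punctured A" and "deg A > 0" "deg (- A) > 0"
  obtains g q where "admissible g" "admissible q" "g (0, 0) = 0" "q (0, 0) = 0"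
    "\<And>z w. z \<in> ball 0 \<delta> \<Longrightarrow> w \<in> ball 0 \<rho> \<Longrightarrow> f (z, w) = g (z, w) * q (z, w)"
proof -
  obtain q where q: "admissible q"
    "\<And>z w. z \<in> ball 0 \<delta> \<Longrightarrow> w \<in> ball 0 \<rho> \<Longrightarrow> f (z, w) = factor A (z, w) * q (z, w)"
    using factor_divides[OF A] by blast
  have "q (0, 0) = 0"
  proof (rule ccontr)
    assume "q (0, 0) \<noteq> 0"
    moreover have "isCont q (0, 0)" using admissible_isCont[OF q(1)] pos by simp
    ultimately obtain r where r: "r > 0" "\<And>p. dist (0, 0) p < r \<Longrightarrow> q p \<noteq> 0"
      using continuous_at_avoid[of "(0, 0)" q 0] by blast
    obtain d where d: "d > 0" "d \<le> \<delta>" "\<And>z w. z \<in> ball 0 d \<Longrightarrow> w \<in> roots z \<Longrightarrow> norm w < r / 2"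
      using roots_near_0[of "r / 2"] r by auto
    \<comment> \<open>A nonzero base point with norm at most r / 2; the root over it has norm below
      r / 2, so the pair lies within r of the origin.\<close>
    define z :: complex where "z = of_real (min d r / 2)"
    have z: "z \<in> punctured" "z \<in> ball 0 d" "norm z < r" "norm z \<le> r / 2" using d r by (auto simp: z_def)
    have "total (- A) z = deg (- A)"
      by (rule total_eq_deg[OF clopen_over_compl[OF A] z(1)])
    then obtain b where b: "b \<in> fiber (- A) z"
      using total_eq_0_iff[of z "- A"] z assms(3) by auto
    then have br: "b \<in> roots z" "b \<notin> fiber A z" by (auto simp: fiber_def)
    then have "factor A (z, b) * q (z, b) = 0"
      using q(2)[of z b] z by (auto simp: roots_def)
    then have "q (z, b) = 0" using factor_eq_0_iff[OF A z(1), of b] br by simp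
    moreover have "dist (0, 0) (z, b) = norm (z, b)"
      by (metis dist_0_norm zero_prod_def)
    then have "dist (0, 0) (z, b) < r"
      using norm_Pair_le[of z b] d(3)[OF z(2) br(1)] z(4) by linarith
    ultimately show False using r(2) by blast
  qed
  moreover have "factor A (0, 0) = 0" using assms(2) by (simp add: factor_def)
  ultimately show thesis using that[OF admissible_factor[OF A] q(1)] q(2) by blast
qed

end

lemma holo_germ_unit_nonzero: "holo_germ_unit f \<Longrightarrow> f 0 \<noteq> 0"
  unfolding holo_germ_unit_def by (auto dest: eventually_nhds_x_imp_x)

context branched_cover
begin

lemma bidisc_nhds: "\<forall>\<^sub>F p in nhds 0. p \<in> ball 0 \<delta> \<times> ball 0 \<rho>"
  using pos by (intro eventually_nhds_in_open open_Times) (auto simp: zero_prod_def)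

lemma holo_germ_admissible: assumes "admissible \<phi>" shows "holo_germ \<phi>"
  unfolding holo_germ_def using bidisc_nhds
proof eventually_elim
  case (elim p)
  then show ?case
    using has_derivative_separately_holomorphic[of "ball 0 \<delta>" "ball 0 \<rho>" \<phi> "fst p" "snd p"] assms
    unfolding admissible_def by (auto simp: mem_Times_iff)
qed

text \<open>If both A and its complement had positive degree, f would be a product of two germs
  vanishing at the origin, neither of them a unit.\<close>

lemma clopen_trivial:
  assumes irr: "holo_germ_irreducible f" and A: "clopen_over punctured A"
  shows "(\<forall>z\<in>punctured. fiber A z = {}) \<or> (\<forall>z\<in>punctured. fiber A z = roots z)"
proof (cases "deg A = 0 \<or> deg (- A) = 0")
  case True
  have "fiber A z = {}" if "deg A = 0" "z \<in> punctured" for z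
    using total_eq_deg[OF A that(2)] total_eq_0_iff[of z A] that by auto
  moreover have "fiber A z = roots z" if "deg (- A) = 0" "z \<in> punctured" for z
  proof -
    have "fiber (- A) z = {}"
      using total_eq_deg[OF clopen_over_compl[OF A] that(2)] total_eq_0_iff[of z "- A"] that by auto
    then show ?thesis by (auto simp: fiber_def)
  qed
  ultimately show ?thesis using True by blast
next
  case False
  then obtain g q where gq: "admissible g" "admissible q" "g (0, 0) = 0" "q (0, 0) = 0"
    "\<And>z w. z \<in> ball 0 \<delta> \<Longrightarrow> w \<in> ball 0 \<rho> \<Longrightarrow> f (z, w) = g (z, w) * q (z, w)"
    using factorization[OF A] by auto
  have "\<forall>\<^sub>F p in nhds 0. f p = g p * q p"
    using bidisc_nhds by eventually_elim (auto simp: gq(5))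
  then have "holo_germ_unit g \<or> holo_germ_unit q"
    using irr holo_germ_admissible gq(1,2) unfolding holo_germ_irreducible_def by blast
  then show ?thesis
    using holo_germ_unit_nonzero gq(3,4) by (auto simp: zero_prod_def)
qed

lemma connected_punctured_zeros:
  assumes irr: "holo_germ_irreducible f"
  shows "connected {(z, w). z \<in> punctured \<and> w \<in> roots z}" (is "connected ?W")
  unfolding connected_clopen
proof (intro allI impI)
  fix T assume "openin (top_of_set ?W) T \<and> closedin (top_of_set ?W) T"
  then have T: "openin (top_of_set ?W) T" "openin (top_of_set ?W) (?W - T)" "T \<subseteq> ?W"
    by (auto simp: closedin_def openin_imp_subset)
  \<comment> \<open>Passes from relative openness in the product metric to the separate bounds on z
    and w in \<open>clopen_over\<close>.\<close>
  have nb: "\<exists>e>0. \<forall>z\<in>ball z0 e. \<forall>w\<in>roots z \<inter> ball a e. (z, w) \<in> X"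
    if X: "openin (top_of_set ?W) X" and za: "(z0, a) \<in> X" for X z0 a
  proof -
    obtain e where e: "e > 0" "ball (z0, a) e \<inter> ?W \<subseteq> X"
      using X za unfolding openin_contains_ball by blast
    have "z0 \<in> punctured" using X za openin_imp_subset by blast
    then obtain r where r: "r > 0" "ball z0 r \<subseteq> punctured"
      using punctured(1) open_contains_ball by blast
    have "(z, w) \<in> X" if "z \<in> ball z0 (min r (e / 2))" "w \<in> roots z \<inter> ball a (min r (e / 2))" for z w
    proof -
      have "dist (z0, a) (z, w) \<le> dist z0 z + dist a w"
        using sqrt_sum_squares_le_sum[of "dist z0 z" "dist a w"] by (simp add: dist_Pair_Pair)
      then have "(z, w) \<in> ball (z0, a) e" using that by simp
      moreover have "z \<in> ball z0 r" using that by simp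
      then have "z \<in> punctured" using r by blast
      ultimately show ?thesis using e that by blast
    qed
    then show ?thesis using e r by (intro exI[of _ "min r (e / 2)"]) auto
  qed
  have "clopen_over punctured T"
    unfolding clopen_over_def
  proof (intro ballI)
    fix z0 a assume "z0 \<in> punctured" "a \<in> roots z0"
    then consider "(z0, a) \<in> T" | "(z0, a) \<in> ?W - T" by blast
    then show "\<exists>e>0. \<forall>z\<in>ball z0 e. \<forall>w\<in>roots z \<inter> ball a e. ((z, w) \<in> T) = ((z0, a) \<in> T)"
    proof cases
      case 1
      then show ?thesis using nb[OF T(1)] by blast
    next
      case 2
      then show ?thesis using nb[OF T(2)] by blast
    qed
  qed
  from clopen_trivial[OF irr this] show "T = {} \<or> T = ?W"
    using T(3) by (fastforce simp: fiber_def)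
qed

text \<open>The set \<open>roots z\<close> depends on f and \<rho> only, so the fibers over the
  smaller disc are unchanged. The common zeros with a second function become clopen only after such
  shrinking.\<close>

lemma restrict_disc:
  assumes "0 < \<delta>'" "\<delta>' \<le> \<delta>"
  shows "branched_cover f R \<delta>' \<rho>"
proof -
  have s: "ball (0::complex) \<delta>' \<subseteq> ball 0 \<delta>" using assms by auto
  show ?thesis
  proof
    show "continuous_on (ball 0 \<delta>' \<times> ball 0 R) f"
      by (rule continuous_on_subset[OF cont]) (use s in auto)
    show "(\<lambda>z. f (z, w)) holomorphic_on ball 0 \<delta>'" if "w \<in> ball 0 R" for w
      using hol1[OF that] s holomorphic_on_subset by blast
    show "(\<lambda>w. f (z, w)) holomorphic_on ball 0 R" if "z \<in> ball 0 \<delta>'" for z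
      using hol2 that s by blast
    show "f (z, w) \<noteq> 0" if "z \<in> ball 0 \<delta>'" "norm w = \<rho>" for z w
      using boundary that s by blast
  qed (use pos assms centre in auto)
qed

section \<open>Common zeros with a second function\<close>

text \<open>In reversed form a factor with value 0 is the constant 1 and any other factor has degree
  1, so the degree counts the roots at which \<phi> does not vanish.\<close>

lemma degree_charpoly:
  assumes z: "z \<in> punctured"
  shows "degree (charpoly \<phi> UNIV z) = (\<Sum>w\<in>roots z. if \<phi> (z, w) = 0 then 0 else root_mult z w)"
proof -
  have "degree (charpoly \<phi> UNIV z) = (\<Sum>w\<in>roots z. degree ([:1, - \<phi> (z, w):] ^ root_mult z w))"
    using z by (simp add: charpoly_def) (subst degree_prod_sum_eq, auto)
  also have "\<dots> = (\<Sum>w\<in>roots z. if \<phi> (z, w) = 0 then 0 else root_mult z w)"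
    by (intro sum.cong) (auto simp: degree_power_eq)
  finally show ?thesis .
qed

text \<open>
  The zeros of \<open>\<phi>\<close> on the fiber over \<open>z\<close> account for the drop in the degree of the reversed
  characteristic polynomial, whose coefficients are holomorphic in \<open>z\<close>. Near the origin their
  number is thus constant, so \<open>\<phi> = 0\<close> is a closed and open condition there.
\<close>

lemma zeros_clopen:
  assumes \<phi>: "admissible \<phi>"
  obtains \<delta>' where "0 < \<delta>'" "\<delta>' \<le> \<delta>" "clopen_over (ball 0 \<delta>' - {0}) {p. \<phi> p = 0}"
proof -
  define Q where "Q k z = coeff (charpoly \<phi> UNIV z) k" for k z
  have Q: "Q k holomorphic_on ball 0 \<delta>" for k
    unfolding Q_def by (rule coeff_charpoly_holomorphic[OF clopen_over_UNIV \<phi>])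
  define d where "d z = (\<Sum>w\<in>roots z. if \<phi> (z, w) = 0 then 0 else root_mult z w)" for z
  have d: "degree (charpoly \<phi> UNIV z) = d z" if "z \<in> punctured" for z
    using degree_charpoly[OF that] by (simp add: d_def)
  have dle: "d z \<le> deg UNIV" if "z \<in> punctured" for z
  proof -
    have "d z \<le> sum (root_mult z) (roots z)" unfolding d_def by (rule sum_mono) simp
    also have "\<dots> = deg UNIV" using total_eq_deg[OF clopen_over_UNIV that] by (simp add: total_def)
    finally show ?thesis .
  qed
  \<comment> \<open>The indices of coefficients that do not vanish identically. The coefficient of
    largest such index K has isolated zeros, so near 0, off the origin, the degree is exactly
    K.\<close>
  define S where "S = {k. k \<le> deg UNIV \<and> (\<exists>z\<in>punctured. Q k z \<noteq> 0)}"
  have "0 \<in> S"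
  proof -
    have "Q 0 z = 1" for z
      unfolding Q_def poly_0_coeff_0[symmetric] charpoly_def by (simp add: poly_prod)
    then have "Q 0 (of_real (\<delta> / 2)) \<noteq> 0" by simp
    then show ?thesis unfolding S_def using punctured(4) le0[of "deg UNIV"] by blast
  qed
  have finS: "finite S" by (rule finite_subset[of _ "{..deg UNIV}"]) (auto simp: S_def)
  define K where "K = Max S"
  have "K \<in> S" unfolding K_def using finS \<open>0 \<in> S\<close> by (intro Max_in) auto
  then obtain z1 where z1: "z1 \<in> punctured" "Q K z1 \<noteq> 0" unfolding S_def by blast
  have "\<forall>\<^sub>F z in at 0. Q K z \<noteq> 0 \<and> z \<in> ball 0 \<delta>"
    by (rule non_zero_neighbour_alt[OF Q open_ball connected_ball _ _ z1(2)])
       (use z1 pos in auto)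
  then obtain r where r: "r > 0" "\<And>z. z \<noteq> 0 \<Longrightarrow> dist z 0 < r \<Longrightarrow> Q K z \<noteq> 0"
    unfolding eventually_at by blast
  define \<delta>' where "\<delta>' = min r \<delta>"
  have \<delta>': "0 < \<delta>'" "\<delta>' \<le> \<delta>" using r pos by (auto simp: \<delta>'_def)
  let ?D = "ball (0::complex) \<delta>' - {0}"
  have Dp: "?D \<subseteq> punctured" "open ?D" "?D \<subseteq> ball 0 \<delta>" using \<delta>' by (auto simp: open_Diff)
  have dK: "d z = K" if z: "z \<in> ?D" for z
  proof -
    have zp: "z \<in> punctured" using z Dp by blast
    have "Q K z \<noteq> 0" using r(2)[of z] z by (auto simp: \<delta>'_def)
    then have "K \<le> d z" using d[OF zp] le_degree by (force simp: Q_def)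
    moreover have "d z \<le> K"
    proof (cases "d z = 0")
      case False
      then have "coeff (charpoly \<phi> UNIV z) (d z) \<noteq> 0"
        using d[OF zp] by (metis degree_0 leading_coeff_0_iff)
      then have "d z \<in> S" using dle[OF zp] zp by (auto simp: S_def Q_def)
      then show ?thesis unfolding K_def using finS by simp
    qed simp
    ultimately show ?thesis by simp
  qed
  have nb: "\<exists>e>0. \<forall>z\<in>ball z0 e. \<forall>w\<in>ball a e. \<phi> (z, w) \<noteq> 0"
    if "z0 \<in> ?D" "a \<in> roots z0" and \<phi>0: "\<phi> (z0, a) \<noteq> 0" for z0 a
  proof -
    have "isCont \<phi> (z0, a)"
      using admissible_isCont[OF \<phi>] that Dp by (auto simp: roots_def)
    then obtain e where e: "e > 0" "\<And>p. dist (z0, a) p < e \<Longrightarrow> \<phi> p \<noteq> 0"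
      using continuous_at_avoid[of "(z0, a)" \<phi> 0] \<phi>0 by blast
    have "\<phi> (z, w) \<noteq> 0" if "z \<in> ball z0 (e / 2)" "w \<in> ball a (e / 2)" for z w
    proof (rule e(2))
      have "dist (z0, a) (z, w) \<le> dist z0 z + dist a w"
        using sqrt_sum_squares_le_sum[of "dist z0 z" "dist a w"] by (simp add: dist_Pair_Pair)
      then show "dist (z0, a) (z, w) < e" using that by simp
    qed
    then show ?thesis using e by (intro exI[of _ "e / 2"]) auto
  qed
  have "clopen_over ?D {p. \<phi> p = 0}"
    unfolding clopen_over_def
  proof (intro ballI)
    fix z0 a assume z0: "z0 \<in> ?D" and a: "a \<in> roots z0"
    have z0d: "z0 \<in> ball 0 \<delta>" using z0 Dp by blast
    show "\<exists>e>0. \<forall>z\<in>ball z0 e. \<forall>w\<in>roots z \<inter> ball a e.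
      ((z, w) \<in> {p. \<phi> p = 0}) = ((z0, a) \<in> {p. \<phi> p = 0})"
    proof (cases "\<phi> (z0, a) = 0")
      case False
      then show ?thesis using nb[OF z0 a] by auto
    next
      case True
      \<comment> \<open>By \<open>local_total\<close> the discs around roots with \<phi> \<noteq> 0
        already contribute d z0 to d z. Both numbers equal K, so nothing remains for the other
        discs, and every root in them, having positive multiplicity, must be a zero of
        \<phi>.\<close>
      define NZ where "NZ = {b \<in> roots z0. \<phi> (z0, b) \<noteq> 0}"
      have finNZ: "finite NZ" using finite_roots[OF z0d] by (simp add: NZ_def)
      obtain h where h: "\<And>b. b \<in> NZ \<Longrightarrow> h b > 0 \<and> (\<forall>z\<in>ball z0 (h b). \<forall>w\<in>ball b (h b). \<phi> (z, w) \<noteq> 0)"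
        using nb[OF z0] unfolding NZ_def by (simp add: Ball_def) metis
      define e where "e = Min (insert 1 (h ` NZ))"
      have e: "e > 0" unfolding e_def using finNZ h by (subst Min_gr_iff) auto
      have eh: "e \<le> h b" if "b \<in> NZ" for b
        unfolding e_def using finNZ that by (intro Min_le) auto
      obtain \<epsilon> \<eta> where iso: "isolating z0 \<epsilon> \<eta>" "\<epsilon> < e" "\<eta> \<le> e" "ball z0 \<eta> \<subseteq> ?D"
        using clopen_isolating[OF Dp(2,3) clopen_over_UNIV z0 e] by metis
      have pos': "\<epsilon> > 0" "\<eta> > 0" using iso by (auto simp: isolating_def)
      have "\<phi> (z, w) = 0" if z: "z \<in> ball z0 \<eta>" and w: "w \<in> roots z" "w \<in> ball a \<epsilon>" for z w
      proof -
        have zD: "z \<in> ?D" "z \<in> ball 0 \<delta>" using z iso Dp by blast+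
        define s where "s b = (\<Sum>p\<in>roots z \<inter> ball b \<epsilon>. if \<phi> (z, p) = 0 then 0 else root_mult z p)" for b
        have rz: "roots z = (\<Union>b\<in>roots z0. roots z \<inter> ball b \<epsilon>)"
          using isolating_roots[OF iso(1) z] by blast
        have "d z = (\<Sum>w\<in>(\<Union>b\<in>roots z0. roots z \<inter> ball b \<epsilon>).
            if \<phi> (z, w) = 0 then 0 else root_mult z w)"
          unfolding d_def by (rule sum.cong[OF rz refl])
        also have "\<dots> = (\<Sum>b\<in>roots z0. s b)"
          unfolding s_def by (rule sum_isolating[OF iso(1) z subset_refl])
        also have "\<dots> = (\<Sum>b\<in>NZ. s b) + (\<Sum>b\<in>roots z0 - NZ. s b)"
          using sum.subset_diff[of NZ "roots z0" s] finite_roots[OF z0d] by (auto simp: NZ_def)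
        also have "(\<Sum>b\<in>NZ. s b) = (\<Sum>b\<in>NZ. root_mult z0 b)"
        proof (rule sum.cong)
          fix b assume b: "b \<in> NZ"
          have "s b = (\<Sum>p\<in>roots z \<inter> ball b \<epsilon>. root_mult z p)"
            unfolding s_def
          proof (rule sum.cong)
            fix p assume "p \<in> roots z \<inter> ball b \<epsilon>"
            then have "z \<in> ball z0 (h b)" "p \<in> ball b (h b)"
              using eh[OF b] iso(2,3) z by auto
            then show "(if \<phi> (z, p) = 0 then 0 else root_mult z p) = root_mult z p" using h[OF b] by simp
          qed simp
          also have "\<dots> = root_mult z0 b"
            by (rule local_total[OF iso(1) _ z]) (use b in \<open>simp add: NZ_def\<close>)
          finally show "s b = root_mult z0 b" .
        qed simp
        also have "(\<Sum>b\<in>NZ. root_mult z0 b) = d z0"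
          unfolding d_def NZ_def using finite_roots[OF z0d]
          by (intro sum.mono_neutral_cong_left) auto
        finally have "(\<Sum>b\<in>roots z0 - NZ. s b) = 0" using dK[OF z0] dK[OF zD(1)] by simp
        moreover have "a \<in> roots z0 - NZ" using a True by (simp add: NZ_def)
        ultimately have "s a = 0" using finite_roots[OF z0d] by (simp add: sum_eq_0_iff)
        then have "(if \<phi> (z, w) = 0 then 0 else root_mult z w) = 0"
          unfolding s_def using finite_roots[OF zD(2)] w by (subst (asm) sum_eq_0_iff) auto
        then show ?thesis using zorder_root(2)[OF zD(2) w(1)] by (auto split: if_splits)
      qed
      then show ?thesis
        using pos' True by (intro exI[of _ "min \<epsilon> \<eta>"]) auto
    qed
  qed
  with \<delta>' show thesis by (rule that)
qed

lemma zeros_dichotomy: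
  assumes irr: "holo_germ_irreducible f" and \<phi>: "admissible \<phi>"
  obtains d where "0 < d" "d \<le> \<delta>"
    "(\<forall>z\<in>ball 0 d - {0}. \<forall>w\<in>roots z. \<phi> (z, w) \<noteq> 0) \<or>
     (\<forall>z\<in>ball 0 d - {0}. \<forall>w\<in>roots z. \<phi> (z, w) = 0)"
proof -
  obtain \<delta>' where d: "0 < \<delta>'" "\<delta>' \<le> \<delta>" "clopen_over (ball 0 \<delta>' - {0}) {p. \<phi> p = 0}"
    using zeros_clopen[OF \<phi>] by blast
  interpret small: branched_cover f R \<delta>' \<rho> by (rule restrict_disc[OF d(1,2)])
  show thesis
    using small.clopen_trivial[OF irr d(3)] d(1,2)
    by (intro that[of \<delta>']) (auto simp: fiber_def)
qed

end

subsection \<open>Irreducible germs\<close>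

lemma holo_germ_obtain_ball:
  assumes "holo_germ f"
  obtains r where "r > 0"
    "\<And>p. p \<in> ball 0 r \<Longrightarrow> \<exists>a b. (f has_derivative (\<lambda>(u, v). a * u + b * v)) (at p)"
  using assms unfolding holo_germ_def eventually_nhds_metric by (auto simp: dist_commute)

lemma holo_germ_separately_holomorphic:
  assumes "holo_germ f"
  obtains r where "r > 0" "continuous_on (ball 0 r \<times> ball 0 r) f"
    "\<And>w. w \<in> ball 0 r \<Longrightarrow> (\<lambda>z. f (z, w)) holomorphic_on ball 0 r"
    "\<And>z. z \<in> ball 0 r \<Longrightarrow> (\<lambda>w. f (z, w)) holomorphic_on ball 0 r"
proof -
  obtain r where r: "r > 0"
    "\<And>p. p \<in> ball 0 r \<Longrightarrow> \<exists>a b. (f has_derivative (\<lambda>(u, v). a * u + b * v)) (at p)"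
    using holo_germ_obtain_ball[OF assms] by metis
  have sub: "(z, w) \<in> ball 0 r" if "z \<in> ball 0 (r / 2)" "w \<in> ball 0 (r / 2)" for z w :: complex
    using norm_Pair_le[of z w] that by simp
  show thesis
  proof
    show "r / 2 > 0" using r by simp
    show "continuous_on (ball 0 (r / 2) \<times> ball 0 (r / 2)) f"
    proof (intro continuous_at_imp_continuous_on ballI)
      fix p :: "complex \<times> complex" assume "p \<in> ball 0 (r / 2) \<times> ball 0 (r / 2)"
      then show "isCont f p" using r(2)[of p] sub has_derivative_continuous by (cases p) blast
    qed
    show "(\<lambda>z. f (z, w)) holomorphic_on ball 0 (r / 2)" if "w \<in> ball 0 (r / 2)" for w
      unfolding holomorphic_on_open[OF open_ball]
    proof
      fix z :: complex assume "z \<in> ball 0 (r / 2)"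
      then obtain a b where "(f has_derivative (\<lambda>(u, v). a * u + b * v)) (at (z, w))"
        using r(2) sub \<open>w \<in> ball 0 (r / 2)\<close> by blast
      then have "((\<lambda>z. f (z, w)) has_derivative (\<lambda>u. (\<lambda>(u, v). a * u + b * v) (u, 0))) (at z)"
        by (intro has_derivative_compose[of "\<lambda>z. (z, w)" "\<lambda>u. (u, 0)" z UNIV f]) (auto intro!: derivative_eq_intros)
      then show "\<exists>f'. ((\<lambda>z. f (z, w)) has_field_derivative f') (at z)"
        by (auto simp: has_field_derivative_def intro!: exI[of _ a])
    qed
    show "(\<lambda>w. f (z, w)) holomorphic_on ball 0 (r / 2)" if "z \<in> ball 0 (r / 2)" for z
      unfolding holomorphic_on_open[OF open_ball]
    proof
      fix w :: complex assume "w \<in> ball 0 (r / 2)"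
      then obtain a b where "(f has_derivative (\<lambda>(u, v). a * u + b * v)) (at (z, w))"
        using r(2) sub \<open>z \<in> ball 0 (r / 2)\<close> by blast
      then have "((\<lambda>w. f (z, w)) has_derivative (\<lambda>u. (\<lambda>(u, v). a * u + b * v) (0, u))) (at w)"
        by (intro has_derivative_compose[of "\<lambda>w. (z, w)" "\<lambda>u. (0, u)" w UNIV f]) (auto intro!: derivative_eq_intros)
      then show "\<exists>f'. ((\<lambda>w. f (z, w)) has_field_derivative f') (at w)"
        by (auto simp: has_field_derivative_def intro!: exI[of _ b])
    qed
  qed
qed

section \<open>Germs in general position\<close>

definition regular_in_w :: "(complex \<times> complex \<Rightarrow> complex) \<Rightarrow> bool" where
  "regular_in_w f \<longleftrightarrow> \<not> (\<forall>\<^sub>F w in nhds 0. f (0, w) = 0)"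

text \<open>The radius \<rho> comes first, below the isolated zero of \<open>f (0, w)\<close> at w =
  0; then f is nonzero on the compact circle over z = 0, and the tube lemma provides
  \<delta>.\<close>

lemma exists_branched_cover:
  assumes f: "holo_germ f" "f 0 = 0" and reg: "regular_in_w f" and e: "e > 0"
  obtains R \<delta> \<rho> where "branched_cover f R \<delta> \<rho>" "\<delta> < e" "\<rho> < e"
proof -
  obtain R where R: "R > 0" and cont: "continuous_on (ball 0 R \<times> ball 0 R) f"
    and h1: "\<And>w. w \<in> ball 0 R \<Longrightarrow> (\<lambda>z. f (z, w)) holomorphic_on ball 0 R"
    and h2: "\<And>z. z \<in> ball 0 R \<Longrightarrow> (\<lambda>w. f (z, w)) holomorphic_on ball 0 R"
    using holo_germ_separately_holomorphic[OF f(1)] by metis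
  have R0: "0 \<in> ball (0::complex) R" using R by simp
  have "\<exists>w\<in>ball 0 R. f (0, w) \<noteq> 0"
  proof (rule ccontr)
    assume "\<not> ?thesis"
    then have "\<forall>\<^sub>F w in nhds 0. f (0, w) = 0"
      using eventually_nhds_in_open[OF open_ball R0] by (auto elim: eventually_mono)
    then show False using reg by (simp add: regular_in_w_def)
  qed
  then obtain w1 where w1: "w1 \<in> ball 0 R" "f (0, w1) \<noteq> 0" by blast
  have "\<forall>\<^sub>F w in at 0. f (0, w) \<noteq> 0 \<and> w \<in> ball 0 R"
    by (rule non_zero_neighbour_alt[OF h2[OF R0] open_ball connected_ball R0 w1])
  then obtain r where r: "r > 0" "\<And>w. w \<noteq> 0 \<Longrightarrow> dist w 0 < r \<Longrightarrow> f (0, w) \<noteq> 0"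
    unfolding eventually_at by blast
  define \<rho> where "\<rho> = min r (min R e) / 2"
  have \<rho>: "0 < \<rho>" "\<rho> < r" "\<rho> < R" "\<rho> < e" using r R e by (auto simp: \<rho>_def)
  define Op where "Op = (ball 0 R \<times> ball 0 R) \<inter> f -` (- {0})"
  have "open Op" unfolding Op_def
    by (rule continuous_open_preimage[OF cont]) (auto intro: open_Times)
  moreover have "{0} \<times> sphere 0 \<rho> \<subseteq> Op"
    using r(2) \<rho> R by (auto simp: Op_def)
  ultimately have "\<exists>U V. open U \<and> open V \<and> 0 \<in> U \<and> sphere 0 \<rho> \<subseteq> V \<and> U \<times> V \<subseteq> Op"
    using tube_lemma_right[of euclidean euclidean Op "sphere 0 \<rho>" 0]
    by (simp add: euclidean_product_topology)
  then obtain U V where UV: "open U" "0 \<in> U" "sphere 0 \<rho> \<subseteq> V" "U \<times> V \<subseteq> Op" by blast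
  obtain \<eta> where \<eta>: "\<eta> > 0" "ball 0 \<eta> \<subseteq> U" using UV open_contains_ball by blast
  define \<delta> where "\<delta> = min \<eta> (min R e) / 2"
  have \<delta>: "0 < \<delta>" "\<delta> < \<eta>" "\<delta> < R" "\<delta> < e" using \<eta> R e by (auto simp: \<delta>_def)
  have sub: "ball (0::complex) \<delta> \<subseteq> ball 0 R" "ball (0::complex) \<delta> \<subseteq> ball 0 \<eta>" using \<delta> by auto
  have "branched_cover f R \<delta> \<rho>"
  proof
    show "continuous_on (ball 0 \<delta> \<times> ball 0 R) f"
      by (rule continuous_on_subset[OF cont]) (use sub in auto)
    show "(\<lambda>z. f (z, w)) holomorphic_on ball 0 \<delta>" if "w \<in> ball 0 R" for w
      using h1[OF that] sub(1) holomorphic_on_subset by blast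
    show "(\<lambda>w. f (z, w)) holomorphic_on ball 0 R" if "z \<in> ball 0 \<delta>" for z
      using h2 that sub(1) by blast
    show "f (z, w) \<noteq> 0" if "z \<in> ball 0 \<delta>" "norm w = \<rho>" for z w
    proof -
      have "z \<in> U" "w \<in> V" using that sub(2) \<eta>(2) UV(3) by auto
      then show ?thesis using UV(4) by (auto simp: Op_def)
    qed
    show "f (0, w) = 0 \<longleftrightarrow> w = 0" if "norm w \<le> \<rho>" for w
      using r(2)[of w] that \<rho> f(2) by (auto simp: zero_prod_def)
  qed (use \<rho> \<delta> in auto)
  with \<delta>(4) \<rho>(4) show thesis by (intro that)
qed

lemma holo_germ_unitI:
  assumes f: "holo_germ f" and "f 0 \<noteq> 0" shows "holo_germ_unit f"
proof -
  obtain r where r: "r > 0"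
    "\<And>p. p \<in> ball 0 r \<Longrightarrow> \<exists>a b. (f has_derivative (\<lambda>(u, v). a * u + b * v)) (at p)"
    using holo_germ_obtain_ball[OF f] by metis
  have "isCont f 0" using r(2)[of 0] r(1) has_derivative_continuous by force
  then obtain e where e: "e > 0" "\<And>p. dist 0 p < e \<Longrightarrow> f p \<noteq> 0"
    using continuous_at_avoid[of 0 f 0] assms(2) by blast
  have ev: "\<forall>\<^sub>F p in nhds 0. p \<in> ball 0 (min r e)"
    using r e by (intro eventually_nhds_in_open) auto
  then have "\<forall>\<^sub>F p in nhds 0. f p * inverse (f p) = 1"
    by eventually_elim (use e in auto)
  moreover have "holo_germ (\<lambda>p. inverse (f p))"
    unfolding holo_germ_def using ev
  proof eventually_elim
    case (elim p)
    then obtain a b where ab: "(f has_derivative (\<lambda>(u, v). a * u + b * v)) (at p)"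
      using r(2)[of p] by auto
    have "f p \<noteq> 0" using e elim by simp
    from Deriv.has_derivative_inverse[OF this ab] have "((\<lambda>p. inverse (f p)) has_derivative
        (\<lambda>h. - (inverse (f p) * (case h of (u, v) \<Rightarrow> a * u + b * v) * inverse (f p)))) (at p)"
      .
    also have "(\<lambda>h. - (inverse (f p) * (case h of (u, v) \<Rightarrow> a * u + b * v) * inverse (f p))) =
        (\<lambda>(u, v). (- inverse (f p) * a * inverse (f p)) * u + (- inverse (f p) * b * inverse (f p)) * v)"
      by (auto simp: fun_eq_iff algebra_simps)
    finally show ?case by blast
  qed
  ultimately show ?thesis using f unfolding holo_germ_unit_def by blast
qed

lemma holo_germ_irreducible_at_0: "holo_germ_irreducible f \<Longrightarrow> f 0 = 0"
  using holo_germ_unitI unfolding holo_germ_irreducible_def by blast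

text \<open>The connected set is the punctured cover over a bidisc. It is only sandwiched between
  the zeros in two punctured balls, because nothing is claimed about connectedness inside a round
  ball.\<close>

lemma connected_zeros_regular:
  assumes f: "holo_germ_irreducible f" and reg: "regular_in_w f" and e: "e > 0"
  shows "\<exists>W d. d > 0 \<and> connected W \<and> W \<noteq> {} \<and> W \<subseteq> {p. f p = 0} \<inter> ball 0 e - {0} \<and>
    {p. f p = 0} \<inter> ball 0 d - {0} \<subseteq> W"
proof -
  have hf: "holo_germ f" "f 0 = 0"
    using f holo_germ_irreducible_at_0 by (auto simp: holo_germ_irreducible_def)
  have e2: "e / 2 > 0" using e by simp
  obtain R \<delta> \<rho> where bc: "branched_cover f R \<delta> \<rho>" and small: "\<delta> < e / 2" "\<rho> < e / 2"
    using exists_branched_cover[OF hf reg e2] .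
  interpret branched_cover f R \<delta> \<rho> by (rule bc)
  let ?W = "{(z, w). z \<in> punctured \<and> w \<in> roots z}"
  have "?W \<noteq> {}"
    using punctured(2,4) roots_nonempty[of "of_real (\<delta> / 2)"] by blast
  moreover have "?W \<subseteq> {p. f p = 0} \<inter> ball 0 e - {0}"
  proof
    fix p assume "p \<in> ?W"
    then obtain z w where p: "p = (z, w)" "z \<in> punctured" "w \<in> roots z" by blast
    then have "norm p < e"
      using norm_Pair_le[of z w] small by (simp add: roots_def)
    moreover have "p \<noteq> 0" using p by (simp add: zero_prod_def)
    ultimately show "p \<in> {p. f p = 0} \<inter> ball 0 e - {0}"
      using p(1,3) by (simp add: roots_def)
  qed
  moreover have W: "(z, w) \<in> ?W" if "f (z, w) = 0" "norm (z, w) < min \<delta> \<rho>" "(z, w) \<noteq> 0" for z w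
  proof -
    have "norm z < \<delta>" "norm w < \<rho>"
      using that(2) norm_fst_le[of z w] norm_snd_le[of w z] by linarith+
    \<comment> \<open>Over z = 0 the only root is w = 0, so puncturing the base removes just the
      origin from the curve.\<close>
    moreover have "z \<noteq> 0"
      using that centre[of w] \<open>norm w < \<rho>\<close> by (auto simp: zero_prod_def)
    ultimately show ?thesis using that(1) by (simp add: roots_def)
  qed
  moreover have "{p. f p = 0} \<inter> ball 0 (min \<delta> \<rho>) - {0} \<subseteq> ?W"
  proof
    fix p assume "p \<in> {p. f p = 0} \<inter> ball 0 (min \<delta> \<rho>) - {0}"
    then show "p \<in> ?W" using W[of "fst p" "snd p"] by simp
  qed
  moreover have "min \<delta> \<rho> > 0" using pos by simp
  ultimately show ?thesis
    using connected_punctured_zeros[OF f]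
    by (intro exI[of _ ?W] exI[of _ "min \<delta> \<rho>"]) (intro conjI)
qed

lemma zeros_dichotomy_regular:
  assumes f: "holo_germ_irreducible f" and reg: "regular_in_w f" and g: "holo_germ g"
  shows "(\<forall>\<^sub>F p in nhds 0. f p = 0 \<longrightarrow> g p = 0) \<or> (\<forall>\<^sub>F p in nhds 0. f p = 0 \<and> g p = 0 \<longrightarrow> p = 0)"
proof -
  have hf: "holo_germ f" "f 0 = 0"
    using f holo_germ_irreducible_at_0 by (auto simp: holo_germ_irreducible_def)
  obtain r where r: "r > 0" and g: "continuous_on (ball 0 r \<times> ball 0 r) g"
    "\<And>w. w \<in> ball 0 r \<Longrightarrow> (\<lambda>z. g (z, w)) holomorphic_on ball 0 r"
    "\<And>z. z \<in> ball 0 r \<Longrightarrow> (\<lambda>w. g (z, w)) holomorphic_on ball 0 r"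
    using holo_germ_separately_holomorphic[OF g] by metis
  obtain R \<delta> \<rho> where bc: "branched_cover f R \<delta> \<rho>" and small: "\<delta> < r" "\<rho> < r"
    using exists_branched_cover[OF hf reg r] .
  interpret branched_cover f R \<delta> \<rho> by (rule bc)
  have sub: "ball (0::complex) \<delta> \<subseteq> ball 0 r" "ball (0::complex) \<rho> \<subseteq> ball 0 r" using small by auto
  have "admissible g"
    unfolding admissible_def
  proof (intro conjI ballI)
    show "continuous_on (ball 0 \<delta> \<times> ball 0 \<rho>) g"
      by (rule continuous_on_subset[OF g(1)]) (use sub in auto)
    show "(\<lambda>z. g (z, w)) holomorphic_on ball 0 \<delta>" if "w \<in> ball 0 \<rho>" for w
      using g(2) that sub holomorphic_on_subset by blast
    show "(\<lambda>w. g (z, w)) holomorphic_on ball 0 \<rho>" if "z \<in> ball 0 \<delta>" for z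
      using g(3) that sub holomorphic_on_subset by blast
  qed
  then obtain d where d: "0 < d" "d \<le> \<delta>" "(\<forall>z\<in>ball 0 d - {0}. \<forall>w\<in>roots z. g (z, w) \<noteq> 0) \<or>
     (\<forall>z\<in>ball 0 d - {0}. \<forall>w\<in>roots z. g (z, w) = 0)"
    using zeros_dichotomy[OF f] by blast
  have "\<forall>\<^sub>F p in nhds 0. p \<in> ball 0 d \<times> ball 0 \<rho>"
    using pos d by (intro eventually_nhds_in_open open_Times) (auto simp: zero_prod_def)
  then have ev: "\<forall>\<^sub>F p in nhds 0. f p = 0 \<longrightarrow> p = 0 \<or> fst p \<in> ball 0 d - {0} \<and> snd p \<in> roots (fst p)"
  proof eventually_elim
    case (elim p)
    then show ?case
      using centre[of "snd p"] by (cases p) (auto simp: roots_def zero_prod_def)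
  qed
  from d(3) show ?thesis
  proof
    assume *: "\<forall>z\<in>ball 0 d - {0}. \<forall>w\<in>roots z. g (z, w) \<noteq> 0"
    have "\<forall>\<^sub>F p in nhds 0. f p = 0 \<and> g p = 0 \<longrightarrow> p = 0"
      using ev by eventually_elim (use * in force)
    then show ?thesis ..
  next
    assume *: "\<forall>z\<in>ball 0 d - {0}. \<forall>w\<in>roots z. g (z, w) = 0"
    show ?thesis
    \<comment> \<open>The cover only controls g away from the origin. If g is nonzero at the origin
      it has no zeros nearby, and the second alternative holds.\<close>
    proof (cases "g 0 = 0")
      case True
      have "\<forall>\<^sub>F p in nhds 0. f p = 0 \<longrightarrow> g p = 0"
        using ev by eventually_elim (use * True in force)
      then show ?thesis ..
    next
      case False
      have c: "isCont g 0"
        using g(1) r by (auto simp: continuous_on_eq_continuous_at open_Times zero_prod_def)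
      then obtain s where "s > 0" "\<And>p. dist 0 p < s \<Longrightarrow> g p \<noteq> 0"
        using continuous_at_avoid[of 0 g 0] False by blast
      then have "\<forall>\<^sub>F p in nhds 0. g p \<noteq> 0"
        unfolding eventually_nhds_metric by (auto simp: dist_commute)
      then have "\<forall>\<^sub>F p in nhds 0. f p = 0 \<and> g p = 0 \<longrightarrow> p = 0"
        by eventually_elim auto
      then show ?thesis ..
    qed
  qed
qed

section \<open>Linear changes of coordinates\<close>

definition lin :: "complex \<Rightarrow> complex \<Rightarrow> complex \<Rightarrow> complex \<Rightarrow> complex \<times> complex \<Rightarrow> complex \<times> complex" where
  "lin a b c d = (\<lambda>(z, w). (a * z + b * w, c * z + d * w))"

lemma lin_0 [simp]: "lin a b c d 0 = 0"
  by (simp add: lin_def zero_prod_def)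

lemma has_derivative_lin: "(lin a b c d has_derivative lin a b c d) (at p within S)"
  unfolding lin_def case_prod_beta by (auto intro!: derivative_eq_intros)

lemma continuous_on_lin: "continuous_on S (lin a b c d)"
  unfolding lin_def case_prod_beta by (intro continuous_intros)

lemma eventually_nhds_lin:
  assumes "\<forall>\<^sub>F p in nhds 0. P p" shows "\<forall>\<^sub>F p in nhds 0. P (lin a b c d p)"
proof (rule eventually_compose_filterlim[OF assms])
  have "isCont (lin a b c d) 0"
    using continuous_on_lin continuous_on_eq_continuous_at[OF open_UNIV] by blast
  then show "filterlim (lin a b c d) (nhds 0) (nhds 0)"
    using tendsto_at_iff_tendsto_nhds[of "lin a b c d" 0] by (simp add: isCont_def)
qed

lemma lin_inverse:
  assumes "a * d - b * c \<noteq> 0"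
  shows "lin a b c d (lin (d / (a * d - b * c)) (- b / (a * d - b * c)) (- c / (a * d - b * c)) (a / (a * d - b * c)) p) = p"
    and "lin (d / (a * d - b * c)) (- b / (a * d - b * c)) (- c / (a * d - b * c)) (a / (a * d - b * c)) (lin a b c d p) = p"
  using assms by (cases p; simp add: lin_def divide_simps; simp add: algebra_simps)+

lemma holo_germ_lin: assumes "holo_germ f" shows "holo_germ (\<lambda>p. f (lin a b c d p))"
proof -
  have "\<forall>\<^sub>F p in nhds 0. \<exists>A B. (f has_derivative (\<lambda>(u, v). A * u + B * v)) (at (lin a b c d p))"
    using eventually_nhds_lin[OF assms[unfolded holo_germ_def]] .
  then show ?thesis
    unfolding holo_germ_def
  proof eventually_elim
    case (elim p)
    then obtain A B where "(f has_derivative (\<lambda>(u, v). A * u + B * v)) (at (lin a b c d p))" by blast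
    then have "((\<lambda>p. f (lin a b c d p)) has_derivative
        (\<lambda>h. (\<lambda>(u, v). A * u + B * v) (lin a b c d h))) (at p)"
      by (rule has_derivative_compose[OF has_derivative_lin])
    also have "(\<lambda>h. (\<lambda>(u, v). A * u + B * v) (lin a b c d h)) =
        (\<lambda>(u, v). (A * a + B * c) * u + (A * b + B * d) * v)"
      by (auto simp: lin_def fun_eq_iff algebra_simps)
    finally show ?case by blast
  qed
qed

lemma holo_germ_unit_lin: "holo_germ_unit f \<Longrightarrow> holo_germ_unit (\<lambda>p. f (lin a b c d p))"
  unfolding holo_germ_unit_def using holo_germ_lin eventually_nhds_lin by blast

lemma holo_germ_irreducible_lin:
  assumes f: "holo_germ_irreducible f" and det: "a * d - b * c \<noteq> 0"
  shows "holo_germ_irreducible (\<lambda>p. f (lin a b c d p))"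
proof -
  define L where "L = lin a b c d"
  define M where "M = lin (d / (a * d - b * c)) (- b / (a * d - b * c)) (- c / (a * d - b * c)) (a / (a * d - b * c))"
  have LM: "L (M p) = p" "M (L p) = p" for p
    unfolding L_def M_def by (rule lin_inverse[OF det])+
  have ev: "\<forall>\<^sub>F p in nhds 0. P (M p)" if "\<forall>\<^sub>F p in nhds 0. P p" for P
    unfolding M_def by (rule eventually_nhds_lin[OF that])
  have hM: "holo_germ (\<lambda>p. g (M p))" if "holo_germ g" for g
    unfolding M_def by (rule holo_germ_lin[OF that])
  have uL: "holo_germ_unit (\<lambda>p. g (L p))" if "holo_germ_unit g" for g
    unfolding L_def by (rule holo_germ_unit_lin[OF that])
  have uM: "holo_germ_unit (\<lambda>p. g (M p))" if "holo_germ_unit g" for g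
    unfolding M_def by (rule holo_germ_unit_lin[OF that])
  have "holo_germ_irreducible (\<lambda>p. f (L p))"
    unfolding holo_germ_irreducible_def
  proof (intro conjI allI impI)
    show "holo_germ (\<lambda>p. f (L p))"
      using f unfolding L_def holo_germ_irreducible_def by (intro holo_germ_lin) auto
    show "\<not> (\<forall>\<^sub>F p in nhds 0. f (L p) = 0)"
      using ev[of "\<lambda>p. f (L p) = 0"] f by (auto simp: LM holo_germ_irreducible_def)
    show "\<not> holo_germ_unit (\<lambda>p. f (L p))"
      using uM[of "\<lambda>p. f (L p)"] f by (auto simp: LM holo_germ_irreducible_def)
    fix g h assume gh: "holo_germ g" "holo_germ h" "\<forall>\<^sub>F p in nhds 0. f (L p) = g p * h p"
    have "\<forall>\<^sub>F p in nhds 0. f p = g (M p) * h (M p)"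
      using ev[OF gh(3)] by (simp add: LM)
    then have "holo_germ_unit (\<lambda>p. g (M p)) \<or> holo_germ_unit (\<lambda>p. h (M p))"
      using f hM[OF gh(1)] hM[OF gh(2)] unfolding holo_germ_irreducible_def by blast
    then show "holo_germ_unit g \<or> holo_germ_unit h"
      using uL[of "\<lambda>p. g (M p)"] uL[of "\<lambda>p. h (M p)"] by (auto simp: LM)
  qed
  then show ?thesis by (simp add: L_def)
qed

text \<open>A nonzero germ is nonzero on some line through the origin; the coordinate change sends
  the w-axis to such a line.\<close>

lemma exists_regular_lin:
  assumes f: "holo_germ f" and nz: "\<not> (\<forall>\<^sub>F p in nhds 0. f p = 0)"
  obtains a b c d where "a * d - b * c \<noteq> 0" "regular_in_w (\<lambda>p. f (lin a b c d p))"
proof -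
  obtain r where r: "r > 0"
    "\<And>p. p \<in> ball 0 r \<Longrightarrow> \<exists>a b. (f has_derivative (\<lambda>(u, v). a * u + b * v)) (at p)"
    using holo_germ_obtain_ball[OF f] by metis
  \<comment> \<open>The direction must be a nonzero vector: if f vanished at all of these points,
    continuity would give f 0 = 0 too. The bound r / 2 lets t range over the disc of radius 2, which
    contains the point t = 1 needed for the identity theorem.\<close>
  have "\<exists>p. p \<noteq> 0 \<and> norm p < r / 2 \<and> f p \<noteq> 0"
  proof (rule ccontr)
    assume no: "\<not> ?thesis"
    have *: "f p = 0" if "p \<noteq> 0" "dist p 0 < r / 2" for p
      using that no by (metis dist_0_norm dist_commute)
    have "f 0 = 0"
    proof (rule ccontr)
      assume "f 0 \<noteq> 0"
      moreover have "isCont f 0" using r(2)[of 0] r(1) has_derivative_continuous by force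
      ultimately obtain s where s: "s > 0" "\<And>p. dist 0 p < s \<Longrightarrow> f p \<noteq> 0"
        using continuous_at_avoid[of 0 f 0] by blast
      let ?p = "(of_real (min s r / 4), 0) :: complex \<times> complex"
      have m: "min s r > 0" "min s r \<le> s" "min s r \<le> r" using s(1) r(1) by simp_all
      have "norm ?p = min s r / 4" using m by (simp add: norm_Pair)
      then have "norm ?p < s" "norm ?p < r / 2" "norm ?p \<noteq> 0" using m by linarith+
      then show False using *[of ?p] s(2)[of ?p] by (metis dist_0_norm dist_commute norm_zero)
    qed
    then have "\<forall>\<^sub>F p in nhds 0. f p = 0"
      unfolding eventually_nhds_metric using * r(1) by (metis half_gt_zero)
    then show False using nz by simp
  qed
  then obtain b d where bd: "(b, d) \<noteq> 0" "norm (b, d) < r / 2" "f (b, d) \<noteq> 0"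
    by (metis prod.collapse)
  define h where "h t = f (b * t, d * t)" for t
  have hol: "h holomorphic_on ball 0 2"
    unfolding holomorphic_on_open[OF open_ball]
  proof
    fix t :: complex assume t: "t \<in> ball 0 2"
    have "norm (b * t, d * t) = norm t * norm (b, d)"
      unfolding norm_Pair norm_mult power_mult_distrib distrib_right[symmetric]
      by (simp add: real_sqrt_mult)
    also have "\<dots> < 2 * (r / 2)" using t bd(2) r(1) by (intro mult_strict_mono) auto
    finally obtain A B where AB: "(f has_derivative (\<lambda>(u, v). A * u + B * v)) (at (b * t, d * t))"
      using r(2)[of "(b * t, d * t)"] by auto
    have "(h has_derivative (\<lambda>u. (\<lambda>(u, v). A * u + B * v) (b * u, d * u))) (at t)"
      unfolding h_def
      by (rule has_derivative_compose[of "\<lambda>u. (b * u, d * u)" "\<lambda>u. (b * u, d * u)" t UNIV f, OF _ AB])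
         (auto intro!: derivative_eq_intros)
    also have "(\<lambda>u. (\<lambda>(u, v). A * u + B * v) (b * u, d * u)) = (*) (A * b + B * d)"
      by (auto simp: fun_eq_iff algebra_simps)
    finally show "\<exists>h'. (h has_field_derivative h') (at t)"
      unfolding has_field_derivative_def by blast
  qed
  have "\<forall>\<^sub>F t in at 0. h t \<noteq> 0 \<and> t \<in> ball 0 2"
    by (rule non_zero_neighbour_alt[OF hol open_ball connected_ball, of 0 1])
       (use bd in \<open>auto simp: h_def\<close>)
  then have h: "\<forall>\<^sub>F t in at 0. h t \<noteq> 0" by eventually_elim simp
  \<comment> \<open>The vector (b, d) is completed by its Hermitian-orthogonal vector (-cnj d, cnj
    b), which makes the determinant minus the squared norm of (b, d).\<close>
  have reg: "regular_in_w (\<lambda>p. f (lin (- cnj d) b (cnj b) d p))"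
    unfolding regular_in_w_def
  proof
    assume "\<forall>\<^sub>F w in nhds 0. f (lin (- cnj d) b (cnj b) d (0, w)) = 0"
    then have "\<forall>\<^sub>F w in at 0. h w = 0"
      by (simp add: lin_def h_def eventually_at_filter eventually_mono)
    with h have "\<forall>\<^sub>F t in at (0::complex). False" by eventually_elim simp
    then show False by simp
  qed
  have "- cnj d * d - b * cnj b = - of_real ((norm b)\<^sup>2 + (norm d)\<^sup>2)"
    unfolding of_real_add complex_norm_square by (simp add: mult.commute)
  moreover have "(norm b)\<^sup>2 + (norm d)\<^sup>2 \<noteq> 0"
    using bd(1) by (auto simp: zero_prod_def sum_power2_eq_zero_iff)
  ultimately have "- cnj d * d - b * cnj b \<noteq> 0"
    by (metis neg_equal_0_iff_equal of_real_eq_0_iff)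
  then show thesis using reg by (rule that)
qed

text \<open>A linear map does not preserve round balls, but the sandwich between two punctured balls
  survives it with adjusted radii.\<close>

lemma connected_zeros:
  assumes f: "holo_germ_irreducible f" and e: "e > 0"
  shows "\<exists>W d. d > 0 \<and> connected W \<and> W \<noteq> {} \<and> W \<subseteq> {p. f p = 0} \<inter> ball 0 e - {0} \<and>
    {p. f p = 0} \<inter> ball 0 d - {0} \<subseteq> W"
proof -
  have "holo_germ f" "\<not> (\<forall>\<^sub>F p in nhds 0. f p = 0)"
    using f by (auto simp: holo_germ_irreducible_def)
  then obtain a b c d where det: "a * d - b * c \<noteq> 0"
    and reg: "regular_in_w (\<lambda>p. f (lin a b c d p))"
    by (rule exists_regular_lin)
  define L where "L = lin a b c d"
  define M where "M = lin (d / (a * d - b * c)) (- b / (a * d - b * c)) (- c / (a * d - b * c)) (a / (a * d - b * c))"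
  have LM: "L (M p) = p" "M (L p) = p" for p
    unfolding L_def M_def by (rule lin_inverse[OF det])+
  have LM0: "L 0 = 0" "M 0 = 0" by (simp_all add: L_def M_def)
  have "\<forall>\<^sub>F p in nhds 0. L p \<in> ball 0 e"
    unfolding L_def by (rule eventually_nhds_lin, rule eventually_nhds_in_open) (use e in auto)
  then obtain e' where e': "e' > 0" "\<And>p. p \<in> ball 0 e' \<Longrightarrow> L p \<in> ball 0 e"
    unfolding eventually_nhds_metric by (auto simp: dist_commute)
  obtain W r where W: "r > 0" "connected W" "W \<noteq> {}" "W \<subseteq> {p. f (L p) = 0} \<inter> ball 0 e' - {0}"
    "{p. f (L p) = 0} \<inter> ball 0 r - {0} \<subseteq> W"
    using connected_zeros_regular[OF holo_germ_irreducible_lin[OF f det] reg e'(1)]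
    unfolding L_def by blast
  have "\<forall>\<^sub>F p in nhds 0. M p \<in> ball 0 r"
    unfolding M_def by (rule eventually_nhds_lin, rule eventually_nhds_in_open) (use W in auto)
  then obtain s where s: "s > 0" "\<And>p. p \<in> ball 0 s \<Longrightarrow> M p \<in> ball 0 r"
    unfolding eventually_nhds_metric by (auto simp: dist_commute)
  have "connected (L ` W)"
    by (rule connected_continuous_image[OF _ W(2)]) (simp add: L_def continuous_on_lin)
  moreover have "L ` W \<subseteq> {p. f p = 0} \<inter> ball 0 e - {0}"
  proof
    fix q assume "q \<in> L ` W"
    then obtain p where p: "p \<in> W" "q = L p" by blast
    then have "p \<in> {p. f (L p) = 0}" "p \<in> ball 0 e'" "p \<noteq> 0" using W(4) by blast+
    then have "f q = 0" "q \<in> ball 0 e" "p \<noteq> 0" using p e'(2) by auto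
    moreover have "q \<noteq> 0" using LM(2)[of p] LM0 p \<open>p \<noteq> 0\<close> by auto
    ultimately show "q \<in> {p. f p = 0} \<inter> ball 0 e - {0}" by simp
  qed
  moreover have "{p. f p = 0} \<inter> ball 0 s - {0} \<subseteq> L ` W"
  proof
    fix p assume p: "p \<in> {p. f p = 0} \<inter> ball 0 s - {0}"
    then have "M p \<in> ball 0 r" using s by blast
    moreover have "M p \<noteq> 0" using LM(1)[of p] LM0 p by auto
    ultimately have "M p \<in> W" using W(5) p LM(1)[of p] by auto
    then show "p \<in> L ` W" using LM(1)[of p] by (metis imageI)
  qed
  moreover have "L ` W \<noteq> {}" using W(3) by simp
  ultimately show ?thesis using s(1) by (intro exI[of _ "L ` W"] exI[of _ s]) (intro conjI)
qed

lemma zeros_dichotomy: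
  assumes f: "holo_germ_irreducible f" and g: "holo_germ g"
  shows "(\<forall>\<^sub>F p in nhds 0. f p = 0 \<longrightarrow> g p = 0) \<or> (\<forall>\<^sub>F p in nhds 0. f p = 0 \<and> g p = 0 \<longrightarrow> p = 0)"
proof -
  have "holo_germ f" "\<not> (\<forall>\<^sub>F p in nhds 0. f p = 0)"
    using f by (auto simp: holo_germ_irreducible_def)
  then obtain a b c d where det: "a * d - b * c \<noteq> 0"
    and reg: "regular_in_w (\<lambda>p. f (lin a b c d p))"
    by (rule exists_regular_lin)
  define L where "L = lin a b c d"
  define M where "M = lin (d / (a * d - b * c)) (- b / (a * d - b * c)) (- c / (a * d - b * c)) (a / (a * d - b * c))"
  have LM: "L (M p) = p" for p
    unfolding L_def M_def by (rule lin_inverse[OF det])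
  have ev: "\<forall>\<^sub>F p in nhds 0. P (M p)" if "\<forall>\<^sub>F p in nhds 0. P p" for P
    unfolding M_def by (rule eventually_nhds_lin[OF that])
  have M0: "p = 0" if "M p = 0" for p
    using LM[of p] that by (simp add: L_def)
  have "(\<forall>\<^sub>F p in nhds 0. f (L p) = 0 \<longrightarrow> g (L p) = 0) \<or>
      (\<forall>\<^sub>F p in nhds 0. f (L p) = 0 \<and> g (L p) = 0 \<longrightarrow> p = 0)"
    using zeros_dichotomy_regular[OF holo_germ_irreducible_lin[OF f det] reg holo_germ_lin[OF g]]
    unfolding L_def .
  then show ?thesis
  proof
    assume "\<forall>\<^sub>F p in nhds 0. f (L p) = 0 \<longrightarrow> g (L p) = 0"
    from ev[OF this] show ?thesis by (simp add: LM)
  next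
    assume "\<forall>\<^sub>F p in nhds 0. f (L p) = 0 \<and> g (L p) = 0 \<longrightarrow> p = 0"
    from ev[OF this] have "\<forall>\<^sub>F p in nhds 0. f p = 0 \<and> g p = 0 \<longrightarrow> p = 0"
      by eventually_elim (use M0 in \<open>auto simp: LM\<close>)
    then show ?thesis ..
  qed
qed

subsection \<open>Contact\<close>

text \<open>Serves the case in which a homeomorphism exchanges the two branches.\<close>

lemma contact_fun_commute:
  fixes X Y :: "'a::real_normed_vector set"
  shows "contact_fun X Y r = contact_fun Y X r"
proof -
  let ?S = "\<lambda>X Y. {norm (x - y) |x y. x \<in> X \<and> y \<in> Y \<and> r \<le> norm x \<and> r \<le> norm y}"
  have "?S X Y \<subseteq> ?S Y X" for X Y :: "'a set"
  proof
    fix v assume "v \<in> ?S X Y"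
    then obtain x y where "v = norm (x - y)" and xy: "x \<in> X" "y \<in> Y" "r \<le> norm x" "r \<le> norm y"
      by blast
    then have "v = norm (y - x)" by (simp add: norm_minus_commute)
    with xy show "v \<in> ?S Y X" by blast
  qed
  then have "?S X Y = ?S Y X" by (intro equalityI) auto
  then show ?thesis by (simp add: contact_fun_def)
qed

text \<open>Only the parts inside the closed ball of radius \<epsilon>0 are controlled; there they
  are compact by the Heine-Borel property. Accumulation at 0 keeps the set of distances in
  \<open>contact_fun\<close> nonempty for small r.\<close>

locale germ_pair =
  fixes X Y :: "'a::{real_normed_vector, heine_borel} set" and \<epsilon>0 :: real
  assumes \<epsilon>0: "0 < \<epsilon>0"
    and closed: "closed (X \<inter> cball 0 \<epsilon>0)" "closed (Y \<inter> cball 0 \<epsilon>0)"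
    and disjoint: "X \<inter> Y \<inter> cball 0 \<epsilon>0 \<subseteq> {0}"
    and accum: "0 islimpt X" "0 islimpt Y"
begin

definition gap :: "real \<Rightarrow> real \<Rightarrow> real" where
  "gap \<epsilon> r = contact_fun (X \<inter> cball 0 \<epsilon>) (Y \<inter> cball 0 \<epsilon>) r"

lemma small_points:
  assumes "0 < e"
  obtains x y where "x \<in> X" "y \<in> Y" "x \<noteq> 0" "y \<noteq> 0" "norm x < e" "norm y < e"
proof -
  obtain x y where "x \<in> X" "x \<noteq> 0" "dist x 0 < e" "y \<in> Y" "y \<noteq> 0" "dist y 0 < e"
    using accum assms unfolding islimpt_approachable by blast
  then show thesis by (intro that[of x y]) auto
qed

lemma gap_le:
  assumes "x \<in> X" "y \<in> Y" "norm x \<le> \<epsilon>" "norm y \<le> \<epsilon>" "r \<le> norm x" "r \<le> norm y"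
  shows "gap \<epsilon> r \<le> norm (x - y)"
  unfolding gap_def contact_fun_def
  by (rule cInf_lower) (use assms in \<open>auto intro!: bdd_belowI[of _ 0]\<close>)

lemma gap_ge:
  assumes "0 < \<epsilon>"
    and "\<And>x y. x \<in> X \<Longrightarrow> y \<in> Y \<Longrightarrow> norm x \<le> \<epsilon> \<Longrightarrow> norm y \<le> \<epsilon> \<Longrightarrow>
      r \<le> norm x \<Longrightarrow> r \<le> norm y \<Longrightarrow> B \<le> norm (x - y)"
    and "\<exists>x\<in>X. \<exists>y\<in>Y. norm x \<le> \<epsilon> \<and> norm y \<le> \<epsilon> \<and> r \<le> norm x \<and> r \<le> norm y"
  shows "B \<le> gap \<epsilon> r"
  unfolding gap_def contact_fun_def
  by (rule cInf_greatest) (use assms in auto)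

lemma witness:
  assumes "0 < \<epsilon>"
  shows "\<exists>r0>0. \<forall>r\<le>r0. \<exists>x\<in>X. \<exists>y\<in>Y. norm x \<le> \<epsilon> \<and> norm y \<le> \<epsilon> \<and> r \<le> norm x \<and> r \<le> norm y"
proof -
  obtain x y where "x \<in> X" "y \<in> Y" "x \<noteq> 0" "y \<noteq> 0" "norm x < \<epsilon>" "norm y < \<epsilon>"
    using small_points[OF assms] .
  then have "0 < min (norm x) (norm y)"
    "\<forall>r\<le>min (norm x) (norm y). norm x \<le> \<epsilon> \<and> norm y \<le> \<epsilon> \<and> r \<le> norm x \<and> r \<le> norm y"
    by auto
  with \<open>x \<in> X\<close> \<open>y \<in> Y\<close> show ?thesis by blast
qed

text \<open>Away from 0 one set is compact and disjoint from the other, hence at positive distance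
  from it. It suffices that one of the two points is far from 0, which allows for pairs with only
  one point outside a smaller ball.\<close>

lemma separated:
  assumes "0 < s"
  shows "\<exists>B>0. \<forall>x\<in>X \<inter> cball 0 \<epsilon>0. \<forall>y\<in>Y \<inter> cball 0 \<epsilon>0. s \<le> norm x \<or> s \<le> norm y \<longrightarrow> B \<le> norm (x - y)"
proof -
  have comp: "compact (X \<inter> cball 0 \<epsilon>0)" "compact (Y \<inter> cball 0 \<epsilon>0)"
    using closed by (auto simp: compact_eq_bounded_closed bounded_Int)
  have far: "closed {x::'a. s \<le> norm x}" by (intro closed_Collect_le continuous_intros)
  have sep: "\<exists>B>0. \<forall>x\<in>S \<inter> {x. s \<le> norm x}. \<forall>y\<in>T. B \<le> dist x y"
    if "compact S" "compact T" "S \<inter> T \<subseteq> {0}" for S T :: "'a set"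
  proof (rule separate_compact_closed)
    show "compact (S \<inter> {x. s \<le> norm x})" using that far by (intro compact_Int_closed)
    show "closed T" using that by (simp add: compact_imp_closed)
    show "S \<inter> {x. s \<le> norm x} \<inter> T = {}" using that assms by auto
  qed
  have "X \<inter> cball 0 \<epsilon>0 \<inter> (Y \<inter> cball 0 \<epsilon>0) \<subseteq> {0}" "Y \<inter> cball 0 \<epsilon>0 \<inter> (X \<inter> cball 0 \<epsilon>0) \<subseteq> {0}"
    using disjoint by auto
  note dis = this
  obtain B1 where B1: "B1 > 0"
    "\<forall>x\<in>X \<inter> cball 0 \<epsilon>0 \<inter> {x. s \<le> norm x}. \<forall>y\<in>Y \<inter> cball 0 \<epsilon>0. B1 \<le> dist x y"
    using sep[OF comp dis(1)] by blast
  obtain B2 where B2: "B2 > 0"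
    "\<forall>x\<in>Y \<inter> cball 0 \<epsilon>0 \<inter> {x. s \<le> norm x}. \<forall>y\<in>X \<inter> cball 0 \<epsilon>0. B2 \<le> dist x y"
    using sep[OF comp(2,1) dis(2)] by blast
  have "min B1 B2 \<le> norm (x - y)"
    if "x \<in> X \<inter> cball 0 \<epsilon>0" "y \<in> Y \<inter> cball 0 \<epsilon>0" "s \<le> norm x \<or> s \<le> norm y" for x y
    using that(3)
  proof
    assume "s \<le> norm x"
    then have "B1 \<le> dist x y" using B1(2) that by blast
    then show ?thesis by (simp add: dist_norm)
  next
    assume "s \<le> norm y"
    then have "B2 \<le> dist y x" using B2(2) that by blast
    then show ?thesis by (simp add: dist_norm norm_minus_commute)
  qed
  then show ?thesis using B1(1) B2(1) by (intro exI[of _ "min B1 B2"]) auto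
qed

lemma gap_pos:
  assumes "0 < \<epsilon>" "\<epsilon> \<le> \<epsilon>0"
  shows "\<exists>r0>0. \<forall>r. 0 < r \<longrightarrow> r \<le> r0 \<longrightarrow> 0 < gap \<epsilon> r"
proof -
  obtain r0 where r0: "r0 > 0"
    "\<And>r. r \<le> r0 \<Longrightarrow> \<exists>x\<in>X. \<exists>y\<in>Y. norm x \<le> \<epsilon> \<and> norm y \<le> \<epsilon> \<and> r \<le> norm x \<and> r \<le> norm y"
    using witness[OF assms(1)] by blast
  have "0 < gap \<epsilon> r" if r: "0 < r" "r \<le> r0" for r
  proof -
    obtain B where B: "B > 0"
      "\<forall>x\<in>X \<inter> cball 0 \<epsilon>0. \<forall>y\<in>Y \<inter> cball 0 \<epsilon>0. r \<le> norm x \<or> r \<le> norm y \<longrightarrow> B \<le> norm (x - y)"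
      using separated[OF r(1)] by blast
    have "B \<le> gap \<epsilon> r"
    proof (rule gap_ge[OF assms(1) _ r0(2)[OF r(2)]])
      fix x y assume xy: "x \<in> X" "y \<in> Y" "norm x \<le> \<epsilon>" "norm y \<le> \<epsilon>" "r \<le> norm x" "r \<le> norm y"
      then have "x \<in> X \<inter> cball 0 \<epsilon>0" "y \<in> Y \<inter> cball 0 \<epsilon>0" using assms by auto
      then show "B \<le> norm (x - y)" using B(2) xy(5) by blast
    qed
    then show ?thesis using B(1) by simp
  qed
  then show ?thesis using r0(1) by blast
qed

text \<open>Pairs with a point outside the smaller ball have distance at least B, whereas a fixed
  pair close to 0 already has distance at most B. For small r the extra pairs therefore leave the
  infimum unchanged.\<close>

lemma gap_radius:
  assumes "0 < \<epsilon>" "\<epsilon> \<le> \<epsilon>'" "\<epsilon>' \<le> \<epsilon>0"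
  shows "\<forall>\<^sub>F r in at_right 0. gap \<epsilon> r = gap \<epsilon>' r"
proof -
  obtain B where B: "B > 0"
    "\<forall>x\<in>X \<inter> cball 0 \<epsilon>0. \<forall>y\<in>Y \<inter> cball 0 \<epsilon>0. \<epsilon> \<le> norm x \<or> \<epsilon> \<le> norm y \<longrightarrow> B \<le> norm (x - y)"
    using separated[OF assms(1)] by blast
  \<comment> \<open>With both norms below B / 2 the triangle inequality gives distance at most B,
    and with norms below \<epsilon> the pair competes in both infima.\<close>
  define e where "e = min \<epsilon> (B / 2)"
  have "e > 0" using B assms by (simp add: e_def)
  then obtain a b where ab: "a \<in> X" "b \<in> Y" "a \<noteq> 0" "b \<noteq> 0" "norm a < e" "norm b < e"
    by (rule small_points)
  have "gap \<epsilon> r = gap \<epsilon>' r" if r: "0 < r" "r < min (norm a) (norm b)" for r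
  proof (rule antisym)
    have w: "a \<in> X" "b \<in> Y" "norm a \<le> \<epsilon>" "norm b \<le> \<epsilon>" "r \<le> norm a" "r \<le> norm b"
      using ab r by (auto simp: e_def)
    then have w': "norm a \<le> \<epsilon>'" "norm b \<le> \<epsilon>'" using assms by auto
    have "norm (a - b) \<le> norm a + norm b" by (rule norm_triangle_ineq4)
    then have kB: "gap \<epsilon> r \<le> B" using gap_le[OF w] ab by (simp add: e_def)
    show "gap \<epsilon> r \<le> gap \<epsilon>' r"
    proof (rule gap_ge)
      show "\<exists>x\<in>X. \<exists>y\<in>Y. norm x \<le> \<epsilon>' \<and> norm y \<le> \<epsilon>' \<and> r \<le> norm x \<and> r \<le> norm y"
        using w w' by blast
    next
      fix x y assume xy: "x \<in> X" "y \<in> Y" "norm x \<le> \<epsilon>'" "norm y \<le> \<epsilon>'" "r \<le> norm x" "r \<le> norm y"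
      show "gap \<epsilon> r \<le> norm (x - y)"
      proof (cases "norm x \<le> \<epsilon> \<and> norm y \<le> \<epsilon>")
        case True
        then show ?thesis using gap_le xy by blast
      next
        case False
        then have "\<epsilon> \<le> norm x \<or> \<epsilon> \<le> norm y" by auto
        moreover have "x \<in> X \<inter> cball 0 \<epsilon>0" "y \<in> Y \<inter> cball 0 \<epsilon>0" using xy assms by auto
        ultimately have "B \<le> norm (x - y)" using B(2) by blast
        then show ?thesis using kB by simp
      qed
    qed (use assms in simp)
    show "gap \<epsilon>' r \<le> gap \<epsilon> r"
    proof (rule gap_ge)
      show "\<exists>x\<in>X. \<exists>y\<in>Y. norm x \<le> \<epsilon> \<and> norm y \<le> \<epsilon> \<and> r \<le> norm x \<and> r \<le> norm y"
        using w by blast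
      show "gap \<epsilon>' r \<le> norm (x - y)"
        if "x \<in> X" "y \<in> Y" "norm x \<le> \<epsilon>" "norm y \<le> \<epsilon>" "r \<le> norm x" "r \<le> norm y" for x y
        by (rule gap_le) (use that assms in simp_all)
    qed (use assms in simp)
  qed
  then show ?thesis
    unfolding eventually_at_right_field
    using ab by (intro exI[of _ "min (norm a) (norm b)"]) auto
qed

definition contact_limit :: "real \<Rightarrow> bool" where
  "contact_limit l \<longleftrightarrow> (\<forall>\<^sub>F \<epsilon> in at_right 0.
     ((\<lambda>r. ln (contact_fun (X \<inter> cball 0 \<epsilon>) (Y \<inter> cball 0 \<epsilon>) r) / ln r) \<longlongrightarrow> l) (at_right 0))"

text \<open>By \<open>gap_radius\<close> the log ratio near r = 0 does not depend on the radius, so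
  the outer quantifier over \<epsilon> collapses.\<close>

lemma contact_limit_iff: "contact_limit l \<longleftrightarrow> ((\<lambda>r. ln (gap \<epsilon>0 r) / ln r) \<longlongrightarrow> l) (at_right 0)"
proof -
  have eq: "((\<lambda>r. ln (gap \<epsilon> r) / ln r) \<longlongrightarrow> l) (at_right 0) \<longleftrightarrow>
      ((\<lambda>r. ln (gap \<epsilon>0 r) / ln r) \<longlongrightarrow> l) (at_right 0)" if "0 < \<epsilon>" "\<epsilon> < \<epsilon>0" for \<epsilon>
  proof (rule tendsto_cong)
    show "\<forall>\<^sub>F r in at_right 0. ln (gap \<epsilon> r) / ln r = ln (gap \<epsilon>0 r) / ln r"
      using gap_radius[of \<epsilon> \<epsilon>0] that by (auto elim: eventually_mono)
  qed
  have ev: "\<forall>\<^sub>F \<epsilon> in at_right 0. 0 < \<epsilon> \<and> \<epsilon> < \<epsilon>0"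
    using \<epsilon>0 unfolding eventually_at_right_field by blast
  have "(\<forall>\<^sub>F \<epsilon> in at_right 0. ((\<lambda>r. ln (gap \<epsilon> r) / ln r) \<longlongrightarrow> l) (at_right 0)) \<longleftrightarrow>
    (\<forall>\<^sub>F \<epsilon> in at_right (0::real). ((\<lambda>r. ln (gap \<epsilon>0 r) / ln r) \<longlongrightarrow> l) (at_right 0))"
  proof (rule eventually_subst)
    show "\<forall>\<^sub>F \<epsilon> in at_right 0. ((\<lambda>r. ln (gap \<epsilon> r) / ln r) \<longlongrightarrow> l) (at_right 0) \<longleftrightarrow>
      ((\<lambda>r. ln (gap \<epsilon>0 r) / ln r) \<longlongrightarrow> l) (at_right 0)"
      using ev by eventually_elim (rule eq; simp)
  qed
  then show ?thesis by (simp add: contact_limit_def gap_def)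
qed

lemma contact_eq: "contact X Y = (THE l. contact_limit l)"
  by (simp add: contact_def contact_limit_def)

end

section \<open>Distortion of the contact function\<close>

text \<open>The map sends pairs outside radius r to pairs outside radius
  \<open>(r / c) powr (1 / \<alpha>)\<close>, by the lower bound on \<open>norm (f p)\<close>, and
  raises distances to the power \<alpha> at worst. So image pairs compete in the infimum for X' and
  Y'.\<close>

lemma contact_inequality:
  fixes X Y X' Y' :: "'a::{real_normed_vector, heine_borel} set"
  assumes P: "germ_pair X Y e" and P': "germ_pair X' Y' e'"
    and pos: "0 < \<alpha>" "0 < c" "0 < d"
    and f: "f ` (X \<inter> cball 0 d) \<subseteq> X' \<inter> cball 0 e'" "f ` (Y \<inter> cball 0 d) \<subseteq> Y' \<inter> cball 0 e'"
    and lip: "\<And>p q. p \<in> X \<union> Y \<Longrightarrow> q \<in> X \<union> Y \<Longrightarrow> norm p \<le> d \<Longrightarrow> norm q \<le> d \<Longrightarrow>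
      norm (f p - f q) \<le> c * norm (p - q) powr \<alpha>"
    and low: "\<And>p. p \<in> X \<union> Y \<Longrightarrow> norm p \<le> d \<Longrightarrow> norm p \<le> c * norm (f p) powr \<alpha>"
  shows "\<forall>\<^sub>F r in at_right 0. germ_pair.gap X' Y' e' ((r / c) powr (1 / \<alpha>)) \<le> c * germ_pair.gap X Y e r powr \<alpha>"
proof -
  interpret P: germ_pair X Y e by (rule P)
  interpret P': germ_pair X' Y' e' by (rule P')
  define d1 where "d1 = min d e"
  have d1: "0 < d1" "d1 \<le> d" "d1 \<le> e" using pos P.\<epsilon>0 by (auto simp: d1_def)
  obtain r0 where r0: "r0 > 0"
    "\<And>r. r \<le> r0 \<Longrightarrow> \<exists>x\<in>X. \<exists>y\<in>Y. norm x \<le> d1 \<and> norm y \<le> d1 \<and> r \<le> norm x \<and> r \<le> norm y"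
    using P.witness[OF d1(1)] by blast
  have "\<forall>\<^sub>F r in at_right 0. P.gap d1 r = P.gap e r"
    by (rule P.gap_radius) (use d1 in auto)
  moreover have "\<forall>\<^sub>F r in at_right 0. 0 < r \<and> r < r0"
    unfolding eventually_at_right_field using r0(1) by blast
  ultimately show ?thesis
  proof eventually_elim
    case (elim r)
    define s where "s = (r / c) powr (1 / \<alpha>)"
    \<comment> \<open>The sign of the gap at s has not been established here; a negative value makes
      the bound trivial, and otherwise both sides may be raised to powers.\<close>
    show ?case
    proof (cases "P'.gap e' s < 0")
      case True
      have "0 \<le> c * P.gap e r powr \<alpha>" using pos by simp
      with True show ?thesis by (simp add: s_def)
    next
      case False
      have "(P'.gap e' s / c) powr (1 / \<alpha>) \<le> P.gap d1 r"
      proof (rule P.gap_ge[OF d1(1)])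
        show "\<exists>x\<in>X. \<exists>y\<in>Y. norm x \<le> d1 \<and> norm y \<le> d1 \<and> r \<le> norm x \<and> r \<le> norm y"
          by (rule r0(2)) (use elim in simp)
      next
        fix x y assume xy: "x \<in> X" "y \<in> Y" "norm x \<le> d1" "norm y \<le> d1" "r \<le> norm x" "r \<le> norm y"
        have nd: "norm x \<le> d" "norm y \<le> d" using xy d1 by auto
        have far: "s \<le> norm (f p)" if "p \<in> X \<union> Y" "norm p \<le> d" "r \<le> norm p" for p
        proof -
          have "r \<le> c * norm (f p) powr \<alpha>" using low[OF that(1,2)] that(3) by simp
          then have "r / c \<le> norm (f p) powr \<alpha>" using pos by (simp add: field_simps)
          then have "s \<le> (norm (f p) powr \<alpha>) powr (1 / \<alpha>)"
            unfolding s_def using pos elim by (intro powr_mono2) auto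
          also have "\<dots> = norm (f p)" using pos by (simp add: powr_powr)
          finally show ?thesis .
        qed
        have "x \<in> X \<inter> cball 0 d" "y \<in> Y \<inter> cball 0 d" using xy nd by auto
        then have "f x \<in> X' \<inter> cball 0 e'" "f y \<in> Y' \<inter> cball 0 e'" using f by blast+
        then have fx: "f x \<in> X'" "f y \<in> Y'" "norm (f x) \<le> e'" "norm (f y) \<le> e'" by auto
        have "P'.gap e' s \<le> norm (f x - f y)"
          by (rule P'.gap_le[OF fx]) (use far xy nd in auto)
        also have "\<dots> \<le> c * norm (x - y) powr \<alpha>" using lip xy nd by simp
        finally have "P'.gap e' s / c \<le> norm (x - y) powr \<alpha>" using pos by (simp add: field_simps)
        then have "(P'.gap e' s / c) powr (1 / \<alpha>) \<le> (norm (x - y) powr \<alpha>) powr (1 / \<alpha>)"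
          using False pos by (intro powr_mono2) auto
        also have "\<dots> = norm (x - y)" using pos by (simp add: powr_powr)
        finally show "(P'.gap e' s / c) powr (1 / \<alpha>) \<le> norm (x - y)" .
      qed
      then have "((P'.gap e' s / c) powr (1 / \<alpha>)) powr \<alpha> \<le> P.gap d1 r powr \<alpha>"
        using pos by (intro powr_mono2) auto
      then have "P'.gap e' s / c \<le> P.gap d1 r powr \<alpha>"
        using False pos by (simp add: powr_powr)
      then show ?thesis using pos elim by (simp add: s_def field_simps)
    qed
  qed
qed

lemma filterlim_scaled_powr:
  assumes "0 < c" "0 < (\<alpha>::real)"
  shows "filterlim (\<lambda>s. c * s powr \<alpha>) (at_right 0) (at_right 0)"
  unfolding filterlim_at
proof
  have pos: "\<forall>\<^sub>F s in at_right (0::real). 0 < s"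
    by (simp add: eventually_at_right_less)
  then show "\<forall>\<^sub>F s in at_right 0. c * s powr \<alpha> \<in> {0<..} \<and> c * s powr \<alpha> \<noteq> 0"
    by eventually_elim (use assms in simp)
  have "((\<lambda>s. s powr \<alpha>) \<longlongrightarrow> 0) (at_right 0)"
    using assms pos by (intro tendsto_zero_powrI[of _ _ _ \<alpha>] tendsto_intros) (auto elim: eventually_mono)
  then show "((\<lambda>s. c * s powr \<alpha>) \<longlongrightarrow> 0) (at_right 0)"
    using tendsto_mult_right_zero by blast
qed

text \<open>Logarithms of radii below 1 are negative, so an upper bound on k' yields a lower bound
  on its log ratio, and conversely. One factor \<alpha> comes from the power on the values, the
  other from the change of radius.\<close>

lemma log_ratio_transfer:
  fixes k k' :: "real \<Rightarrow> real"
  assumes pos: "\<forall>\<^sub>F r in at_right 0. 0 < k r" "\<forall>\<^sub>F r in at_right 0. 0 < k' r"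
    and upper: "\<And>\<alpha>. 0 < \<alpha> \<Longrightarrow> \<alpha> < 1 \<Longrightarrow>
      \<exists>c>0. \<forall>\<^sub>F r in at_right 0. k' ((r / c) powr (1 / \<alpha>)) \<le> c * k r powr \<alpha>"
    and lower: "\<And>\<alpha>. 0 < \<alpha> \<Longrightarrow> \<alpha> < 1 \<Longrightarrow>
      \<exists>c>0. \<forall>\<^sub>F r in at_right 0. k ((r / c) powr (1 / \<alpha>)) \<le> c * k' r powr \<alpha>"
    and lim: "((\<lambda>r. ln (k r) / ln r) \<longlongrightarrow> l) (at_right 0)"
  shows "((\<lambda>r. ln (k' r) / ln r) \<longlongrightarrow> l) (at_right 0)"
proof -
  have ln0: "((\<lambda>r. K / ln r) \<longlongrightarrow> 0) (at_right 0)" for K :: real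
    by (rule tendsto_divide_0[OF tendsto_const filterlim_at_bot_imp_at_infinity[OF ln_at_0]])
  have small: "\<forall>\<^sub>F r in at_right (0::real). 0 < r \<and> r < 1"
    unfolding eventually_at_right_field by (intro exI[of _ 1]) auto
  show ?thesis
  proof (rule order_tendstoI)
    fix a assume a: "a < l"
    \<comment> \<open>Continuity at \<alpha> = 1 picks an exponent for which the distorted limit
      still exceeds a, whatever the sign of l.\<close>
    have "((\<lambda>\<alpha>::real. \<alpha>\<^sup>2 * l) \<longlongrightarrow> 1\<^sup>2 * l) (at_left 1)" by (intro tendsto_intros)
    then have "\<forall>\<^sub>F \<alpha> in at_left 1. a < \<alpha>\<^sup>2 * l" using a by (simp add: order_tendstoD)
    moreover have "\<forall>\<^sub>F \<alpha> in at_left (1::real). 0 < \<alpha> \<and> \<alpha> < 1"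
      unfolding eventually_at_left_field by (intro exI[of _ 0]) auto
    ultimately have "\<forall>\<^sub>F \<alpha> in at_left 1. a < \<alpha>\<^sup>2 * l \<and> 0 < \<alpha> \<and> \<alpha> < 1" by eventually_elim auto
    then obtain \<alpha> where \<alpha>: "a < \<alpha>\<^sup>2 * l" "0 < \<alpha>" "\<alpha> < 1"
      using eventually_happens trivial_limit_at_left_real by blast
    obtain c where c: "c > 0" "\<forall>\<^sub>F r in at_right 0. k' ((r / c) powr (1 / \<alpha>)) \<le> c * k r powr \<alpha>"
      using upper[OF \<alpha>(2,3)] by blast
    \<comment> \<open>Inverse of the radius change: \<open>(u s / c) powr (1 / \<alpha>)\<close> is
      s, so the bound is read at k' s, and \<open>ln (u s) / ln s\<close> tends to \<alpha>.\<close>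
    define u where "u = (\<lambda>s. c * s powr \<alpha>)"
    have fu: "filterlim u (at_right 0) (at_right 0)"
      unfolding u_def by (rule filterlim_scaled_powr[OF c(1) \<alpha>(2)])
    have lu: "((\<lambda>s. ln (k (u s)) / ln (u s)) \<longlongrightarrow> l) (at_right 0)"
      by (rule filterlim_compose[OF lim fu])
    have "((\<lambda>s. ln c / ln s + \<alpha> * ((ln (k (u s)) / ln (u s)) * (ln c / ln s + \<alpha>))) \<longlongrightarrow>
        0 + \<alpha> * (l * (0 + \<alpha>))) (at_right 0)"
      by (intro tendsto_intros ln0 lu)
    then have "\<forall>\<^sub>F s in at_right 0. a < ln c / ln s + \<alpha> * ((ln (k (u s)) / ln (u s)) * (ln c / ln s + \<alpha>))"
      using \<alpha>(1) by (intro order_tendstoD(1)) (auto simp: power2_eq_square mult_ac)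
    moreover have "\<forall>\<^sub>F s in at_right 0. k' ((u s / c) powr (1 / \<alpha>)) \<le> c * k (u s) powr \<alpha>"
      by (rule eventually_compose_filterlim[OF c(2) fu])
    moreover have "\<forall>\<^sub>F s in at_right 0. 0 < k (u s)"
      by (rule eventually_compose_filterlim[OF pos(1) fu])
    moreover have "\<forall>\<^sub>F s in at_right 0. 0 < u s \<and> u s < 1"
      by (rule eventually_compose_filterlim[OF small fu])
    ultimately show "\<forall>\<^sub>F s in at_right 0. a < ln (k' s) / ln s"
      using pos(2) small
    proof eventually_elim
      case (elim s)
      have "(u s / c) powr (1 / \<alpha>) = s"
        using c(1) \<alpha>(2) elim by (simp add: u_def powr_powr)
      then have "ln (k' s) \<le> ln (c * k (u s) powr \<alpha>)"
        using elim by (intro ln_mono) auto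
      also have "\<dots> = ln c + \<alpha> * ln (k (u s))"
        using elim c(1) by (simp add: ln_mult ln_powr)
      finally have "(ln c + \<alpha> * ln (k (u s))) / ln s \<le> ln (k' s) / ln s"
        using elim by (intro divide_right_mono_neg) auto
      moreover have "ln (u s) \<noteq> 0" "ln s \<noteq> 0" using elim by auto
      moreover have "ln c / ln s + \<alpha> = ln (u s) / ln s"
        using elim c(1) by (simp add: u_def ln_mult ln_powr add_divide_distrib)
      ultimately show ?case
        using elim(1) by (simp add: add_divide_distrib)
    qed
  next
    fix a assume a: "l < a"
    have "((\<lambda>\<alpha>::real. l / \<alpha>\<^sup>2) \<longlongrightarrow> l / 1\<^sup>2) (at_left 1)" by (intro tendsto_intros) auto
    then have "\<forall>\<^sub>F \<alpha> in at_left 1. l / \<alpha>\<^sup>2 < a" using a by (simp add: order_tendstoD)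
    moreover have "\<forall>\<^sub>F \<alpha> in at_left (1::real). 0 < \<alpha> \<and> \<alpha> < 1"
      unfolding eventually_at_left_field by (intro exI[of _ 0]) auto
    ultimately have "\<forall>\<^sub>F \<alpha> in at_left 1. l / \<alpha>\<^sup>2 < a \<and> 0 < \<alpha> \<and> \<alpha> < 1" by eventually_elim auto
    then obtain \<alpha> where \<alpha>: "l / \<alpha>\<^sup>2 < a" "0 < \<alpha>" "\<alpha> < 1"
      using eventually_happens trivial_limit_at_left_real by blast
    obtain c where c: "c > 0" "\<forall>\<^sub>F r in at_right 0. k ((r / c) powr (1 / \<alpha>)) \<le> c * k' r powr \<alpha>"
      using lower[OF \<alpha>(2,3)] by blast
    \<comment> \<open>Here the changed radius sits inside k, where the limit is known along any
      radius tending to 0 from the right; \<open>ln (v r) / ln r\<close> tends to 1 /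
      \<alpha>.\<close>
    define v where "v = (\<lambda>r. (r / c) powr (1 / \<alpha>))"
    have fv: "filterlim v (at_right 0) (at_right 0)"
    proof -
      have "filterlim (\<lambda>r. (1 / c) powr (1 / \<alpha>) * r powr (1 / \<alpha>)) (at_right 0) (at_right 0)"
        using c(1) \<alpha>(2) by (intro filterlim_scaled_powr) auto
      moreover have ev: "\<forall>\<^sub>F r in at_right 0. (1 / c) powr (1 / \<alpha>) * r powr (1 / \<alpha>) = v r"
        using small by eventually_elim (use c(1) in \<open>simp add: v_def flip: powr_mult\<close>)
      ultimately show ?thesis by (simp only: filterlim_cong[OF refl refl ev])
    qed
    have lv: "((\<lambda>r. ln (k (v r)) / ln (v r)) \<longlongrightarrow> l) (at_right 0)"
      by (rule filterlim_compose[OF lim fv])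
    have "((\<lambda>r. ((ln (k (v r)) / ln (v r)) * ((1 - ln c / ln r) / \<alpha>) - ln c / ln r) / \<alpha>) \<longlongrightarrow>
        (l * ((1 - 0) / \<alpha>) - 0) / \<alpha>) (at_right 0)"
      using \<alpha>(2) by (intro tendsto_intros ln0 lv) auto
    then have "\<forall>\<^sub>F r in at_right 0. ((ln (k (v r)) / ln (v r)) * ((1 - ln c / ln r) / \<alpha>) - ln c / ln r) / \<alpha> < a"
      using \<alpha>(1) by (intro order_tendstoD(2)) (auto simp: power2_eq_square)
    moreover have "\<forall>\<^sub>F r in at_right 0. 0 < k (v r)"
      by (rule eventually_compose_filterlim[OF pos(1) fv])
    moreover have "\<forall>\<^sub>F r in at_right 0. 0 < v r \<and> v r < 1"
      by (rule eventually_compose_filterlim[OF small fv])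
    ultimately show "\<forall>\<^sub>F r in at_right 0. ln (k' r) / ln r < a"
      using pos(2) small c(2)
    proof eventually_elim
      case (elim r)
      have "ln (k (v r)) \<le> ln (c * k' r powr \<alpha>)"
        using elim c(1) by (intro ln_mono) (auto simp: v_def)
      also have "\<dots> = ln c + \<alpha> * ln (k' r)"
        using elim c(1) by (simp add: ln_mult ln_powr)
      finally have "(ln (k (v r)) - ln c) / \<alpha> \<le> ln (k' r)"
        using \<alpha>(2) by (simp add: field_simps)
      then have "ln (k' r) / ln r \<le> (ln (k (v r)) - ln c) / \<alpha> / ln r"
        using elim by (intro divide_right_mono_neg) auto
      also have "\<dots> = (ln (k (v r)) / ln r - ln c / ln r) / \<alpha>"
        by (simp add: diff_divide_distrib mult.commute)
      also have "ln (k (v r)) / ln r = (ln (k (v r)) / ln (v r)) * (ln (v r) / ln r)"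
        using elim by simp
      also have "ln (v r) / ln r = (1 - ln c / ln r) / \<alpha>"
        using elim c(1) \<alpha>(2) by (simp add: v_def ln_powr ln_div field_simps)
      finally show ?case using elim(1) by linarith
    qed
  qed
qed

subsection \<open>Hoelder homeomorphisms of pairs of germs\<close>

text \<open>Connectedness of the punctured germ, independent of the shape of neighbourhoods: the
  connected set W lies between two punctured balls. Nonemptiness of W makes 0 a limit point.\<close>

definition connected_germ :: "'a::real_normed_vector set \<Rightarrow> bool" where
  "connected_germ X \<longleftrightarrow> 0 \<in> X \<and> (\<forall>e>0. \<exists>W d. d > 0 \<and> connected W \<and> W \<noteq> {} \<and>
     W \<subseteq> X \<inter> ball 0 e - {0} \<and> X \<inter> ball 0 d - {0} \<subseteq> W)"

lemma connected_germ_islimpt: assumes "connected_germ X" shows "0 islimpt X"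
  unfolding islimpt_approachable
proof (intro allI impI)
  fix e :: real assume "e > 0"
  then obtain W where "W \<noteq> {}" "W \<subseteq> X \<inter> ball 0 e - {0}"
    using assms unfolding connected_germ_def by meson
  then obtain x where "x \<in> X \<inter> ball 0 e - {0}" by blast
  then show "\<exists>x'\<in>X. x' \<noteq> 0 \<and> dist x' 0 < e" by (auto simp: dist_commute)
qed

lemma holder_homeomorphic_germs_sym:
  assumes "holder_homeomorphic_germs \<alpha> X x0 Y y0" "x0 \<in> X"
  shows "holder_homeomorphic_germs \<alpha> Y y0 X x0"
proof -
  obtain U V f g where h: "open U" "x0 \<in> U" "open V" "y0 \<in> V" "homeomorphism (X \<inter> U) (Y \<inter> V) f g"
    "f x0 = y0" "holder_on \<alpha> (X \<inter> U) f" "holder_on \<alpha> (Y \<inter> V) g"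
    using assms(1) unfolding holder_homeomorphic_germs_def by blast
  have "g y0 = x0" using h(2,5,6) assms(2) by (auto simp: homeomorphism_def)
  then show ?thesis
    unfolding holder_homeomorphic_germs_def
    using h homeomorphism_symD[OF h(5)]
    by (intro exI[of _ V] exI[of _ U] exI[of _ g] exI[of _ f]) (intro conjI)
qed

text \<open>By injectivity the image of a punctured branch avoids 0. There the two target sets are
  disjoint and closed, so a connected image lies in one of them. Surjectivity near 0 prevents both
  images from lying in the same set.\<close>

lemma holder_germ_map_splits:
  fixes X Y X' Y' :: "'a::{real_normed_vector, heine_borel} set"
  assumes P': "germ_pair X' Y' e'"
    and conn: "connected_germ X" "connected_germ Y" and zero: "0 \<in> X'" "0 \<in> Y'"
    and holder: "holder_homeomorphic_germs \<alpha> (X \<union> Y) 0 (X' \<union> Y') 0"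
  obtains f c d where "0 < c" "0 < d" "0 < \<alpha>"
    "\<And>p q. p \<in> X \<union> Y \<Longrightarrow> q \<in> X \<union> Y \<Longrightarrow> norm p \<le> d \<Longrightarrow> norm q \<le> d \<Longrightarrow>
      norm (f p - f q) \<le> c * norm (p - q) powr \<alpha>"
    "\<And>p. p \<in> X \<union> Y \<Longrightarrow> norm p \<le> d \<Longrightarrow> norm p \<le> c * norm (f p) powr \<alpha>"
    "f ` (X \<inter> cball 0 d) \<subseteq> X' \<inter> cball 0 e' \<and> f ` (Y \<inter> cball 0 d) \<subseteq> Y' \<inter> cball 0 e' \<or>
     f ` (X \<inter> cball 0 d) \<subseteq> Y' \<inter> cball 0 e' \<and> f ` (Y \<inter> cball 0 d) \<subseteq> X' \<inter> cball 0 e'"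
proof -
  interpret P': germ_pair X' Y' e' by (rule P')
  have zX: "0 \<in> X" using conn by (simp add: connected_germ_def)
  obtain U V f g where UV: "open U" "0 \<in> U" "open V" "0 \<in> V"
    and hom: "homeomorphism ((X \<union> Y) \<inter> U) ((X' \<union> Y') \<inter> V) f g" and f0: "f 0 = 0"
    and hf: "holder_on \<alpha> ((X \<union> Y) \<inter> U) f" and hg: "holder_on \<alpha> ((X' \<union> Y') \<inter> V) g"
    using holder unfolding holder_homeomorphic_germs_def by blast
  have gf: "g (f p) = p" if "p \<in> (X \<union> Y) \<inter> U" for p
    using hom that by (simp add: homeomorphism_def)
  have fg: "f (g q) = q" if "q \<in> (X' \<union> Y') \<inter> V" for q
    using hom that by (simp add: homeomorphism_def)
  have fim: "f p \<in> (X' \<union> Y') \<inter> V" if "p \<in> (X \<union> Y) \<inter> U" for p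
    using hom that by (auto simp: homeomorphism_def)
  have gim: "g q \<in> (X \<union> Y) \<inter> U" if "q \<in> (X' \<union> Y') \<inter> V" for q
    using hom that by (auto simp: homeomorphism_def)
  have cf: "continuous_on ((X \<union> Y) \<inter> U) f" and cg: "continuous_on ((X' \<union> Y') \<inter> V) g"
    using hom by (auto simp: homeomorphism_def)
  have g0: "g 0 = 0" using gf[of 0] f0 zX UV by simp
  obtain c1 where c1: "\<alpha> > 0" "c1 > 0"
    "\<And>p q. p \<in> (X \<union> Y) \<inter> U \<Longrightarrow> q \<in> (X \<union> Y) \<inter> U \<Longrightarrow> norm (f p - f q) \<le> c1 * norm (p - q) powr \<alpha>"
    using hf unfolding holder_on_def by blast
  obtain c2 where c2: "c2 > 0"
    "\<And>p q. p \<in> (X' \<union> Y') \<inter> V \<Longrightarrow> q \<in> (X' \<union> Y') \<inter> V \<Longrightarrow> norm (g p - g q) \<le> c2 * norm (p - q) powr \<alpha>"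
    using hg unfolding holder_on_def by blast
  obtain u where u: "u > 0" "ball 0 u \<subseteq> U" using UV open_contains_ball by blast
  obtain v where v: "v > 0" "ball 0 v \<subseteq> V" using UV open_contains_ball by blast
  have "0 \<in> (X \<union> Y) \<inter> U" using zX UV by simp
  then obtain d0 where d0: "d0 > 0" "\<And>p. p \<in> (X \<union> Y) \<inter> U \<Longrightarrow> norm p < d0 \<Longrightarrow> norm (f p) < e'"
    using cf P'.\<epsilon>0 f0 unfolding continuous_on_iff by (metis dist_0_norm dist_commute)
  define \<delta> where "\<delta> = min d0 u"
  have \<delta>: "\<delta> > 0" using d0 u by (simp add: \<delta>_def)
  have in_ball: "p \<in> (X \<union> Y) \<inter> U \<and> norm (f p) < e'" if "p \<in> X \<union> Y" "norm p < \<delta>" for p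
    using that u(2) d0(2)[of p] by (auto simp: \<delta>_def)
  obtain W1 d1 where W1: "d1 > 0" "connected W1" "W1 \<subseteq> X \<inter> ball 0 \<delta> - {0}" "X \<inter> ball 0 d1 - {0} \<subseteq> W1"
    using conn(1) \<delta> unfolding connected_germ_def by meson
  obtain W2 d2 where W2: "d2 > 0" "connected W2" "W2 \<subseteq> Y \<inter> ball 0 \<delta> - {0}" "Y \<inter> ball 0 d2 - {0} \<subseteq> W2"
    using conn(2) \<delta> unfolding connected_germ_def by meson
  have side: "f ` W \<subseteq> X' \<or> f ` W \<subseteq> Y'" and bounded: "f ` W \<subseteq> cball 0 e'"
    if W: "connected W" "W \<subseteq> (X \<union> Y) \<inter> ball 0 \<delta> - {0}" for W
  proof -
    have WU: "p \<in> (X \<union> Y) \<inter> U \<and> norm (f p) < e'" if "p \<in> W" for p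
      using in_ball[of p] W that by auto
    then show "f ` W \<subseteq> cball 0 e'" by force
    have "f p \<in> X' \<inter> cball 0 e' \<union> Y' \<inter> cball 0 e'" if "p \<in> W" for p
      using fim[of p] WU[OF that] by auto
    then have cov: "f ` W \<subseteq> X' \<inter> cball 0 e' \<union> Y' \<inter> cball 0 e'" by blast
    have "0 \<notin> f ` W"
    proof
      assume "0 \<in> f ` W"
      then obtain p where "p \<in> W" "f p = 0" by auto
      then have "p = 0" using gf[of p] WU g0 by simp
      then show False using \<open>p \<in> W\<close> W by blast
    qed
    have dis: "X' \<inter> cball 0 e' \<inter> (Y' \<inter> cball 0 e') \<inter> f ` W = {}"
    proof (rule equals0I)
      fix x assume "x \<in> X' \<inter> cball 0 e' \<inter> (Y' \<inter> cball 0 e') \<inter> f ` W"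
      then have "x \<in> X' \<inter> Y' \<inter> cball 0 e'" "x \<in> f ` W" by blast+
      then have "x = 0" using P'.disjoint by blast
      then show False using \<open>x \<in> f ` W\<close> \<open>0 \<notin> f ` W\<close> by simp
    qed
    have "connected (f ` W)"
      by (rule connected_continuous_image[OF continuous_on_subset[OF cf] W(1)]) (use WU in blast)
    from connected_closedD[OF this dis cov P'.closed]
    show "f ` W \<subseteq> X' \<or> f ` W \<subseteq> Y'" using cov by (elim disjE) blast+
  qed
  have W1': "W1 \<subseteq> (X \<union> Y) \<inter> ball 0 \<delta> - {0}" using W1(3) by blast
  have W2': "W2 \<subseteq> (X \<union> Y) \<inter> ball 0 \<delta> - {0}" using W2(3) by blast
  have "0 \<in> (X' \<union> Y') \<inter> V" using zero UV by simp
  moreover have m: "min d1 d2 > 0" using W1(1) W2(1) by simp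
  ultimately obtain \<eta> where "\<eta> > 0"
    "\<forall>q\<in>(X' \<union> Y') \<inter> V. dist q 0 < \<eta> \<longrightarrow> dist (g q) (g 0) < min d1 d2"
    using cg unfolding continuous_on_iff by blast
  then have \<eta>: "\<eta> > 0" "\<And>q. q \<in> (X' \<union> Y') \<inter> V \<Longrightarrow> norm q < \<eta> \<Longrightarrow> norm (g q) < min d1 d2"
    by (simp_all add: g0)
  \<comment> \<open>A nonzero point of T close to 0 has its preimage under f so close to 0 that it
    lies in W1 or W2, by continuity of g.\<close>
  have hit: "\<exists>p\<in>W1 \<union> W2. f p \<in> T \<inter> cball 0 e' - {0}" if T: "0 islimpt T" "T \<subseteq> X' \<union> Y'" for T
  proof -
    have "min \<eta> (min e' v) > 0" using \<eta> v P'.\<epsilon>0 by simp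
    then obtain q where q: "q \<in> T" "q \<noteq> 0" "dist q 0 < min \<eta> (min e' v)"
      using T(1) unfolding islimpt_approachable by blast
    then have qV: "q \<in> (X' \<union> Y') \<inter> V" using T v by auto
    then have "norm (g q) < min d1 d2" using \<eta>(2) q by simp
    moreover have "g q \<in> X \<union> Y" using gim[OF qV] by blast
    moreover have "g q \<noteq> 0" using fg[OF qV] f0 q(2) by auto
    ultimately have "g q \<in> W1 \<union> W2" using W1(4) W2(4) by auto
    then show ?thesis using fg[OF qV] q by (intro bexI[of _ "g q"]) auto
  qed
  have hX: "\<exists>p\<in>W1 \<union> W2. f p \<in> X' \<inter> cball 0 e' - {0}"
    by (rule hit[OF P'.accum(1)]) simp
  have hY: "\<exists>p\<in>W1 \<union> W2. f p \<in> Y' \<inter> cball 0 e' - {0}"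
    by (rule hit[OF P'.accum(2)]) simp
  have sides: "f ` W1 \<subseteq> X' \<and> f ` W2 \<subseteq> Y' \<or> f ` W1 \<subseteq> Y' \<and> f ` W2 \<subseteq> X'"
    using side[OF W1(2) W1'] side[OF W2(2) W2'] hX hY P'.disjoint by blast
  define d where "d = min d1 d2 / 2"
  have d: "d > 0" "d < d1" "d < d2" using W1(1) W2(1) by (auto simp: d_def)
  have inW: "f ` (X \<inter> cball 0 d) \<subseteq> T \<inter> cball 0 e'" if "f ` W1 \<subseteq> T" "0 \<in> T" for T
  proof
    fix q assume "q \<in> f ` (X \<inter> cball 0 d)"
    then obtain p where p: "p \<in> X" "norm p \<le> d" "q = f p" by auto
    show "q \<in> T \<inter> cball 0 e'"
    proof (cases "p = 0")
      case False
      then have "p \<in> W1" using W1(4) p d by auto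
      then show ?thesis using that bounded[OF W1(2) W1'] p by blast
    qed (use that f0 p P'.\<epsilon>0 in simp)
  qed
  have inW2: "f ` (Y \<inter> cball 0 d) \<subseteq> T \<inter> cball 0 e'" if "f ` W2 \<subseteq> T" "0 \<in> T" for T
  proof
    fix q assume "q \<in> f ` (Y \<inter> cball 0 d)"
    then obtain p where p: "p \<in> Y" "norm p \<le> d" "q = f p" by auto
    show "q \<in> T \<inter> cball 0 e'"
    proof (cases "p = 0")
      case False
      then have "p \<in> W2" using W2(4) p d by auto
      then show ?thesis using that bounded[OF W2(2) W2'] p by blast
    qed (use that f0 p P'.\<epsilon>0 in simp)
  qed
  have dU: "p \<in> (X \<union> Y) \<inter> U" if "p \<in> X \<union> Y" "norm p \<le> d" for p
  proof (cases "p = 0")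
    case False
    then have "p \<in> W1 \<union> W2" using that W1(4) W2(4) d by auto
    then have "norm p < \<delta>" using W1(3) W2(3) by auto
    then show ?thesis using in_ball that(1) by blast
  qed (use that UV in simp)
  show thesis
  \<comment> \<open>One constant serves both estimates: c1 bounds f, and c2 comes from applying the
    bound for g to f p and 0.\<close>
  proof (rule that[of "max c1 c2" d f])
    fix p q assume "p \<in> X \<union> Y" "q \<in> X \<union> Y" "norm p \<le> d" "norm q \<le> d"
    then have "norm (f p - f q) \<le> c1 * norm (p - q) powr \<alpha>" using dU c1(3) by blast
    also have "\<dots> \<le> max c1 c2 * norm (p - q) powr \<alpha>" by (intro mult_right_mono) auto
    finally show "norm (f p - f q) \<le> max c1 c2 * norm (p - q) powr \<alpha>" .
  next
    fix p assume p: "p \<in> X \<union> Y" "norm p \<le> d"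
    have "norm (g (f p) - g 0) \<le> c2 * norm (f p - 0) powr \<alpha>"
      using fim[OF dU[OF p]] c2(2) zero UV by blast
    then have "norm p \<le> c2 * norm (f p) powr \<alpha>" using gf[OF dU[OF p]] g0 by simp
    also have "\<dots> \<le> max c1 c2 * norm (f p) powr \<alpha>" by (intro mult_right_mono) auto
    finally show "norm p \<le> max c1 c2 * norm (f p) powr \<alpha>" .
  next
    show "f ` (X \<inter> cball 0 d) \<subseteq> X' \<inter> cball 0 e' \<and> f ` (Y \<inter> cball 0 d) \<subseteq> Y' \<inter> cball 0 e' \<or>
     f ` (X \<inter> cball 0 d) \<subseteq> Y' \<inter> cball 0 e' \<and> f ` (Y \<inter> cball 0 d) \<subseteq> X' \<inter> cball 0 e'"
      using sides
    proof
      assume "f ` W1 \<subseteq> X' \<and> f ` W2 \<subseteq> Y'"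
      then show ?thesis using inW[OF _ zero(1)] inW2[OF _ zero(2)] by simp
    next
      assume "f ` W1 \<subseteq> Y' \<and> f ` W2 \<subseteq> X'"
      then show ?thesis using inW[OF _ zero(2)] inW2[OF _ zero(1)] by simp
    qed
  qed (use c1 c2 d in auto)
qed

lemma germ_pair_swap: "germ_pair X Y e \<Longrightarrow> germ_pair Y X e"
  unfolding germ_pair_def by (auto simp: Int_commute)

text \<open>The conclusion does not mention the map, so by symmetry of the gap it is the same
  whether the branches are kept or exchanged.\<close>

lemma holder_contact_inequality:
  fixes X Y X' Y' :: "'a::{real_normed_vector, heine_borel} set"
  assumes P: "germ_pair X Y e" and P': "germ_pair X' Y' e'"
    and conn: "connected_germ X" "connected_germ Y" and zero: "0 \<in> X'" "0 \<in> Y'"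
    and holder: "holder_homeomorphic_germs \<alpha> (X \<union> Y) 0 (X' \<union> Y') 0"
  shows "\<exists>c>0. \<forall>\<^sub>F r in at_right 0.
    germ_pair.gap X' Y' e' ((r / c) powr (1 / \<alpha>)) \<le> c * germ_pair.gap X Y e r powr \<alpha>"
proof -
  obtain f c d where f: "0 < c" "0 < d" "0 < \<alpha>"
    "\<And>p q. p \<in> X \<union> Y \<Longrightarrow> q \<in> X \<union> Y \<Longrightarrow> norm p \<le> d \<Longrightarrow> norm q \<le> d \<Longrightarrow>
      norm (f p - f q) \<le> c * norm (p - q) powr \<alpha>"
    "\<And>p. p \<in> X \<union> Y \<Longrightarrow> norm p \<le> d \<Longrightarrow> norm p \<le> c * norm (f p) powr \<alpha>"
    and cases: "f ` (X \<inter> cball 0 d) \<subseteq> X' \<inter> cball 0 e' \<and> f ` (Y \<inter> cball 0 d) \<subseteq> Y' \<inter> cball 0 e' \<or>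
     f ` (X \<inter> cball 0 d) \<subseteq> Y' \<inter> cball 0 e' \<and> f ` (Y \<inter> cball 0 d) \<subseteq> X' \<inter> cball 0 e'"
    using holder_germ_map_splits[OF P' conn zero holder] by metis
  from cases show ?thesis
  proof
    assume "f ` (X \<inter> cball 0 d) \<subseteq> X' \<inter> cball 0 e' \<and> f ` (Y \<inter> cball 0 d) \<subseteq> Y' \<inter> cball 0 e'"
    then show ?thesis
      using contact_inequality[OF P P' f(3,1,2) _ _ f(4,5)] f(1) by blast
  next
    assume "f ` (X \<inter> cball 0 d) \<subseteq> Y' \<inter> cball 0 e' \<and> f ` (Y \<inter> cball 0 d) \<subseteq> X' \<inter> cball 0 e'"
    then have "\<forall>\<^sub>F r in at_right 0.
        germ_pair.gap Y' X' e' ((r / c) powr (1 / \<alpha>)) \<le> c * germ_pair.gap X Y e r powr \<alpha>"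
      using contact_inequality[OF P germ_pair_swap[OF P'] f(3,1,2) _ _ f(4,5)] by blast
    moreover have "germ_pair.gap Y' X' e' r = germ_pair.gap X' Y' e' r" for r
      using germ_pair.gap_def[OF P'] germ_pair.gap_def[OF germ_pair_swap[OF P']] contact_fun_commute
      by metis
    ultimately show ?thesis using f(1) by auto
  qed
qed

text \<open>Each \<alpha> may come with its own homeomorphism and its own matching of branches; only
  the resulting inequalities between gaps are combined. The inverse maps give the second family of
  inequalities.\<close>

lemma contact_limit_transfer:
  fixes X Y X' Y' :: "'a::{real_normed_vector, heine_borel} set"
  assumes P: "germ_pair X Y e" and P': "germ_pair X' Y' e'"
    and conn: "connected_germ X" "connected_germ Y" "connected_germ X'" "connected_germ Y'"
    and holder: "\<And>\<alpha>. 0 < \<alpha> \<Longrightarrow> \<alpha> < 1 \<Longrightarrow> holder_homeomorphic_germs \<alpha> (X \<union> Y) 0 (X' \<union> Y') 0"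
    and lim: "germ_pair.contact_limit X Y l"
  shows "germ_pair.contact_limit X' Y' l"
proof -
  interpret P: germ_pair X Y e by (rule P)
  interpret P': germ_pair X' Y' e' by (rule P')
  have z: "0 \<in> X" "0 \<in> Y" "0 \<in> X'" "0 \<in> Y'" using conn by (auto simp: connected_germ_def)
  have ev: "\<forall>\<^sub>F r in at_right 0. 0 < h r"
    if "\<exists>r0>0. \<forall>r. 0 < r \<longrightarrow> r \<le> r0 \<longrightarrow> 0 < h r" for h :: "real \<Rightarrow> real"
    using that unfolding eventually_at_right_field by (meson less_imp_le)
  have holder': "holder_homeomorphic_germs \<alpha> (X' \<union> Y') 0 (X \<union> Y) 0" if "0 < \<alpha>" "\<alpha> < 1" for \<alpha>
    using holder_homeomorphic_germs_sym[OF holder[OF that]] z by simp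
  have "((\<lambda>r. ln (P'.gap e' r) / ln r) \<longlongrightarrow> l) (at_right 0)"
  proof (rule log_ratio_transfer[of "P.gap e"])
    show "\<forall>\<^sub>F r in at_right 0. 0 < P.gap e r" by (rule ev, rule P.gap_pos) (use P.\<epsilon>0 in auto)
    show "\<forall>\<^sub>F r in at_right 0. 0 < P'.gap e' r" by (rule ev, rule P'.gap_pos) (use P'.\<epsilon>0 in auto)
    show "\<exists>c>0. \<forall>\<^sub>F r in at_right 0. P'.gap e' ((r / c) powr (1 / \<alpha>)) \<le> c * P.gap e r powr \<alpha>"
      if "0 < \<alpha>" "\<alpha> < 1" for \<alpha>
      by (rule holder_contact_inequality[OF P P' conn(1,2) z(3,4) holder[OF that]])
    show "\<exists>c>0. \<forall>\<^sub>F r in at_right 0. P.gap e ((r / c) powr (1 / \<alpha>)) \<le> c * P'.gap e' r powr \<alpha>"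
      if "0 < \<alpha>" "\<alpha> < 1" for \<alpha>
      by (rule holder_contact_inequality[OF P' P conn(3,4) z(1,2) holder'[OF that]])
    show "((\<lambda>r. ln (P.gap e r) / ln r) \<longlongrightarrow> l) (at_right 0)"
      using lim P.contact_limit_iff by blast
  qed
  then show ?thesis using P'.contact_limit_iff by blast
qed

section \<open>Pairs of plane branches\<close>

lemma plane_branch_connected_germ: assumes "plane_branch C" shows "connected_germ C"
proof -
  obtain f where f: "holo_germ_irreducible f" and C: "same_germ 0 C {z. f z = 0}"
    using assms unfolding plane_branch_def by blast
  obtain r where r: "r > 0" "\<And>p. p \<in> ball 0 r \<Longrightarrow> p \<in> C \<longleftrightarrow> f p = 0"
    using C unfolding same_germ_def eventually_nhds_metric by (auto simp: dist_commute)
  show ?thesis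
    unfolding connected_germ_def
  proof (intro conjI allI impI)
    show "0 \<in> C" using r(2)[of 0] r(1) holo_germ_irreducible_at_0[OF f] by simp
    fix e :: real assume "e > 0"
    then have "min e r > 0" using r by simp
    then obtain W d where W: "d > 0" "connected W" "W \<noteq> {}" "W \<subseteq> {p. f p = 0} \<inter> ball 0 (min e r) - {0}"
      "{p. f p = 0} \<inter> ball 0 d - {0} \<subseteq> W"
      using connected_zeros[OF f] by meson
    have "ball (0::complex \<times> complex) (min e r) = ball 0 e \<inter> ball 0 r"
      "ball (0::complex \<times> complex) (min d r) = ball 0 d \<inter> ball 0 r" by auto
    then have "W \<subseteq> C \<inter> ball 0 e - {0}" "C \<inter> ball 0 (min d r) - {0} \<subseteq> W"
      using W(4,5) r(2) by blast+
    moreover have "min d r > 0" using W(1) r(1) by simp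
    ultimately show "\<exists>W d. d > 0 \<and> connected W \<and> W \<noteq> {} \<and> W \<subseteq> C \<inter> ball 0 e - {0} \<and>
        C \<inter> ball 0 d - {0} \<subseteq> W"
      using W(2,3) by (intro exI[of _ W] exI[of _ "min d r"] conjI)
  qed
qed

lemma plane_branch_closed:
  assumes "plane_branch C"
  obtains e where "e > 0" "\<forall>e'\<le>e. closed (C \<inter> cball 0 e')"
proof -
  obtain f where f: "holo_germ_irreducible f" and C: "same_germ 0 C {z. f z = 0}"
    using assms unfolding plane_branch_def by blast
  obtain r where r: "r > 0" "\<And>p. p \<in> ball 0 r \<Longrightarrow> p \<in> C \<longleftrightarrow> f p = 0"
    using C unfolding same_germ_def eventually_nhds_metric by (auto simp: dist_commute)
  have "holo_germ f" using f by (simp add: holo_germ_irreducible_def)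
  then obtain s where s: "s > 0"
    "\<And>p. p \<in> ball 0 s \<Longrightarrow> \<exists>a b. (f has_derivative (\<lambda>(u, v). a * u + b * v)) (at p)"
    using holo_germ_obtain_ball by metis
  have "closed (C \<inter> cball 0 e')" if "e' \<le> min r s / 2" for e'
  proof -
    have small: "p \<in> ball 0 r \<and> p \<in> ball 0 s" if "p \<in> cball 0 e'" for p
      using that \<open>e' \<le> min r s / 2\<close> r(1) s(1) by auto
    have "continuous_on (cball 0 e') f"
    proof (intro continuous_at_imp_continuous_on ballI)
      fix p assume "p \<in> cball (0::complex \<times> complex) e'"
      then show "isCont f p" using small s(2) has_derivative_continuous by blast
    qed
    then have "closed {p \<in> cball 0 e'. f p = 0}"
      by (intro continuous_closed_preimage_constant) auto
    also have "{p \<in> cball 0 e'. f p = 0} = C \<inter> cball 0 e'"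
      using small r(2) by blast
    finally show ?thesis .
  qed
  moreover have "min r s / 2 > 0" using r s by simp
  ultimately show thesis using that by blast
qed

text \<open>The dichotomy is used in both directions: if neither yields an isolated intersection,
  each zero germ contains the other and the branches coincide.\<close>

lemma plane_branches_meet_at_0:
  assumes "plane_branch C1" "plane_branch C2" "\<not> same_germ 0 C1 C2"
  shows "\<forall>\<^sub>F p in nhds 0. p \<in> C1 \<inter> C2 \<longrightarrow> p = 0"
proof -
  obtain f1 where f1: "holo_germ_irreducible f1" and C1: "\<forall>\<^sub>F p in nhds 0. p \<in> C1 \<longleftrightarrow> f1 p = 0"
    using assms(1) unfolding plane_branch_def same_germ_def by auto
  obtain f2 where f2: "holo_germ_irreducible f2" and C2: "\<forall>\<^sub>F p in nhds 0. p \<in> C2 \<longleftrightarrow> f2 p = 0"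
    using assms(2) unfolding plane_branch_def same_germ_def by auto
  have h: "holo_germ f1" "holo_germ f2" using f1 f2 by (auto simp: holo_germ_irreducible_def)
  consider "\<forall>\<^sub>F p in nhds 0. f1 p = 0 \<and> f2 p = 0 \<longrightarrow> p = 0"
    | "\<forall>\<^sub>F p in nhds 0. f1 p = 0 \<longrightarrow> f2 p = 0" "\<forall>\<^sub>F p in nhds 0. f2 p = 0 \<longrightarrow> f1 p = 0"
    using zeros_dichotomy[OF f1 h(2)] zeros_dichotomy[OF f2 h(1)] by (auto simp: conj_commute)
  then show ?thesis
  proof cases
    case 1
    then show ?thesis using C1 C2 by eventually_elim auto
  next
    case 2
    then have "same_germ 0 C1 C2"
      unfolding same_germ_def using C1 C2 by eventually_elim auto
    then show ?thesis using assms(3) by simp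
  qed
qed

lemma plane_branches_germ_pair:
  assumes "plane_branch C1" "plane_branch C2" "\<not> same_germ 0 C1 C2"
  obtains e where "germ_pair C1 C2 e"
proof -
  obtain e1 where e1: "e1 > 0" "\<forall>e'\<le>e1. closed (C1 \<inter> cball 0 e')"
    using plane_branch_closed[OF assms(1)] .
  obtain e2 where e2: "e2 > 0" "\<forall>e'\<le>e2. closed (C2 \<inter> cball 0 e')"
    using plane_branch_closed[OF assms(2)] .
  obtain e3 where e3: "e3 > 0" "\<And>p. norm p < e3 \<Longrightarrow> p \<in> C1 \<inter> C2 \<longrightarrow> p = 0"
    using plane_branches_meet_at_0[OF assms] unfolding eventually_nhds_metric by auto
  define e where "e = min e1 (min e2 (e3 / 2))"
  have e: "e > 0" "e \<le> e1" "e \<le> e2" "e < e3" using e1 e2 e3 by (auto simp: e_def)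
  have "germ_pair C1 C2 e"
  proof
    show "C1 \<inter> C2 \<inter> cball 0 e \<subseteq> {0}"
    proof
      fix p assume "p \<in> C1 \<inter> C2 \<inter> cball 0 e"
      then have "norm p < e3" "p \<in> C1 \<inter> C2" using e(4) by auto
      then show "p \<in> {0}" using e3(2) by blast
    qed
  qed (use e e1 e2 assms in \<open>auto intro: connected_germ_islimpt plane_branch_connected_germ\<close>)
  then show thesis by (rule that)
qed

theorem theorem4p6:
  fixes C1 C2 D1 D2 :: "(complex \<times> complex) set"
  assumes "plane_branch C1" and "plane_branch C2"
    and "plane_branch D1" and "plane_branch D2"
    and "\<not> same_germ 0 C1 C2" and "\<not> same_germ 0 D1 D2"
    and "contact C1 C2 \<noteq> contact D1 D2"
  shows "\<exists>\<alpha>. 0 < \<alpha> \<and> \<alpha> < 1 \<and>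
           \<not> holder_homeomorphic_germs \<alpha> (C1 \<union> C2) 0 (D1 \<union> D2) 0"
proof (rule ccontr)
  assume "\<not> ?thesis"
  then have holder: "holder_homeomorphic_germs \<alpha> (C1 \<union> C2) 0 (D1 \<union> D2) 0"
    if "0 < \<alpha>" "\<alpha> < 1" for \<alpha>
    using that by blast
  obtain e where C: "germ_pair C1 C2 e" using plane_branches_germ_pair[OF assms(1,2,5)] .
  obtain e' where D: "germ_pair D1 D2 e'" using plane_branches_germ_pair[OF assms(3,4,6)] .
  note conn = assms(1-4)[THEN plane_branch_connected_germ]
  have "0 \<in> C1 \<union> C2" using conn(1) by (simp add: connected_germ_def)
  then have holder': "holder_homeomorphic_germs \<alpha> (D1 \<union> D2) 0 (C1 \<union> C2) 0"
    if "0 < \<alpha>" "\<alpha> < 1" for \<alpha>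
    using holder_homeomorphic_germs_sym[OF holder[OF that]] by simp
  have "germ_pair.contact_limit C1 C2 = germ_pair.contact_limit D1 D2"
    using contact_limit_transfer[OF C D conn holder]
      contact_limit_transfer[OF D C conn(3,4,1,2) holder'] by blast
  then have "contact C1 C2 = contact D1 D2"
    using germ_pair.contact_eq[OF C] germ_pair.contact_eq[OF D] by simp
  then show False using assms(7) by simp
qed

end
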